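(* For every integers $p,k\geq1$ such that $p+k\leq n$, let $\widehat R_{p,n}$ denote the leave-$p$-out estimator of the classification error of the $k$NN classifier. Then for every $t>0$, $$\max\Big(\mathbb{P}\big(\widehat R_{p,n}-\mathbb{E}[\widehat R_{p,n}]>t\big),\ \mathbb{P}\big(\mathbb{E}[\widehat R_{p,n}]-\widehat R_{p,n}>t\big)\Big)\leq\exp\left(-(n-p+1)\frac{t^2}{\Delta^2k^2}\right),$$ where $\Delta=4\sqrt e\,\max\big(4\gamma_d\sqrt{2\kappa},\ \sqrt{2+16\gamma_d}\big)$. Furthermore, in the particular setting where $p>n/2+1$, for every $t>0$, $$\max\Big(\mathbb{P}\big(\widehat R_{p,n}-\mathbb{E}[\widehat R_{p,n}]>t\big),\ \mathbb{P}\big(\mathbb{E}[\widehat R_{p,n}]-\widehat R_{p,n}>t\big)\Big)\leq e\left\lfloor\frac n{n-p+1}\right\rfloor$$ $$\times\exp\left[-\frac1{2e}\min\left\{(n-p+1)\left\lfloor\frac n{n-p+1}\right\rfloor\frac{t^2}{4\Gamma^2k^{3/2}},\ \left((n-p+1)\left\lfloor\frac n{n-p+1}\right\rfloor^2\frac{t^2}{4\Gamma^2k^2}\right)^{1/3}\right\}\right],$$ where $\Gamma=2\sqrt{2e}\,\max\left(\sqrt{2\cdot\frac{128\kappa\gamma_d}{\sqrt{2\pi}}},\ 8\gamma_d\sqrt{2\kappa}\right)$.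
   Context: Let $\mathcal{X}\subset\mathbb{R}^d$ and let $\mathcal{D}_n=\{Z_1,\ldots,Z_n\}$, $Z_i=(X_i,Y_i)\in\mathcal{X}\times\{0,1\}$, be i.i.d. copies of a pair $(X,Y)$ with arbitrary distribution. $k$NN rule: for a sample $\mathcal{D}$ of at least $k$ labelled points and $x\in\mathbb{R}^d$, let $Y_{(1)}(x),\ldots,Y_{(k)}(x)$ be the labels of the $k$ points of the sample closest to $x$ in Euclidean norm (distance ties are broken by smallest index). Then $\mathcal{A}_k^{\mathcal{D}}(x)=1$ if $\frac1k\sum_{i=1}^kY_{(i)}(x)>\frac12$, $\mathcal{A}_k^{\mathcal{D}}(x)=0$ if $\frac1k\sum_{i=1}^kY_{(i)}(x)<\frac12$, and $\mathcal{A}_k^{\mathcal{D}}(x)$ is a Bernoulli$(1/2)$ variable otherwise (independent of the data and of the other such variables). Leave-$p$-out estimator: with $\mathcal{E}_{n-p}$ the set of subsets of $\{1,\ldots,n\}$ of cardinality $n-p$, $\bar e=\{1,\ldots,n\}\setminus e$ and $\mathcal{D}^e=\{Z_i\mid i\in e\}$, $$\widehat R_{p,n}=\binom np^{-1}\sum_{e\in\mathcal{E}_{n-p}}\Big(\frac1p\sum_{i\in\bar e}\mathbf{1}_{\{\mathcal{A}_k^{\mathcal{D}^e}(X_i)\neq Y_i\}}\Big).$$ $\gamma_d$ is the constant of Stone's lemma, depending only on $d$ (and growing exponentially with $d$): given finitely many points in $\mathbb{R}^d$ and $k\ge1$, any of these points belongs to the $k$ nearest neighbors of at most $k\gamma_d$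 of the other points. It is a standing convention that this property holds almost surely, under the tie-breaking in use, for all finite families of points drawn from the $X_i$'s and independent copies of them. $\kappa\leq1.271$ is a universal constant such that for every $q\geq2$, all independent $U_1,\ldots,U_N$ with independent copies $U_1',\ldots,U_N'$, and every measurable real function $f$, setting $\zeta=f(U_1,\ldots,U_N)$ and $\zeta_i'=f(U_1,\ldots,U_i',\ldots,U_N)$, one has $\|\zeta-\mathbb{E}\zeta\|_q\leq\sqrt{2\kappa q}\,\sqrt{\|\sum_{i=1}^N(\zeta-\zeta_i')^2\|_{q/2}}$, where $\|U\|_q=(\mathbb{E}|U|^q)^{1/q}$. *)

theory Defs
  imports "HOL-Probability.Probability"
begin

text \<open>
  A sample is a family of points indexed by natural numbers, restricted to a finite index set
  \<open>S\<close>; labels are Booleans, \<open>True\<close> standing for 1 and \<open>False\<close> for 0.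
\<close>

definition closer :: "(nat \<Rightarrow> real ^ 'd) \<Rightarrow> real ^ 'd \<Rightarrow> nat \<Rightarrow> nat \<Rightarrow> bool" where
  "closer x z j i \<longleftrightarrow> dist z (x j) < dist z (x i) \<or> (dist z (x j) = dist z (x i) \<and> j < i)"

text \<open>
  \<open>closer x z\<close> is a strict total order on indices, so the \<open>k\<close> nearest neighbours are the indices
  preceded by fewer than \<open>k\<close> others.
\<close>

definition nearest :: "nat \<Rightarrow> (nat \<Rightarrow> real ^ 'd) \<Rightarrow> nat set \<Rightarrow> real ^ 'd \<Rightarrow> nat set" where
  "nearest k x S z = {i \<in> S. card {j \<in> S. closer x z j i} < k}"

text \<open>The argument \<open>b\<close> is the outcome of the fair coin, used only when the vote is tied.\<close>

definition knn_classifier ::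
  "nat \<Rightarrow> (nat \<Rightarrow> real ^ 'd) \<Rightarrow> (nat \<Rightarrow> bool) \<Rightarrow> nat set \<Rightarrow> bool \<Rightarrow> real ^ 'd \<Rightarrow> bool" where
  "knn_classifier k x y S b z =
     (let v = 1 / real k * (\<Sum>i\<in>nearest k x S z. of_bool (y i))
      in if v > 1 / 2 then True else if v < 1 / 2 then False else b)"

definition training_sets :: "nat \<Rightarrow> nat \<Rightarrow> nat set set" where
  "training_sets n p = {e. e \<subseteq> {1..n} \<and> card e = n - p}"

definition lpo_coins :: "nat \<Rightarrow> nat \<Rightarrow> (nat set \<times> nat) set" where
  "lpo_coins n p = (SIGMA e : training_sets n p. {1..n} - e)"

text \<open>
  The leave-\<open>p\<close>-out estimator evaluates one classifier for each pair of a training set \<open>e\<close> and a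
  test index \<open>i\<close> outside \<open>e\<close>; each such evaluation has its own coin \<open>b (e, i)\<close>.
\<close>

definition lpo ::
  "nat \<Rightarrow> nat \<Rightarrow> nat \<Rightarrow> (nat \<Rightarrow> real ^ 'd) \<Rightarrow> (nat \<Rightarrow> bool) \<Rightarrow> (nat set \<times> nat \<Rightarrow> bool) \<Rightarrow> real" where
  "lpo n p k x y b =
     inverse (real (n choose p)) *
     (\<Sum>e\<in>training_sets n p.
        1 / real p * (\<Sum>i\<in>{1..n} - e. of_bool (knn_classifier k x y e (b (e, i)) (x i) \<noteq> y i)))"

text \<open>
  Stone's property for the points \<open>x 0, \<dots>, x (m - 1)\<close>: each of them is among the \<open>k\<close> nearest
  neighbours of at most \<open>k * \<gamma>\<close> of the others (the neighbours of a point being searched among the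
  remaining points).
\<close>

definition stone_property :: "real \<Rightarrow> nat \<Rightarrow> (nat \<Rightarrow> real ^ 'd) \<Rightarrow> bool" where
  "stone_property \<gamma> m x \<longleftrightarrow>
     (\<forall>k\<ge>1. \<forall>j<m.
        real (card {i \<in> {..<m} - {j}. j \<in> nearest k x ({..<m} - {i}) (x i)}) \<le> real k * \<gamma>)"

text \<open>
  Stone's lemma is deterministic only for points without distance ties: many coinciding points,
  with ties broken by index, violate it for every constant.
\<close>

definition stone_constant :: "'d::finite itself \<Rightarrow> real \<Rightarrow> bool" where
  "stone_constant _ \<gamma> \<longleftrightarrow>
     (\<forall>m (x :: nat \<Rightarrow> real ^ 'd).
        (\<forall>i<m. inj_on (\<lambda>j. dist (x i) (x j)) {..<m}) \<longrightarrow> stone_property \<gamma> m x)"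

definition Lnorm :: "'a measure \<Rightarrow> real \<Rightarrow> ('a \<Rightarrow> real) \<Rightarrow> real" where
  "Lnorm M q U = (\<integral>\<omega>. \<bar>U \<omega>\<bar> powr q \<partial>M) powr (1 / q)"

text \<open>
  The generalized Efron-Stein moment inequality, for independent variables \<open>U\<^sub>0, \<dots>, U\<^sub>N\<^sub>-\<^sub>1\<close> with
  values in arbitrary measurable spaces over the type \<open>'u\<close>.  As it only involves their law, the
  variables and their independent copies are taken to be the coordinates \<open>u i\<close> and \<open>u' i\<close> of a
  product space.  When \<open>f\<close> is not in \<open>L\<^sup>q\<close>, the Bochner integral on the left is 0 and the
  inequality imposes nothing.  The type \<open>'u\<close> is an argument because a hypothesis cannot quantify
  over types; if it has the cardinality of the continuum, no generality is lost, since a real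
  measurable function of \<open>N\<close> variables always factors through Cantor spaces.
\<close>

definition moment_constant :: "'u itself \<Rightarrow> real \<Rightarrow> bool" where
  "moment_constant _ \<kappa> \<longleftrightarrow>
     (\<forall>(N :: nat) (P :: nat \<Rightarrow> 'u measure) f q.
        (\<forall>i<N. prob_space (P i)) \<longrightarrow> f \<in> borel_measurable (Pi\<^sub>M {..<N} P) \<longrightarrow> 2 \<le> q \<longrightarrow>
        (let Q = Pi\<^sub>M {..<N} P in
           Lnorm Q q (\<lambda>u. f u - (\<integral>v. f v \<partial>Q))
           \<le> sqrt (2 * \<kappa> * q) *
             sqrt (Lnorm (Q \<Otimes>\<^sub>M Q) (q / 2)
                     (\<lambda>(u, u'). \<Sum>i<N. (f u - f (u(i := u' i)))\<^sup>2))))"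

definition Delta :: "real \<Rightarrow> real \<Rightarrow> real" where
  "Delta \<gamma> \<kappa> = 4 * sqrt (exp 1) * max (4 * \<gamma> * sqrt (2 * \<kappa>)) (sqrt (2 + 16 * \<gamma>))"

definition Gamma_const :: "real \<Rightarrow> real \<Rightarrow> real" where
  "Gamma_const \<gamma> \<kappa> =
     2 * sqrt (2 * exp 1) *
     max (sqrt (2 * (128 * \<kappa> * \<gamma> / sqrt (2 * pi)))) (8 * \<gamma> * sqrt (2 * \<kappa>))"

end

theory Submission
  imports Defs "HOL-Combinatorics.Permutations"
begin

text \<open>
  With \<open>m = n - p + 1\<close>, the leave-\<open>p\<close>-out estimator is the average over all \<open>m\<close>-subsets \<open>v\<close> of the
  leave-one-out error \<open>h v\<close> of the sample restricted to \<open>v\<close>; equivalently, it is an average over permutations of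
  means of \<open>r\<close> leave-one-out errors on disjoint, hence independent, blocks whenever \<open>r * m \<le> n\<close>.  By
  Jensen's inequality its exponential moments are bounded by the \<open>r\<close>-th power of those of one block.

  By Stone's property, replacing one observation changes the error of a block by at most \<open>(1 + 2 k \<gamma>) / m\<close>,
  and replacing one coin by at most \<open>1 / m\<close>, so the generalized Efron-Stein inequality bounds all moments
  and makes the error of a block subgaussian with variance proxy of order \<open>\<kappa> \<gamma>\<^sup>2 k\<^sup>2 / m\<close>.  Taking \<open>r = 1\<close> gives
  the first inequality.

  For the second one, the variance of a block is smaller by a factor of order \<open>sqrt k\<close>: an observation changes the
  prediction at a test point only if the vote there is nearly tied, which has probability of order
  \<open>1 / sqrt k\<close>, because given the distance of the \<open>k + 1\<close>-st neighbour the \<open>k\<close> nearest labels are i.i.d.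
  A Bernstein bound for one block, with \<open>r = n div m\<close>, then yields the claim.
\<close>

section \<open>Nearest neighbours in a strict total order\<close>

text \<open>Put \<open>T = t / scale\<close>, with
  \<open>scale = k * sqrt (\<kappa> * \<gamma>\<^sup>2 / m)\<close> the natural size of the
  fluctuations of one block. Up to a constant, \<open>A\<close> is
  \<open>r * T\<^sup>2 * sqrt k\<close>, the Gaussian exponent of a mean of \<open>r\<close>
  independent blocks of variance \<open>scale\<^sup>2 / sqrt k\<close>, while \<open>B\<close> grows
  only like \<open>(r * T) powr (2 / 3)\<close>. The factor \<open>sqrt k\<close> comes from the
  squared influence of an observation: one factor keeps the worst case \<open>k * \<gamma>\<close>
  of Stone's property, the other is replaced by its mean, of order \<open>sqrt k\<close>. Only the
  variance improves; the tail of a block still has the worst-case size, so it is truncated at a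
  multiple of \<open>scale * sqrt (ln k)\<close>, and the resulting logarithm must be absorbed. This
  works because the prefactor \<open>exp 1 * r\<close> makes the claim trivial unless
  \<open>min A B > 2 * exp 1 * (1 + ln r)\<close>. Distance ties are the obstacle to the mean
  influence: with ties broken by index, the neighbours are not selected by an order on the values
  alone, which is what conditioning on the next neighbour requires.\<close>

definition firsts :: "nat \<Rightarrow> ('i \<Rightarrow> 'i \<Rightarrow> bool) \<Rightarrow> 'i set \<Rightarrow> 'i set" where
  "firsts k lt S = {i \<in> S. card {j \<in> S. lt j i} < k}"

text \<open>Totality is required on \<open>S\<close> only, since orders given by real keys or by a
  random sample are free of ties on that set alone. Working with an abstract order covers
  tie-breaking by index and by random keys alike.\<close>

locale strict_total_on =
  fixes lt :: "'i \<Rightarrow> 'i \<Rightarrow> bool" and S :: "'i set"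
  assumes fin: "finite S"
    and lt_irrefl: "i \<in> S \<Longrightarrow> \<not> lt i i"
    and lt_trans: "\<lbrakk>i \<in> S; j \<in> S; l \<in> S; lt i j; lt j l\<rbrakk> \<Longrightarrow> lt i l"
    and lt_total: "\<lbrakk>i \<in> S; j \<in> S; i \<noteq> j\<rbrakk> \<Longrightarrow> lt i j \<or> lt j i"
begin

lemma card_below_less:
  assumes "i \<in> S" "j \<in> S" "lt i j"
  shows "card {l \<in> S. lt l i} < card {l \<in> S. lt l j}"
proof (rule psubset_card_mono)
  show "{l \<in> S. lt l i} \<subset> {l \<in> S. lt l j}"
    using assms lt_irrefl lt_trans by blast
qed (use fin in simp)

text \<open>Ranks increase strictly along the order, hence the rank map is injective; its values lie
  below \<open>card S\<close>, so surjectivity follows by counting.\<close>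

lemma bij_betw_card_below: "bij_betw (\<lambda>i. card {j \<in> S. lt j i}) S {..<card S}"
proof -
  have inj: "inj_on (\<lambda>i. card {j \<in> S. lt j i}) S"
  proof (rule inj_onI, rule ccontr)
    fix i j
    assume ij: "i \<in> S" "j \<in> S" "card {l \<in> S. lt l i} = card {l \<in> S. lt l j}" "i \<noteq> j"
    from lt_total[OF ij(1,2,4)] show False
      using card_below_less[of i j] card_below_less[of j i] ij by auto
  qed
  have sub: "(\<lambda>i. card {j \<in> S. lt j i}) ` S \<subseteq> {..<card S}"
  proof safe
    fix i assume i: "i \<in> S"
    show "card {j \<in> S. lt j i} < card S"
      by (rule psubset_card_mono[OF fin]) (use i lt_irrefl in blast)
  qed
  have "(\<lambda>i. card {j \<in> S. lt j i}) ` S = {..<card S}"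
    by (rule card_subset_eq[OF _ sub]) (simp_all add: card_image[OF inj])
  with inj show ?thesis by (simp add: bij_betw_def)
qed

lemma card_firsts: "card (firsts k lt S) = min k (card S)"
proof -
  let ?r = "\<lambda>i. card {j \<in> S. lt j i}"
  have "bij_betw ?r (firsts k lt S) {..<min k (card S)}"
  proof (rule bij_betw_subset[OF bij_betw_card_below])
    have "?r ` firsts k lt S = {..<k} \<inter> ?r ` S"
      by (auto simp: firsts_def)
    also have "\<dots> = {..<min k (card S)}"
      unfolding bij_betw_imp_surj_on[OF bij_betw_card_below] by auto
    finally show "?r ` firsts k lt S = {..<min k (card S)}" .
  qed (auto simp: firsts_def)
  from bij_betw_same_card[OF this] show ?thesis by simp
qed

text \<open>An element \<open>i\<close> after \<open>j\<close> is preceded by everything before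
  \<open>j\<close>, that is by at least \<open>k\<close> elements other than \<open>j\<close>, so it
  is selected neither with nor without \<open>j\<close>. The rank of an element not after
  \<open>j\<close> does not see the removal.\<close>

lemma firsts_remove:
  assumes "j \<notin> firsts k lt S"
  shows "firsts k lt S = firsts k lt (S - {j})"
proof (cases "j \<in> S")
  case True
  then have kj: "k \<le> card {l \<in> S. lt l j}" using assms by (auto simp: firsts_def)
  have le: "card {l \<in> S - {j}. lt l i} \<le> card {l \<in> S. lt l i}" for i
    by (rule card_mono) (use fin in auto)
  show ?thesis
  proof (intro equalityI subsetI)
    fix i assume "i \<in> firsts k lt S"
    then show "i \<in> firsts k lt (S - {j})"
      using le[of i] assms by (auto simp: firsts_def)
  next
    fix i assume i: "i \<in> firsts k lt (S - {j})"
    show "i \<in> firsts k lt S"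
    proof (cases "lt j i")
      case True
      have "{l \<in> S. lt l j} \<subseteq> {l \<in> S - {j}. lt l i}"
        using True \<open>j \<in> S\<close> i lt_trans lt_irrefl unfolding firsts_def by blast
      then have "card {l \<in> S. lt l j} \<le> card {l \<in> S - {j}. lt l i}"
        by (rule card_mono[rotated]) (use fin in auto)
      then show ?thesis using i kj by (auto simp: firsts_def)
    next
      case False
      then have "{l \<in> S. lt l i} = {l \<in> S - {j}. lt l i}" by auto
      then show ?thesis using i by (auto simp: firsts_def)
    qed
  qed
qed (auto simp: firsts_def)

text \<open>Putting \<open>j\<close> back raises a rank by at most one.\<close>

lemma firsts_remove_subset: "firsts (k - 1) lt (S - {j}) \<subseteq> firsts k lt S"
proof
  fix i assume i: "i \<in> firsts (k - 1) lt (S - {j})"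
  have "card {l \<in> S. lt l i} \<le> card (insert j {l \<in> S - {j}. lt l i})"
    by (rule card_mono) (use fin in auto)
  also have "\<dots> \<le> Suc (card {l \<in> S - {j}. lt l i})"
    using fin by (auto simp: card_insert_if)
  finally show "i \<in> firsts k lt S" using i by (auto simp: firsts_def)
qed

end

lemma firsts_cong:
  "(\<And>i j. i \<in> S \<Longrightarrow> j \<in> S \<Longrightarrow> lt i j = lt' i j) \<Longrightarrow> firsts k lt S = firsts k lt' S"
proof -
  assume "\<And>i j. i \<in> S \<Longrightarrow> j \<in> S \<Longrightarrow> lt i j = lt' i j"
  then have "{j \<in> S. lt j i} = {j \<in> S. lt' j i}" if "i \<in> S" for i using that by auto
  then show ?thesis unfolding firsts_def by (intro Collect_cong conj_cong) auto
qed

lemma firsts_reindex: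
  assumes "inj_on f T"
  shows "firsts k lt (f ` T) = f ` firsts k (\<lambda>i j. lt (f i) (f j)) T"
proof -
  have "{j \<in> f ` T. lt j (f i)} = f ` {j \<in> T. lt (f j) (f i)}" for i by auto
  moreover have "card (f ` {j \<in> T. lt (f j) (f i)}) = card {j \<in> T. lt (f j) (f i)}" for i
    by (rule card_image) (rule inj_on_subset[OF assms], auto)
  ultimately show ?thesis by (auto simp: firsts_def)
qed

lemma nearest_eq_firsts: "nearest k x S z = firsts k (closer x z) S"
  by (simp add: nearest_def firsts_def)

lemma strict_total_on_closer: "finite S \<Longrightarrow> strict_total_on (closer x z) S"
  by unfold_locales (auto simp: closer_def)

lemma nearest_subset: "nearest k x S z \<subseteq> S"
  by (auto simp: nearest_def)

lemma nearest_cong: "(\<And>i. i \<in> S \<Longrightarrow> x i = x' i) \<Longrightarrow> nearest k x S z = nearest k x' S z"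
  unfolding nearest_eq_firsts by (rule firsts_cong) (simp add: closer_def)

section \<open>Votes, near ties and the effect of replacing one observation\<close>

definition votes :: "nat \<Rightarrow> (nat \<Rightarrow> real ^ 'd) \<Rightarrow> (nat \<Rightarrow> bool) \<Rightarrow> nat set \<Rightarrow> real ^ 'd \<Rightarrow> real" where
  "votes k x y S z = (\<Sum>i\<in>nearest k x S z. of_bool (y i))"

text \<open>The margin 1 is the most by which one replaced observation can change the vote, so every
  change of prediction happens within it.\<close>

definition close_call :: "nat \<Rightarrow> (nat \<Rightarrow> real ^ 'd) \<Rightarrow> (nat \<Rightarrow> bool) \<Rightarrow> nat set \<Rightarrow> real ^ 'd \<Rightarrow> bool" where
  "close_call k x y S z \<longleftrightarrow> \<bar>votes k x y S z - real k / 2\<bar> \<le> 1"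

lemma knn_classifier_votes:
  assumes "k \<ge> 1"
  shows "knn_classifier k x y S b z =
    (if votes k x y S z > real k / 2 then True else if votes k x y S z < real k / 2 then False else b)"
  using assms by (simp add: knn_classifier_def votes_def Let_def field_simps)

text \<open>The \<open>k - 1\<close> nearest points after deletion of \<open>j\<close> are among the
  \<open>k\<close> nearest of all, and exactly one neighbour is left over. The point of the form is
  that \<open>a\<close> ignores observation \<open>j\<close>: two samples that differ only at
  \<open>j\<close> have both votes in the same interval of length 1.\<close>

lemma votes_bounds:
  fixes x :: "nat \<Rightarrow> real ^ 'd"
  assumes "finite S" "k \<ge> 1" "k \<le> card S"
  defines "a \<equiv> \<lambda>(x :: nat \<Rightarrow> real ^ 'd) y z j. (\<Sum>i\<in>nearest (k - 1) x (S - {j}) z. of_bool (y i)) :: real"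
  shows "a x y z j \<le> votes k x y S z" "votes k x y S z \<le> a x y z j + 1"
proof -
  interpret strict_total_on "closer x z" S by (rule strict_total_on_closer) fact
  interpret T: strict_total_on "closer x z" "S - {j}" by (rule strict_total_on_closer) (use assms in simp)
  let ?A = "nearest (k - 1) x (S - {j}) z" and ?B = "nearest k x S z"
  have sub: "?A \<subseteq> ?B" unfolding nearest_eq_firsts by (rule firsts_remove_subset)
  have fB: "finite ?B" using assms by (auto intro: finite_subset[OF nearest_subset])
  have cA: "card ?A = k - 1" unfolding nearest_eq_firsts T.card_firsts
    using assms by (cases "j \<in> S") (auto simp: min_def)
  have cB: "card ?B = k" unfolding nearest_eq_firsts card_firsts using assms by auto
  have c: "card (?B - ?A) = 1"
    using card_Diff_subset[OF finite_subset[OF sub fB] sub] cA cB assms by simp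
  have eq: "votes k x y S z = a x y z j + (\<Sum>i\<in>?B - ?A. of_bool (y i))"
    unfolding votes_def a_def using sum.subset_diff[OF sub fB] by (simp add: add.commute)
  show "a x y z j \<le> votes k x y S z" unfolding eq by (simp add: sum_nonneg)
  have "(\<Sum>i\<in>?B - ?A. of_bool (y i)) \<le> (\<Sum>i\<in>?B - ?A. 1 :: real)" by (rule sum_mono) simp
  then show "votes k x y S z \<le> a x y z j + 1" unfolding eq using c by simp
qed

text \<open>If \<open>j\<close> is a neighbour in neither sample, both neighbourhoods coincide with
  the one computed without \<open>j\<close> and nothing changes. So \<open>j\<close> is a neighbour
  in at least one sample, and the near tie holds in both.\<close>

lemma knn_flip:
  assumes S: "finite S" "k \<ge> 1" "k \<le> card S"
    and x: "\<And>i. i \<noteq> j \<Longrightarrow> x i = x' i" and y: "\<And>i. i \<noteq> j \<Longrightarrow> y i = y' i"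
    and flip: "knn_classifier k x y S b z \<noteq> knn_classifier k x' y' S b z"
  shows "j \<in> nearest k x S z \<and> close_call k x y S z \<or> j \<in> nearest k x' S z \<and> close_call k x' y' S z"
proof -
  have eq: "nearest l x (S - {j}) z = nearest l x' (S - {j}) z" for l
    by (rule nearest_cong) (simp add: x)
  have "j \<in> nearest k x S z \<or> j \<in> nearest k x' S z"
  proof (rule ccontr)
    assume n: "\<not> ?thesis"
    have "nearest k x S z = nearest k x (S - {j}) z" "nearest k x' S z = nearest k x' (S - {j}) z"
      using n unfolding nearest_eq_firsts
      by (intro strict_total_on.firsts_remove[OF strict_total_on_closer[OF S(1)]], simp)+
    then have "nearest k x S z = nearest k x' S z"
      using eq[of k] by simp
    moreover have "(\<Sum>i\<in>nearest k x S z. of_bool (y i)) = (\<Sum>i\<in>nearest k x S z. of_bool (y' i) :: real)"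
    proof (rule sum.cong)
      fix i assume "i \<in> nearest k x S z"
      then have "y i = y' i" using n by (intro y) auto
      then show "of_bool (y i) = (of_bool (y' i) :: real)" by simp
    qed simp
    ultimately have "knn_classifier k x y S b z = knn_classifier k x' y' S b z"
      unfolding knn_classifier_def by simp
    with flip show False by simp
  qed
  moreover
  have "(\<Sum>i\<in>nearest (k - 1) x (S - {j}) z. of_bool (y i)) = (\<Sum>i\<in>nearest (k - 1) x' (S - {j}) z. of_bool (y' i) :: real)"
    unfolding eq
  proof (rule sum.cong)
    fix i assume "i \<in> nearest (k - 1) x' (S - {j}) z"
    then have "y i = y' i" using nearest_subset by (intro y) blast
    then show "of_bool (y i) = (of_bool (y' i) :: real)" by simp
  qed simp
  then have "\<bar>votes k x y S z - votes k x' y' S z\<bar> \<le> 1"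
    using votes_bounds[OF S, where x=x and j=j and z=z and y=y] votes_bounds[OF S, where x=x' and j=j and z=z and y=y'] by linarith
  \<comment> \<open>With the same coin, different predictions put the votes on different sides of
    \<open>k / 2\<close>, or one of them on it; as they differ by at most 1, both are within 1 of
    \<open>k / 2\<close>.\<close>
  then have "close_call k x y S z \<and> close_call k x' y' S z"
    using flip unfolding knn_classifier_votes[OF S(2)] close_call_def by (auto split: if_splits)
  ultimately show ?thesis by blast
qed

section \<open>Exponential moments of bounded variables\<close>

text \<open>For a centered variable the linear term integrates to 0, so that moments of even order
  alone control the exponential moment.\<close>

lemma exp_le_add_exp_square: "exp x \<le> x + exp (x\<^sup>2)" for x :: real
proof -
  have e2: "1 + x\<^sup>2 \<le> exp (x\<^sup>2)" by (rule exp_ge_add_one_self)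
  consider "x \<le> -1" | "-1 \<le> x" "x \<le> 0" | "0 \<le> x" "x \<le> 1" | "1 \<le> x" by linarith
  then show ?thesis
  proof cases
    case 1
    then have "(- x) * 1 \<le> (- x) * (- x)" by (intro mult_left_mono) auto
    then have "- x \<le> x\<^sup>2" by (simp add: power2_eq_square)
    moreover have "exp x \<le> 1" using 1 by simp
    ultimately show ?thesis using e2 by linarith
  next
    case 2
    define y where "y = - x"
    have y: "0 \<le> y" "y \<le> 1" using 2 by (auto simp: y_def)
    \<comment> \<open>The product is \<open>1 + y ^ 3\<close>.\<close>
    have "1 \<le> (1 + y) * (1 - y + y\<^sup>2)"
      using y by (simp add: algebra_simps power2_eq_square)
    moreover have "(1 + y) * (1 - y + y\<^sup>2) \<le> exp y * (1 - y + y\<^sup>2)"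
      using y by (intro mult_right_mono exp_ge_add_one_self) auto
    ultimately have "1 \<le> exp y * (1 - y + y\<^sup>2)" by linarith
    then have "exp x \<le> 1 - y + y\<^sup>2" unfolding y_def by (simp add: exp_minus field_simps)
    then have "exp x \<le> 1 + x + x\<^sup>2" by (simp add: y_def)
    then show ?thesis using e2 by linarith
  next
    case 3
    then show ?thesis using exp_bound[of x] e2 by linarith
  next
    case 4
    then have "x \<le> x\<^sup>2" by (simp add: power2_eq_square)
    then have "exp x \<le> exp (x\<^sup>2)" by simp
    then show ?thesis using 4 by linarith
  qed
qed

lemma exp_le_quadratic: "exp x \<le> 1 + x + x\<^sup>2 / 2 * exp \<bar>x\<bar>" for x :: real
proof -
  obtain t where t: "\<bar>t\<bar> \<le> \<bar>x\<bar>" and e: "exp x = (\<Sum>m<2. x ^ m / fact m) + exp t / fact 2 * x ^ 2"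
    using Maclaurin_exp_le[of x 2] by auto
  have "exp x = 1 + x + exp t * (x\<^sup>2 / 2)" using e by (simp add: numeral_2_eq_2)
  moreover have "exp t * (x\<^sup>2 / 2) \<le> exp \<bar>x\<bar> * (x\<^sup>2 / 2)"
    using t by (intro mult_right_mono) auto
  ultimately show ?thesis by (simp add: mult.commute)
qed

text \<open>The quotient of \<open>j ^ j\<close> by \<open>fact j\<close> is a single term of the
  exponential series at \<open>j\<close>.\<close>

lemma power_self_le_exp_fact: "real j ^ j \<le> exp 1 ^ j * fact j"
proof -
  have "real j ^ j /\<^sub>R fact j \<le> (\<Sum>n. real j ^ n /\<^sub>R fact n)"
    using sum_le_suminf[OF summable_exp_generic, of "{j}" "real j"] by simp
  also have "\<dots> = exp (real j)" by (simp add: exp_def)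
  also have "\<dots> = exp 1 ^ j" by (simp add: exp_of_nat_mult[symmetric])
  finally show ?thesis by (simp add: field_simps)
qed

text \<open>The bound by 1 provides integrability; the quantitative input is the growth of the even
  moments, that of a subgaussian variable of variance proxy of order \<open>a\<close>.\<close>

locale moment_bounded = prob_space +
  fixes W :: "'a \<Rightarrow> real" and a :: real
  assumes W[measurable]: "W \<in> borel_measurable M"
    and W_bounded: "\<And>x. x \<in> space M \<Longrightarrow> \<bar>W x\<bar> \<le> 1"
    and W_centered: "expectation W = 0"
    and a_pos: "a > 0"
    and W_moments: "\<And>j. j \<ge> 1 \<Longrightarrow> expectation (\<lambda>x. W x ^ (2 * j)) \<le> (a * real j) ^ j"
begin

lemma integrable_W: "integrable M W"
  by (rule integrable_const_bound[where B = 1]) (auto intro: W_bounded)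

lemma integrable_exp: "integrable M (\<lambda>x. exp (t * W x))"
proof (rule integrable_const_bound[where B = "exp \<bar>t\<bar>"])
  show "AE x in M. norm (exp (t * W x)) \<le> exp \<bar>t\<bar>"
  proof (rule AE_I2)
    fix x assume "x \<in> space M"
    then have "\<bar>t\<bar> * \<bar>W x\<bar> \<le> \<bar>t\<bar> * 1"
      by (intro mult_left_mono W_bounded) auto
    then have "t * W x \<le> \<bar>t\<bar>"
      using abs_ge_self[of "t * W x"] by (simp add: abs_mult)
    then show "norm (exp (t * W x)) \<le> exp \<bar>t\<bar>" by simp
  qed
qed measurable

lemma W_power_bounded: "x \<in> space M \<Longrightarrow> \<bar>W x ^ j\<bar> \<le> 1"
  using W_bounded by (simp add: power_abs power_le_one)

lemma integrable_W_power: "integrable M (\<lambda>x. W x ^ j)"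
  by (rule integrable_const_bound[where B = 1]) (auto intro: W_power_bounded)

lemma integrable_exp_square: "integrable M (\<lambda>x. exp (s * (W x)\<^sup>2))"
proof (rule integrable_const_bound[where B = "exp \<bar>s\<bar>"])
  show "AE x in M. norm (exp (s * (W x)\<^sup>2)) \<le> exp \<bar>s\<bar>"
  proof (rule AE_I2)
    fix x assume x: "x \<in> space M"
    have "s * (W x)\<^sup>2 \<le> \<bar>s\<bar> * (W x)\<^sup>2" by (intro mult_right_mono) auto
    also have "\<dots> \<le> \<bar>s\<bar> * 1" using W_power_bounded[OF x, of 2] by (intro mult_left_mono) auto
    finally show "norm (exp (s * (W x)\<^sup>2)) \<le> exp \<bar>s\<bar>" by simp
  qed
qed measurable

text \<open>Expanding the exponential, the term of order \<open>j\<close> has mean at most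
  \<open>s ^ j * (a * j) ^ j / fact j\<close>, hence at most the \<open>j\<close>-th power of
  \<open>s * a * exp 1\<close>; a geometric series remains.\<close>

lemma exp_square_moment:
  assumes s: "s \<ge> 0" "s * (a * exp 1) < 1"
  shows "expectation (\<lambda>x. exp (s * (W x)\<^sup>2)) \<le> 1 / (1 - s * (a * exp 1))"
proof -
  define q where "q = s * (a * exp 1)"
  have q: "0 \<le> q" "q < 1" using s a_pos by (auto simp: q_def)
  define f where "f j x = (s * (W x)\<^sup>2) ^ j / fact j" for j x
  have f_eq: "f j = (\<lambda>x. s ^ j / fact j * W x ^ (2 * j))" for j
    by (rule ext) (simp add: f_def power_mult_distrib power_mult)
  have f_nonneg: "f j x \<ge> 0" for j x using s by (simp add: f_def)
  have int: "integrable M (f j)" for j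
    unfolding f_eq by (intro integrable_mult_right integrable_W_power)
  have bound: "expectation (f j) \<le> q ^ j" for j
  proof (cases "j = 0")
    case True
    then show ?thesis by (simp add: f_eq prob_space)
  next
    case False
    have "expectation (f j) = s ^ j / fact j * expectation (\<lambda>x. W x ^ (2 * j))"
      unfolding f_eq by simp
    also have "\<dots> \<le> s ^ j / fact j * (a * real j) ^ j"
      using False s by (intro mult_left_mono W_moments) auto
    also have "\<dots> = (s * a) ^ j / fact j * real j ^ j" by (simp add: power_mult_distrib)
    also have "\<dots> \<le> (s * a) ^ j / fact j * (exp 1 ^ j * fact j)"
      using s a_pos by (intro mult_left_mono power_self_le_exp_fact) auto
    also have "\<dots> = q ^ j" by (simp add: q_def power_mult_distrib)
    finally show ?thesis .
  qed
  have sm: "(\<lambda>j. f j x) sums exp (s * (W x)\<^sup>2)" for x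
    using exp_converges[of "s * (W x)\<^sup>2"] by (simp add: f_def divide_inverse mult.commute)
  have nn: "\<And>j. expectation (\<lambda>x. norm (f j x)) = expectation (f j)"
    using f_nonneg by simp
  have smq: "summable (\<lambda>j. expectation (f j))"
    by (rule summable_comparison_test'[OF summable_geometric[of q]])
       (use q bound f_nonneg in auto)
  have "expectation (\<lambda>x. \<Sum>j. f j x) = (\<Sum>j. expectation (f j))"
  proof (rule integral_suminf[OF int])
    show "AE x in M. summable (\<lambda>j. norm (f j x))"
      using sm f_nonneg by (auto simp: sums_iff)
    show "summable (\<lambda>j. expectation (\<lambda>x. norm (f j x)))" unfolding nn by (rule smq)
  qed
  also have "\<dots> \<le> (\<Sum>j. q ^ j)"
    by (rule suminf_le[OF bound smq]) (use q in auto)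
  also have "\<dots> = 1 / (1 - q)" using q by (simp add: suminf_geometric)
  finally show ?thesis using sm by (simp add: q_def sums_iff)
qed

lemma exp_square_moment_half:
  assumes "s \<ge> 0" "s * (a * exp 1) \<le> 1 / 2"
  shows "expectation (\<lambda>x. exp (s * (W x)\<^sup>2)) \<le> 2"
proof -
  have "1 / (1 - s * (a * exp 1)) \<le> 2" using assms by (simp add: field_simps)
  then show ?thesis using exp_square_moment[of s] assms by linarith
qed

text \<open>For small \<open>t\<close>, \<open>exp_le_add_exp_square\<close> and
  \<open>1 / (1 - y) \<le> exp (2 * y)\<close> on the interval from 0 to 1/2 suffice. For large
  \<open>t\<close>, \<open>t * W\<close> is split by the inequality of arithmetic and geometric
  means, the weight being chosen so that the square-exponential moment is at most 2.\<close>

lemma subgaussian_mgf: "expectation (\<lambda>x. exp (t * W x)) \<le> exp (2 * (a * exp 1) * t\<^sup>2)"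
proof (cases "t\<^sup>2 * (a * exp 1) \<le> 1 / 2")
  case True
  define y where "y = t\<^sup>2 * (a * exp 1)"
  have y: "0 \<le> y" "y \<le> 1 / 2" using True a_pos by (auto simp: y_def)
  have "expectation (\<lambda>x. exp (t * W x)) \<le> expectation (\<lambda>x. t * W x + exp (t\<^sup>2 * (W x)\<^sup>2))"
    using exp_le_add_exp_square[of "t * W _"]
    by (intro integral_mono integrable_exp Bochner_Integration.integrable_add integrable_exp_square
        integrable_mult_right integrable_W) (simp add: power_mult_distrib)
  also have "\<dots> = expectation (\<lambda>x. exp (t\<^sup>2 * (W x)\<^sup>2))"
    by (subst Bochner_Integration.integral_add)
       (auto intro: integrable_exp_square integrable_W simp: W_centered)
  also have "\<dots> \<le> 1 / (1 - y)"
    unfolding y_def by (rule exp_square_moment) (use True in auto)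
  also have "\<dots> \<le> exp (2 * y)"
  proof -
    have "y * (y * 2) \<le> y * 1" using y by (intro mult_left_mono) auto
    then have "1 \<le> (1 - y) * (1 + 2 * y)" by (simp add: algebra_simps)
    also have "\<dots> \<le> (1 - y) * exp (2 * y)"
      using y by (intro mult_left_mono exp_ge_add_one_self) auto
    finally show ?thesis using y by (simp add: field_simps)
  qed
  finally show ?thesis by (simp add: y_def mult_ac)
next
  case False
  define c where "c = a * exp 1"
  have c: "c > 0" using a_pos by (simp add: c_def)
  have pt: "t * w \<le> t\<^sup>2 * c / 2 + w\<^sup>2 / (2 * c)" for w
  proof -
    have "0 \<le> (t * c - w)\<^sup>2" by simp
    then have "2 * c * (t * w) \<le> t\<^sup>2 * c\<^sup>2 + w\<^sup>2" by (simp add: power2_eq_square algebra_simps)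
    then show ?thesis using c by (simp add: field_simps power2_eq_square)
  qed
  have "expectation (\<lambda>x. exp (t * W x))
    \<le> expectation (\<lambda>x. exp (t\<^sup>2 * c / 2) * exp ((1 / (2 * c)) * (W x)\<^sup>2))"
    by (intro integral_mono integrable_exp integrable_mult_right integrable_exp_square)
       (use pt in \<open>simp add: exp_add[symmetric]\<close>)
  also have "\<dots> \<le> exp (t\<^sup>2 * c / 2) * 2"
    using c by (simp, intro exp_square_moment_half[of "1 / (2 * c)", simplified]) (auto simp: c_def)
  \<comment> \<open>In this case \<open>t\<^sup>2 * c\<close> exceeds 1/2, which is enough to absorb
    the factor 2, as \<open>2 \<le> exp (3 / 4)\<close>.\<close>
  also have "\<dots> \<le> exp (t\<^sup>2 * c / 2) * exp (3 / 2 * (t\<^sup>2 * c))"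
  proof (rule mult_left_mono)
    have "2 \<le> 1 + 3 / 4 + (3/4)\<^sup>2 / (2::real)" by (simp add: power2_eq_square)
    also have "\<dots> \<le> exp (3 / 4)" by (rule exp_lower_Taylor_quadratic) simp
    also have "\<dots> \<le> exp (3 / 2 * (t\<^sup>2 * c))"
    proof -
      have "1 / 2 \<le> t\<^sup>2 * c" using False unfolding c_def by linarith
      then show ?thesis unfolding exp_le_cancel_iff by linarith
    qed
    finally show "2 \<le> exp (3 / 2 * (t\<^sup>2 * c))" .
  qed simp
  also have "\<dots> = exp (2 * c * t\<^sup>2)" by (simp add: exp_add[symmetric] algebra_simps)
  finally show ?thesis by (simp add: c_def)
qed

text \<open>
  The variance controls the part \<open>\<bar>W\<bar> \<le> L\<close> of the exponential moment; beyond \<open>L\<close>, square-exponential integrability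
  gains the factor \<open>exp (- (s * L\<^sup>2))\<close>.
\<close>

lemma bernstein_mgf:
  assumes v: "expectation (\<lambda>x. (W x)\<^sup>2) \<le> v"
    and s: "s > 0" "3 * s * (a * exp 1) \<le> 1 / 2" and L: "L \<ge> 0"
  shows "expectation (\<lambda>x. exp (t * W x))
    \<le> 1 + t\<^sup>2 / 2 * (v * exp (\<bar>t\<bar> * L) + 2 / s * exp (t\<^sup>2 / (4 * s)) * exp (- (s * L\<^sup>2)))"
proof -
  let ?b = "\<lambda>x. (W x)\<^sup>2 * exp (\<bar>t\<bar> * L) +
      1 / s * exp (t\<^sup>2 / (4 * s)) * exp (- (s * L\<^sup>2)) * exp (3 * s * (W x)\<^sup>2)"
  \<comment> \<open>For \<open>\<bar>w\<bar> > L\<close> the exponent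
    \<open>3 * s * w\<^sup>2\<close> is spent in three equal shares: one pays for the factor
    \<open>w\<^sup>2\<close>, one for the splitting of \<open>\<bar>t\<bar> * \<bar>w\<bar>\<close>,
    and one, being at least \<open>s * L\<^sup>2\<close>, yields the small factor.\<close>
  have pt: "w\<^sup>2 * exp (\<bar>t\<bar> * \<bar>w\<bar>) \<le> w\<^sup>2 * exp (\<bar>t\<bar> * L) +
      1 / s * exp (t\<^sup>2 / (4 * s)) * exp (- (s * L\<^sup>2)) * exp (3 * s * w\<^sup>2)" for w
  proof (cases "\<bar>w\<bar> \<le> L")
    case True
    then have "w\<^sup>2 * exp (\<bar>t\<bar> * \<bar>w\<bar>) \<le> w\<^sup>2 * exp (\<bar>t\<bar> * L)"
      by (intro mult_left_mono) (auto intro: mult_left_mono)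
    moreover have "0 \<le> 1 / s * exp (t\<^sup>2 / (4 * s)) * exp (- (s * L\<^sup>2)) * exp (3 * s * w\<^sup>2)"
      using s by simp
    ultimately show ?thesis by linarith
  next
    case False
    have 1: "\<bar>t\<bar> * \<bar>w\<bar> \<le> t\<^sup>2 / (4 * s) + s * w\<^sup>2"
    proof -
      have "0 \<le> (\<bar>t\<bar> - 2 * s * \<bar>w\<bar>)\<^sup>2" by simp
      then have "4 * s * (\<bar>t\<bar> * \<bar>w\<bar>) \<le> t\<^sup>2 + 4 * s\<^sup>2 * w\<^sup>2"
        by (simp add: power2_diff power_mult_distrib algebra_simps)
      then show ?thesis using s by (simp add: field_simps power2_eq_square)
    qed
    have "s * L\<^sup>2 \<le> s * w\<^sup>2" using False L s by (simp add: abs_le_square_iff[symmetric])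
    then have 2: "exp (\<bar>t\<bar> * \<bar>w\<bar>) \<le> exp (t\<^sup>2 / (4 * s)) * exp (- (s * L\<^sup>2)) * exp (2 * s * w\<^sup>2)"
      using 1 by (simp add: exp_add[symmetric])
    have "s * w\<^sup>2 \<le> exp (s * w\<^sup>2)" using exp_ge_add_one_self[of "s * w\<^sup>2"] by linarith
    then have 3: "w\<^sup>2 \<le> 1 / s * exp (s * w\<^sup>2)" using s by (simp add: field_simps)
    have "w\<^sup>2 * exp (\<bar>t\<bar> * \<bar>w\<bar>) \<le> (1 / s * exp (s * w\<^sup>2)) *
        (exp (t\<^sup>2 / (4 * s)) * exp (- (s * L\<^sup>2)) * exp (2 * s * w\<^sup>2))"
      by (rule mult_mono[OF 3 2]) (use s in auto)
    also have "\<dots> = 1 / s * exp (t\<^sup>2 / (4 * s)) * exp (- (s * L\<^sup>2)) * (exp (s * w\<^sup>2) * exp (2 * s * w\<^sup>2))"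
      by (simp only: mult_ac)
    also have "exp (s * w\<^sup>2) * exp (2 * s * w\<^sup>2) = exp (3 * s * w\<^sup>2)"
      by (simp add: exp_add[symmetric])
    finally show ?thesis by (simp add: add_increasing)
  qed
  have pt': "exp (t * w) \<le> 1 + t * w + t\<^sup>2 / 2 * (w\<^sup>2 * exp (\<bar>t\<bar> * L) +
      1 / s * exp (t\<^sup>2 / (4 * s)) * exp (- (s * L\<^sup>2)) * exp (3 * s * w\<^sup>2))" for w
  proof -
    have "exp (t * w) \<le> 1 + t * w + t\<^sup>2 / 2 * (w\<^sup>2 * exp (\<bar>t\<bar> * \<bar>w\<bar>))"
      using exp_le_quadratic[of "t * w"] by (simp add: power_mult_distrib abs_mult)
    also have "t\<^sup>2 / 2 * (w\<^sup>2 * exp (\<bar>t\<bar> * \<bar>w\<bar>)) \<le> t\<^sup>2 / 2 * (w\<^sup>2 * exp (\<bar>t\<bar> * L) +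
      1 / s * exp (t\<^sup>2 / (4 * s)) * exp (- (s * L\<^sup>2)) * exp (3 * s * w\<^sup>2))"
      by (rule mult_left_mono[OF pt]) simp
    finally show ?thesis by simp
  qed
  note [intro!] = integrable_W integrable_W_power integrable_exp_square integrable_mult_right
    integrable_mult_left Bochner_Integration.integrable_add
  have b_int: "integrable M ?b" by auto
  have "expectation ?b = expectation (\<lambda>x. (W x)\<^sup>2) * exp (\<bar>t\<bar> * L) +
      1 / s * exp (t\<^sup>2 / (4 * s)) * exp (- (s * L\<^sup>2)) * expectation (\<lambda>x. exp (3 * s * (W x)\<^sup>2))"
    by (subst Bochner_Integration.integral_add) auto
  also have "\<dots> \<le> v * exp (\<bar>t\<bar> * L) + 1 / s * exp (t\<^sup>2 / (4 * s)) * exp (- (s * L\<^sup>2)) * 2"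
    using s by (intro add_mono mult_right_mono mult_left_mono v exp_square_moment_half) auto
  finally have Eb: "expectation ?b \<le> v * exp (\<bar>t\<bar> * L) + 2 / s * exp (t\<^sup>2 / (4 * s)) * exp (- (s * L\<^sup>2))"
    by (simp add: mult_ac)
  have "expectation (\<lambda>x. exp (t * W x)) \<le> expectation (\<lambda>x. 1 + t * W x + t\<^sup>2 / 2 * ?b x)"
    by (intro integral_mono integrable_exp pt') auto
  also have "\<dots> = expectation (\<lambda>x. 1 + t * W x) + t\<^sup>2 / 2 * expectation ?b"
    using b_int by (subst Bochner_Integration.integral_add) auto
  also have "expectation (\<lambda>x. 1 + t * W x) = 1"
    by (subst Bochner_Integration.integral_add) (auto simp: W_centered prob_space)
  also have "1 + t\<^sup>2 / 2 * expectation ?b \<le> 1 + t\<^sup>2 / 2 *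
      (v * exp (\<bar>t\<bar> * L) + 2 / s * exp (t\<^sup>2 / (4 * s)) * exp (- (s * L\<^sup>2)))"
    by (intro add_left_mono mult_left_mono Eb) simp
  finally show ?thesis .
qed

end

text \<open>
  The parameter \<open>\<theta> = min A B / (100 * B powr (3 / 2))\<close> balances the gain \<open>\<theta> * (r * T)\<close>, which exceeds \<open>min A B\<close>,
  against the loss.  The factor \<open>exp (\<theta> * sqrt (330 * ln k))\<close> is bounded if \<open>k \<le> r ^ 4\<close>; otherwise it is
  at most \<open>2 * k powr (1 / 4)\<close>, which is compensated by \<open>r \<le> k powr (1 / 4)\<close>.
\<close>

lemma chernoff_exponent:
  fixes r k T :: real
  assumes r: "r \<ge> 1" and k: "k \<ge> 1" and T: "T > 0"
  defines "A \<equiv> r * T\<^sup>2 * sqrt k / (4096 * exp 1)"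
    and "B \<equiv> (r\<^sup>2 * T\<^sup>2 / (4096 * exp 1)) powr (1 / 3)"
  assumes large: "2 * exp 1 * (1 + ln r) < min A B"
  obtains \<theta> where "\<theta> \<ge> 0"
    "r * (\<theta>\<^sup>2 / 2 * ((328 * exp (\<theta> * sqrt (330 * ln k)) + 1320 * exp (165 * \<theta>\<^sup>2)) / sqrt k)) - \<theta> * (r * T)
     \<le> 1 + ln r - min A B / (2 * exp 1)"
proof -
  let ?e = "exp 1 :: real"
  define \<mu> where "\<mu> = min A B"
  define q where "q = r\<^sup>2 * T\<^sup>2 / (4096 * ?e)"
  have e: "5 / 2 \<le> ?e" "?e \<le> 3"
    using exp_lower_Taylor_quadratic[of 1] exp_le by auto
  have lnr: "0 \<le> ln r" and lnk: "0 \<le> ln k" using r k by auto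
  have q: "q > 0" using r T by (simp add: q_def)
  have B: "B > 0" using r T unfolding B_def by simp
  have B3: "B ^ 3 = q"
  proof -
    have "B ^ 3 = B powr 3" using B by simp
    also have "\<dots> = q powr 1" unfolding B_def q_def[symmetric] by (simp add: powr_powr)
    finally show ?thesis using q by simp
  qed
  have sqk: "sqrt k \<ge> 1" using k by simp
  have A: "A = sqrt k * B ^ 3 / r"
    unfolding B3 q_def A_def using r by (simp add: field_simps power2_eq_square)
  have A0: "A > 0" using A B sqk r by (simp add: zero_less_mult_iff)
  have mu: "\<mu> > 2 * ?e * (1 + ln r)" "\<mu> \<le> A" "\<mu> \<le> B" using large by (auto simp: \<mu>_def)
  have mu5: "\<mu> \<ge> 5 * (1 + ln r)"
  proof -
    have "5 * (1 + ln r) \<le> 2 * ?e * (1 + ln r)" using e lnr by (intro mult_right_mono) auto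
    then show ?thesis using mu(1) by linarith
  qed
  have mu0: "\<mu> > 0" using mu5 lnr by argo
  have B5: "B \<ge> 5 * (1 + ln r)" using mu5 mu by linarith
  define \<theta> where "\<theta> = \<mu> / (100 * (B * sqrt B))"
  have th0: "\<theta> > 0" using mu0 B by (simp add: \<theta>_def)
  have th2: "\<theta>\<^sup>2 = \<mu>\<^sup>2 / (10000 * B ^ 3)"
    using B by (simp add: \<theta>_def power_divide power_mult_distrib power3_eq_cube power2_eq_square)
  have th2_le: "\<theta>\<^sup>2 \<le> 1 / (10000 * B)"
  proof -
    have "\<mu>\<^sup>2 \<le> B\<^sup>2" using mu mu0 by (intro power_mono) auto
    then have "\<mu>\<^sup>2 / (10000 * B ^ 3) \<le> B\<^sup>2 / (10000 * B ^ 3)" using B by (intro divide_right_mono) auto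
    also have "\<dots> = 1 / (10000 * B)" using B by (simp add: power2_eq_square power3_eq_cube)
    finally show ?thesis using th2 by simp
  qed
  \<comment> \<open>Here the assumption \<open>large\<close> pays for the logarithm of
    \<open>r\<close>, through \<open>B \<ge> 5 * (1 + ln r)\<close>.\<close>
  have th2_le': "\<theta>\<^sup>2 * (1 + ln r) \<le> 1 / 50000"
  proof -
    have "\<theta>\<^sup>2 * (1 + ln r) \<le> \<theta>\<^sup>2 * (B / 5)" using B5 by (intro mult_left_mono) auto
    also have "\<dots> \<le> 1 / (10000 * B) * (B / 5)" using th2_le B by (intro mult_right_mono) auto
    also have "\<dots> = 1 / 50000" using B by simp
    finally show ?thesis .
  qed
  have th2_s: "\<theta>\<^sup>2 \<le> 1 / 50000"
  proof -
    have "\<theta>\<^sup>2 * 1 \<le> \<theta>\<^sup>2 * (1 + ln r)" using lnr by (intro mult_left_mono) auto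
    then show ?thesis using th2_le' by linarith
  qed
  have exp_half: "exp x \<le> 2" if "x \<le> 1 / 2" for x :: real
  proof -
    have "(exp (1 / 2 :: real))\<^sup>2 \<le> 2\<^sup>2"
      using e by (simp add: power2_eq_square exp_add[symmetric])
    then have "exp (1 / 2 :: real) \<le> 2" by (rule power2_le_imp_le) simp
    moreover have "exp x \<le> exp (1 / 2)" using that by simp
    ultimately show ?thesis by linarith
  qed
  have sq_e: "157 / 100 \<le> sqrt ?e"
    using e by (intro real_le_rsqrt) (simp add: power2_eq_square)
  \<comment> \<open>By definition of \<open>B\<close>, \<open>r * T\<close> is
    \<open>64 * sqrt (exp 1) * B powr (3 / 2)\<close>, 64 being the root of 4096; the denominator
    100 in \<open>\<theta>\<close> is below \<open>64 * sqrt (exp 1)\<close>.\<close>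
  have gain: "\<theta> * (r * T) \<ge> \<mu>"
  proof -
    have "(r * T)\<^sup>2 = 4096 * ?e * B ^ 3" unfolding B3 q_def by (simp add: power_mult_distrib)
    also have "\<dots> = 64\<^sup>2 * (sqrt ?e)\<^sup>2 * (B\<^sup>2 * (sqrt B)\<^sup>2)"
      using B by (simp add: power3_eq_cube power2_eq_square[of B])
    also have "\<dots> = (64 * sqrt ?e * (B * sqrt B))\<^sup>2"
      by (simp only: power_mult_distrib)
    finally have "r * T = 64 * sqrt ?e * (B * sqrt B)"
      by (rule power2_eq_imp_eq) (use r T B in auto)
    then have "\<theta> * (r * T) = 64 / 100 * sqrt ?e * \<mu>" using B by (simp add: \<theta>_def)
    moreover have "1 * \<mu> \<le> 64 / 100 * sqrt ?e * \<mu>" using sq_e mu0 by (intro mult_right_mono) auto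
    ultimately show ?thesis by simp
  qed
  \<comment> \<open>Since \<open>A = sqrt k * B ^ 3 / r\<close>, the left side is
    \<open>\<mu>\<^sup>2 / (10000 * A)\<close>, and \<open>\<mu> \<le> A\<close>.\<close>
  have loss: "r * \<theta>\<^sup>2 / sqrt k \<le> \<mu> / 10000"
  proof -
    have "r * \<theta>\<^sup>2 / sqrt k = \<mu> * \<mu> / (10000 * A)"
      unfolding th2 A using r sqk B by (simp add: field_simps power2_eq_square)
    also have "\<dots> \<le> \<mu> * A / (10000 * A)"
      using mu mu0 A0 by (intro divide_right_mono mult_left_mono) auto
    also have "\<dots> = \<mu> / 10000" using A0 by simp
    finally show ?thesis .
  qed
  have e165: "exp (165 * \<theta>\<^sup>2) \<le> 2" by (rule exp_half) (use th2_s in linarith)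
  let ?L = "sqrt (330 * ln k)"
  have mu_le: "\<mu> / (2 * ?e) \<le> \<mu> / 5" using e mu0 by (intro divide_left_mono) auto
  \<comment> \<open>This loss is small enough: the gain is at least \<open>\<mu>\<close>, the target
    needs \<open>\<mu> / (2 * exp 1) \<le> \<mu> / 5\<close>, and the summand 1 is available on the
    right-hand side of the claim.\<close>
  have "r * (\<theta>\<^sup>2 / 2 * ((328 * exp (\<theta> * ?L) + 1320 * exp (165 * \<theta>\<^sup>2)) / sqrt k)) \<le> \<mu> / 5 + 1"
  proof (cases "ln k \<le> 4 * ln r")
    case True
    have "(\<theta> * ?L)\<^sup>2 = 330 * (\<theta>\<^sup>2 * ln k)" using lnk by (simp add: power_mult_distrib)
    also have "\<dots> \<le> 330 * (\<theta>\<^sup>2 * (4 * (1 + ln r)))"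
      using True by (intro mult_left_mono) auto
    also have "\<dots> = 1320 * (\<theta>\<^sup>2 * (1 + ln r))" by simp
    also have "\<dots> \<le> (1 / 2)\<^sup>2" using mult_left_mono[OF th2_le', of 1320] by (simp add: power2_eq_square)
    finally have "\<theta> * ?L \<le> 1 / 2" by (rule power2_le_imp_le) simp
    then have "exp (\<theta> * ?L) \<le> 2" by (rule exp_half)
    then have "r * (\<theta>\<^sup>2 / 2 * ((328 * exp (\<theta> * ?L) + 1320 * exp (165 * \<theta>\<^sup>2)) / sqrt k))
        \<le> r * (\<theta>\<^sup>2 / 2 * (3296 / sqrt k))"
      using e165 r sqk by (intro mult_left_mono divide_right_mono) auto
    also have "\<dots> = 1648 * (r * \<theta>\<^sup>2 / sqrt k)" by simp
    also have "\<dots> \<le> 1648 * (\<mu> / 10000)" by (intro mult_left_mono loss) simp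
    finally show ?thesis using mu0 by linarith
  next
    case False
    define h where "h = k powr (1 / 4)"
    have h1: "h \<ge> 1" using k unfolding h_def by (intro ge_one_powr_ge_zero) auto
    have h_eq: "h = exp (ln k / 4)" using k by (simp add: h_def powr_def)
    have hh: "h * h = sqrt k" using k
      by (simp add: h_def powr_add[symmetric] powr_half_sqrt[symmetric])
    have rh: "r \<le> h"
    proof -
      have "ln r \<le> ln k / 4" using False by simp
      then have "exp (ln r) \<le> h" unfolding h_eq by simp
      then show ?thesis using r by simp
    qed
    \<comment> \<open>Completing the square with this weight leaves exactly a quarter of
      \<open>ln k\<close>, so the exponential costs \<open>h = k powr (1 / 4)\<close>; together with
      \<open>r \<le> h\<close> this gives \<open>h * h = sqrt k\<close>, which cancels the
      denominator.\<close>
    have "\<theta> * ?L \<le> 330 * \<theta>\<^sup>2 + ln k / 4"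
    proof -
      have "0 \<le> (660 * \<theta> - ?L)\<^sup>2" by simp
      also have "\<dots> = 1320 * (330 * \<theta>\<^sup>2 + ln k / 4 - \<theta> * ?L)"
        using lnk by (simp add: power2_diff power_mult_distrib)
      finally show ?thesis by simp
    qed
    then have "exp (\<theta> * ?L) \<le> exp (330 * \<theta>\<^sup>2) * h" unfolding h_eq by (simp add: exp_add[symmetric])
    also have "\<dots> \<le> 2 * h" using h1 th2_s by (intro mult_right_mono exp_half) auto
    finally have ex: "exp (\<theta> * ?L) \<le> 2 * h" .
    have "328 * exp (\<theta> * ?L) + 1320 * exp (165 * \<theta>\<^sup>2) \<le> 3296 * h" using ex e165 h1 by linarith
    then have "r * (\<theta>\<^sup>2 / 2 * ((328 * exp (\<theta> * ?L) + 1320 * exp (165 * \<theta>\<^sup>2)) / sqrt k))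
        \<le> h * (\<theta>\<^sup>2 / 2 * (3296 * h / sqrt k))"
      using r rh h1 sqk by (intro mult_mono mult_left_mono divide_right_mono) auto
    also have "\<dots> = 1648 * \<theta>\<^sup>2 * (h * h) / sqrt k" by simp
    also have "\<dots> = 1648 * \<theta>\<^sup>2" unfolding hh using sqk by simp
    also have "\<dots> \<le> 1" using th2_s by linarith
    finally show ?thesis using mu0 by linarith
  qed
  then have "r * (\<theta>\<^sup>2 / 2 * ((328 * exp (\<theta> * ?L) + 1320 * exp (165 * \<theta>\<^sup>2)) / sqrt k)) - \<theta> * (r * T)
     \<le> 1 + ln r - min A B / (2 * ?e)"
    using gain mu_le mu0 lnr unfolding \<mu>_def[symmetric] by linarith
  with that[of \<theta>] th0 show ?thesis by simp
qed

section \<open>Anti-concentration of the vote\<close>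

text \<open>The weight \<open>3 * n + 1\<close> closes the induction: the step amounts to \<open>(2
  * n + 1)\<^sup>2 * (3 * n + 4) \<le> 4 * (n + 1)\<^sup>2 * (3 * n + 1)\<close>, whose two sides
  differ by exactly \<open>n\<close>.\<close>

lemma central_binomial_square_le: "(real ((2 * n) choose n))\<^sup>2 * (3 * real n + 1) \<le> 16 ^ n"
proof (induction n)
  case (Suc n)
  have eq: "real (Suc n) * real ((2 * Suc n) choose Suc n) = 2 * (2 * real n + 1) * real ((2 * n) choose n)"
  proof -
    have "Suc n * ((2 * Suc n) choose Suc n) = (2 * Suc n) * (Suc (2 * n) choose n)"
      using Suc_times_binomial_eq[of "Suc (2 * n)" n] by (simp add: mult.commute)
    moreover have "Suc n * (Suc (2 * n) choose n) = Suc (2 * n) * ((2 * n) choose n)"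
      using binomial_absorb_comp[of "Suc (2 * n)" n] by simp
    ultimately have "Suc n * ((2 * Suc n) choose Suc n) = 2 * (Suc (2 * n) * ((2 * n) choose n))"
      by (metis mult.assoc mult.left_commute)
    then have "real (Suc n * ((2 * Suc n) choose Suc n)) = real (2 * (Suc (2 * n) * ((2 * n) choose n)))"
      by (rule arg_cong)
    then show ?thesis by (simp del: binomial_Suc_Suc mult_Suc add: algebra_simps)
  qed
  define b where "b = real ((2 * n) choose n)"
  define B where "B = real ((2 * Suc n) choose Suc n)"
  define x where "x = real n"
  have x: "x \<ge> 0" by (simp add: x_def)
  have eq: "(x + 1) * B = 2 * (2 * x + 1) * b"
    using eq unfolding b_def B_def x_def of_nat_Suc by (simp only: add.commute[of 1 "real n"])
  have IH: "b\<^sup>2 * (3 * x + 1) \<le> 16 ^ n" using Suc.IH by (simp add: b_def x_def)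
  have "(x + 1)\<^sup>2 * (B\<^sup>2 * (3 * (x + 1) + 1)) = ((x + 1) * B)\<^sup>2 * (3 * x + 4)"
    by (simp add: power_mult_distrib add.commute)
  also have "\<dots> = b\<^sup>2 * (4 * ((2 * x + 1)\<^sup>2 * (3 * x + 4)))"
    unfolding eq by (simp add: power2_eq_square algebra_simps)
  also have "\<dots> \<le> b\<^sup>2 * (4 * (4 * (x + 1)\<^sup>2 * (3 * x + 1)))"
    using x by (intro mult_left_mono) (auto simp: power2_eq_square algebra_simps)
  also have "\<dots> = (x + 1)\<^sup>2 * (16 * (b\<^sup>2 * (3 * x + 1)))" by simp
  also have "\<dots> \<le> (x + 1)\<^sup>2 * (16 * 16 ^ n)" using IH by (intro mult_left_mono) auto
  finally have "B\<^sup>2 * (3 * (x + 1) + 1) \<le> 16 * 16 ^ n" using x by (simp add: mult_le_cancel_left_pos)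
  then show ?case unfolding B_def[symmetric] x_def by (simp add: add.commute)
qed simp

text \<open>The middle coefficient is the largest. For odd \<open>k = 2 * n + 1\<close> it is half
  of the central coefficient of \<open>2 * n + 2\<close>.\<close>

lemma binomial_square_le: "(real (k choose c))\<^sup>2 * (3 / 2 * real k) \<le> 4 ^ k"
proof -
  define n where "n = k div 2"
  have "(real (k choose c))\<^sup>2 \<le> (real (k choose n))\<^sup>2"
    unfolding n_def by (intro power_mono) (auto simp: binomial_maximum)
  moreover have "(real (k choose n))\<^sup>2 * (3 / 2 * real k) \<le> 4 ^ k"
  proof (cases "even k")
    case True
    then have k: "k = 2 * n" by (simp add: n_def)
    have "(real (k choose n))\<^sup>2 * (3 / 2 * real k) \<le> (real (k choose n))\<^sup>2 * (3 * real n + 1)"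
      by (intro mult_left_mono) (auto simp: k)
    also have "\<dots> \<le> 16 ^ n" unfolding k by (rule central_binomial_square_le)
    also have "\<dots> = 4 ^ k" by (simp add: k power_mult)
    finally show ?thesis .
  next
    case False
    then have k: "k = Suc (2 * n)" by (simp add: n_def)
    have "Suc (2 * n) choose n = Suc (2 * n) choose Suc n"
      using binomial_symmetric[of n "Suc (2 * n)"] by (simp del: binomial_Suc_Suc)
    then have "(2 * Suc n) choose Suc n = 2 * (k choose n)"
      by (simp add: k)
    then have "(2 * real (k choose n))\<^sup>2 * (3 * real (Suc n) + 1) \<le> 16 ^ Suc n"
      using central_binomial_square_le[of "Suc n"] by simp
    then have "(real (k choose n))\<^sup>2 * (3 * real n + 4) \<le> 4 * 16 ^ n"
      by (simp add: power_mult_distrib algebra_simps)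
    moreover have "4 * 16 ^ n = (4::real) ^ k" by (simp add: k power_mult)
    moreover have "(real (k choose n))\<^sup>2 * (3 / 2 * real k) \<le> (real (k choose n))\<^sup>2 * (3 * real n + 4)"
      by (intro mult_left_mono) (auto simp: k)
    ultimately show ?thesis by linarith
  qed
  ultimately show ?thesis
    by (meson mult_right_mono mult_nonneg_nonneg of_nat_0_le_iff order_trans zero_le_divide_iff zero_le_numeral)
qed

lemma binomial_le_sqrt: 
  assumes "k \<ge> 1"
  shows "real (k choose c) \<le> 2 ^ k * (0.82 / sqrt (real k))"
proof (rule power2_le_imp_le)
  have "(real (k choose c))\<^sup>2 * (3 / 2 * real k) \<le> (2 ^ k)\<^sup>2"
    using binomial_square_le[of k c] by (simp add: power_mult[symmetric] mult.commute[of k] power_mult)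
  then have "(real (k choose c))\<^sup>2 \<le> (2 ^ k)\<^sup>2 * (2 / 3 / real k)"
    using assms by (simp add: field_simps)
  \<comment> \<open>0.82 is a decimal upper bound for the root of 2/3.\<close>
  also have "\<dots> \<le> (2 ^ k)\<^sup>2 * ((0.82)\<^sup>2 / real k)"
    using assms by (intro mult_left_mono divide_right_mono) (auto simp: power2_eq_square)
  also have "\<dots> = (2 ^ k * (0.82 / sqrt (real k)))\<^sup>2"
    by (simp add: power_mult_distrib power_divide)
  finally show "(real (k choose c))\<^sup>2 \<le> (2 ^ k * (0.82 / sqrt (real k)))\<^sup>2" .
qed simp

text \<open>This is \<open>4 * a * b \<le> (a + b)\<^sup>2\<close> raised to the power
  \<open>c\<close>; an excess of at most 2 in the exponent of \<open>b\<close> costs the factor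
  4.\<close>

lemma power_mult_power_le:
  fixes a b :: real
  assumes "a \<ge> 0" "b \<ge> 0" "2 * c \<le> k" "k \<le> 2 * c + 2"
  shows "2 ^ k * (a ^ c * b ^ (k - c)) \<le> 4 * (a + b) ^ k"
proof -
  have "0 \<le> (a - b)\<^sup>2" by simp
  then have ab: "4 * (a * b) \<le> (a + b)\<^sup>2" by (simp add: power2_eq_square algebra_simps)
  have e: "k - c = c + (k - 2 * c)" using assms by simp
  have "4 ^ c * (a ^ c * b ^ (k - c)) = (4 * (a * b)) ^ c * b ^ (k - 2 * c)"
    unfolding e by (simp add: power_add power_mult_distrib)
  also have "\<dots> \<le> ((a + b)\<^sup>2) ^ c * (a + b) ^ (k - 2 * c)"
    using assms by (intro mult_mono power_mono ab) auto
  also have "\<dots> = (a + b) ^ k"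
    using assms by (simp add: power_mult[symmetric] power_add[symmetric])
  finally have 1: "4 ^ c * (a ^ c * b ^ (k - c)) \<le> (a + b) ^ k" .
  have "(2::real) ^ k \<le> 2 ^ (2 * c + 2)" using assms by (intro power_increasing) auto
  then have "(2::real) ^ k \<le> 4 * 4 ^ c" by (simp add: power_add power_mult)
  then have "2 ^ k * (a ^ c * b ^ (k - c)) \<le> 4 * 4 ^ c * (a ^ c * b ^ (k - c))"
    using assms by (intro mult_right_mono) auto
  then show ?thesis using 1 by simp
qed

text \<open>\<open>3.28\<close> is \<open>4 * 0.82\<close>. The sum \<open>a + b\<close> is not
  normalised: \<open>a\<close> and \<open>b\<close> will be the masses of the two labels inside a
  ball, and \<open>(a + b) ^ k\<close> the probability that \<open>k\<close> points fall into
  it.\<close>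

lemma binomial_term_le:
  fixes a b :: real
  assumes k: "k \<ge> 1" and ab: "a \<ge> 0" "b \<ge> 0" and c: "k \<le> 2 * c + 2" "2 * c \<le> k + 2" and ck: "c \<le> k"
  shows "real (k choose c) * (a ^ c * b ^ (k - c)) \<le> 3.28 / sqrt (real k) * (a + b) ^ k"
proof -
  have *: "2 ^ k * (a ^ c * b ^ (k - c)) \<le> 4 * (a + b) ^ k"
  proof (cases "2 * c \<le> k")
    case True
    then show ?thesis using power_mult_power_le[OF ab True] c by simp
  next
    case False
    then show ?thesis using power_mult_power_le[OF ab(2,1), of "k - c" k] c ck
      by (simp add: mult.commute add.commute)
  qed
  have "real (k choose c) * (a ^ c * b ^ (k - c)) \<le> 2 ^ k * (0.82 / sqrt (real k)) * (a ^ c * b ^ (k - c))"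
    using ab by (intro mult_right_mono binomial_le_sqrt k) auto
  also have "\<dots> = 0.82 / sqrt (real k) * (2 ^ k * (a ^ c * b ^ (k - c)))" by simp
  also have "\<dots> \<le> 0.82 / sqrt (real k) * (4 * (a + b) ^ k)"
    by (intro mult_left_mono *) simp
  finally show ?thesis by simp
qed

section \<open>The label count among the first points of an i.i.d. sample\<close>

lemma borel_measurable_sum_firsts:
  fixes g :: "'i \<Rightarrow> 'w \<Rightarrow> real"
  assumes S: "finite S"
    and lt: "\<And>i j. i \<in> S \<Longrightarrow> j \<in> S \<Longrightarrow> Measurable.pred M (\<lambda>w. lt w i j)"
    and g: "\<And>i. i \<in> S \<Longrightarrow> g i \<in> borel_measurable M"
  shows "(\<lambda>w. \<Sum>i\<in>firsts k (lt w) S. g i w) \<in> borel_measurable M"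
proof -
  have eq: "(\<Sum>i\<in>firsts k (lt w) S. g i w) =
    (\<Sum>i\<in>S. if (\<Sum>j\<in>S. if lt w j i then 1 else 0 :: real) < real k then g i w else 0)" for w
  proof -
    have "real (card {j \<in> S. lt w j i}) = (\<Sum>j\<in>S. if lt w j i then 1 else 0)" for i
      using S by (simp add: sum.If_cases Int_def)
    then have "firsts k (lt w) S = {i \<in> S. (\<Sum>j\<in>S. if lt w j i then 1 else 0 :: real) < real k}"
      unfolding firsts_def by (metis (no_types, lifting) of_nat_less_iff)
    then show ?thesis using S by (simp add: sum.inter_filter)
  qed
  show ?thesis unfolding eq
    by (intro borel_measurable_sum measurable_If borel_measurable_const g lt pred_intros_logic) (use lt g in measurable)
qed

lemma measurable_card_Collect:
  assumes "finite K" and "\<And>i. i \<in> K \<Longrightarrow> Measurable.pred M (P i)"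
  shows "(\<lambda>w. card {i \<in> K. P i w}) \<in> M \<rightarrow>\<^sub>M count_space UNIV"
  using assms
proof (induction K rule: finite_induct)
  case (insert x K)
  have "card {i \<in> insert x K. P i w} = (if P x w then Suc (card {i \<in> K. P i w}) else card {i \<in> K. P i w})" for w
  proof -
    have "{i \<in> insert x K. P i w} = (if P x w then insert x {i \<in> K. P i w} else {i \<in> K. P i w})" by auto
    then show ?thesis using insert.hyps by simp
  qed
  moreover have [measurable]: "(\<lambda>w. card {i \<in> K. P i w}) \<in> M \<rightarrow>\<^sub>M count_space UNIV" "Measurable.pred M (P x)"
    using insert by auto
  ultimately show ?case by simp
qed simp

text \<open>Given that the points of \<open>K\<close> lie in \<open>A1 \<union> A0\<close> and the
  others in \<open>B\<close>, the number of points in \<open>A1\<close> is binomial. The conditional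
  bound is stated as a product with the probability of the condition, so that conditions of
  probability 0 need no care. The event splits into product boxes, one for each set of
  \<open>c\<close> indices.\<close>

lemma (in prob_space) box_count_le:
  fixes S K :: "'i set"
  assumes S: "finite S" and K: "K \<subseteq> S" and k: "card K = k" "k \<ge> 1"
    and A[measurable]: "A1 \<in> events" "A0 \<in> events" "B \<in> events" and disj: "A1 \<inter> A0 = {}"
    and c: "k \<le> 2 * c + 2" "2 * c \<le> k + 2"
  shows "emeasure (Pi\<^sub>M S (\<lambda>_. M))
      {w \<in> space (Pi\<^sub>M S (\<lambda>_. M)). (\<forall>i\<in>K. w i \<in> A1 \<union> A0) \<and> (\<forall>i\<in>S - K. w i \<in> B) \<and> card {i \<in> K. w i \<in> A1} = c}
    \<le> ennreal (3.28 / sqrt (real k)) * emeasure (Pi\<^sub>M S (\<lambda>_. M))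
      {w \<in> space (Pi\<^sub>M S (\<lambda>_. M)). (\<forall>i\<in>K. w i \<in> A1 \<union> A0) \<and> (\<forall>i\<in>S - K. w i \<in> B)}"
    (is "emeasure ?Q ?G \<le> _ * emeasure ?Q ?E")
proof -
  interpret product_sigma_finite "\<lambda>_ :: 'i. M" by unfold_locales
  have sub: "A1 \<subseteq> space M" "A0 \<subseteq> space M" "B \<subseteq> space M" using A by (simp_all add: sets.sets_into_space)
  have fK: "finite K" using S K finite_subset by auto
  define \<beta> where "\<beta> = prob B ^ card (S - K)"
  define box where "box J = (\<lambda>i. if i \<in> J then A1 else if i \<in> K then A0 else B)" for J
  define J where "J = {J. J \<subseteq> K \<and> card J = c}"
  have E_eq: "?E = Pi\<^sub>E S (\<lambda>i. if i \<in> K then A1 \<union> A0 else B)"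
  proof (intro equalityI subsetI)
    fix w assume "w \<in> Pi\<^sub>E S (\<lambda>i. if i \<in> K then A1 \<union> A0 else B)"
    then have w: "w i \<in> (if i \<in> K then A1 \<union> A0 else B)" "w \<in> extensional S" if "i \<in> S" for i
      using that by (auto simp: PiE_iff)
    have "w i \<in> space M" if "i \<in> S" for i using w(1)[OF that] sub by (auto split: if_splits)
    then show "w \<in> ?E" using w K \<open>w \<in> Pi\<^sub>E S _\<close> by (fastforce simp: space_PiM PiE_iff split: if_splits)
  qed (use K in \<open>auto simp: space_PiM PiE_iff\<close>)
  have "emeasure ?Q ?E = (\<Prod>i\<in>S. emeasure M (if i \<in> K then A1 \<union> A0 else B))"
    unfolding E_eq using S by (intro emeasure_PiM) auto
  also have "\<dots> = (\<Prod>i\<in>K. emeasure M (A1 \<union> A0)) * (\<Prod>i\<in>S - K. emeasure M B)"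
    using K S by (subst prod.subset_diff[of K S]) (auto simp: mult.commute intro!: arg_cong2[where f=times] prod.cong)
  also have "\<dots> = ennreal ((prob A1 + prob A0) ^ k * \<beta>)"
    using disj k by (simp add: emeasure_eq_measure finite_measure_Union \<beta>_def ennreal_power ennreal_mult
        del: ennreal_plus add: ennreal_plus[symmetric])
  finally have E: "emeasure ?Q ?E = ennreal ((prob A1 + prob A0) ^ k * \<beta>)" .
  have G_eq: "?G = (\<Union>j\<in>J. Pi\<^sub>E S (box j))"
  proof (intro equalityI subsetI)
    fix w assume w: "w \<in> ?G"
    let ?j = "{i \<in> K. w i \<in> A1}"
    have "?j \<in> J" using w by (auto simp: J_def)
    moreover have "w \<in> Pi\<^sub>E S (box ?j)" using w K by (auto simp: box_def space_PiM PiE_iff)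
    ultimately show "w \<in> (\<Union>j\<in>J. Pi\<^sub>E S (box j))" by blast
  next
    fix w assume "w \<in> (\<Union>j\<in>J. Pi\<^sub>E S (box j))"
    then obtain j where j: "j \<in> J" and w: "w \<in> Pi\<^sub>E S (box j)" by blast
    have wi: "w i \<in> box j i" if "i \<in> S" for i using w that by (auto simp: PiE_iff)
    have jK: "j \<subseteq> K" "card j = c" using j by (auto simp: J_def)
    have "{i \<in> K. w i \<in> A1} = j"
      using wi disj jK K by (fastforce simp: box_def split: if_splits)
    moreover have "w \<in> space ?Q"
      using w sub by (auto simp: space_PiM PiE_iff box_def split: if_splits)
    moreover have "w i \<in> A1 \<union> A0" if "i \<in> K" for i
      using wi[of i] that jK K by (auto simp: box_def split: if_splits)
    moreover have "w i \<in> B" if "i \<in> S - K" for i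
      using wi[of i] that jK by (auto simp: box_def split: if_splits)
    ultimately show "w \<in> ?G" using jK by simp
  qed
  have fJ: "finite J" unfolding J_def using fK by simp
  have boxm: "box j i \<in> events" for j i by (auto simp: box_def)
  have "emeasure ?Q ?G \<le> (\<Sum>j\<in>J. emeasure ?Q (Pi\<^sub>E S (box j)))"
    unfolding G_eq using fJ S boxm by (intro emeasure_subadditive_finite) auto
  also have "\<dots> = (\<Sum>j\<in>J. ennreal (prob A1 ^ c * prob A0 ^ (k - c) * \<beta>))"
  proof (rule sum.cong)
    fix j assume "j \<in> J"
    then have j: "j \<subseteq> K" "card j = c" by (auto simp: J_def)
    have fj: "finite j" using j fK finite_subset by auto
    have "emeasure ?Q (Pi\<^sub>E S (box j)) = (\<Prod>i\<in>S. emeasure M (box j i))"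
      using S boxm by (intro emeasure_PiM) auto
    also have "\<dots> = (\<Prod>i\<in>K. emeasure M (box j i)) * (\<Prod>i\<in>S - K. emeasure M (box j i))"
      using K S by (subst prod.subset_diff[of K S]) (auto simp: mult.commute)
    also have "(\<Prod>i\<in>K. emeasure M (box j i)) = (\<Prod>i\<in>j. emeasure M (box j i)) * (\<Prod>i\<in>K - j. emeasure M (box j i))"
      using j fK by (subst prod.subset_diff[of j K]) (auto simp: mult.commute)
    also have "(\<Prod>i\<in>j. emeasure M (box j i)) = ennreal (prob A1 ^ c)"
      using j by (simp add: box_def emeasure_eq_measure ennreal_power)
    also have "(\<Prod>i\<in>K - j. emeasure M (box j i)) = ennreal (prob A0 ^ (k - c))"
      using j k fj by (simp add: box_def emeasure_eq_measure ennreal_power card_Diff_subset)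
    also have "(\<Prod>i\<in>S - K. emeasure M (box j i)) = (\<Prod>i\<in>S - K. emeasure M B)"
      using j by (intro prod.cong) (auto simp: box_def)
    also have "\<dots> = ennreal \<beta>"
      by (simp add: emeasure_eq_measure ennreal_power \<beta>_def)
    finally show "emeasure ?Q (Pi\<^sub>E S (box j)) = ennreal (prob A1 ^ c * prob A0 ^ (k - c) * \<beta>)"
      by (simp add: ennreal_mult \<beta>_def)
  qed simp
  also have "\<dots> = ennreal (real (k choose c) * (prob A1 ^ c * prob A0 ^ (k - c)) * \<beta>)"
    using fK k by (simp add: J_def n_subsets ennreal_of_nat_eq_real_of_nat ennreal_mult[symmetric] \<beta>_def mult.assoc)
  also have "\<dots> \<le> ennreal (3.28 / sqrt (real k) * (prob A1 + prob A0) ^ k * \<beta>)"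
  proof (cases "c \<le> k")
    case True
    then show ?thesis
      using binomial_term_le[OF k(2), of "prob A1" "prob A0" c] c
      by (intro ennreal_leI mult_right_mono) (auto simp: \<beta>_def)
  next
    case False
    then show ?thesis by (simp add: binomial_eq_0)
  qed
  also have "\<dots> = ennreal (3.28 / sqrt (real k)) * emeasure ?Q ?E"
    unfolding E by (simp add: ennreal_mult[symmetric] \<beta>_def mult_ac)
  finally show ?thesis .
qed

text \<open>Conditionally on the point of rank \<open>k\<close> (counting from 0) and on the set of
  indices preceding it, the first \<open>k\<close> points are i.i.d. below that point and the rest
  lie above it, so \<open>box_count_le\<close> applies. The order is on values, not on indices: this
  is what makes the conditional law a product.\<close>

lemma (in prob_space) firsts_count_le:
  fixes S :: "'i set" and lt :: "'a \<Rightarrow> 'a \<Rightarrow> bool"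
  assumes S: "finite S" and k: "k \<ge> 1" "k \<le> card S"
    and lt[measurable]: "Measurable.pred (M \<Otimes>\<^sub>M M) (\<lambda>(a, b). lt a b)"
    and y[measurable]: "Measurable.pred M y"
    and irr: "\<And>a. \<not> lt a a" and tr: "\<And>a b c. lt a b \<Longrightarrow> lt b c \<Longrightarrow> lt a c"
    and total: "AE w in Pi\<^sub>M S (\<lambda>_. M). \<forall>i\<in>S. \<forall>j\<in>S. i \<noteq> j \<longrightarrow> lt (w i) (w j) \<or> lt (w j) (w i)"
    and c: "k \<le> 2 * c + 2" "2 * c \<le> k + 2"
  shows "emeasure (Pi\<^sub>M S (\<lambda>_. M))
      {w \<in> space (Pi\<^sub>M S (\<lambda>_. M)). card {i \<in> firsts k (\<lambda>i j. lt (w i) (w j)) S. y (w i)} = c}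
    \<le> ennreal (3.28 / sqrt (real k))"
    (is "emeasure ?Q ?Ev \<le> ?C")
proof -
  interpret Q: product_prob_space "\<lambda>_ :: 'i. M" S by unfold_locales
  show ?thesis
  proof (cases "card S = k")
    case True
    \<comment> \<open>With exactly \<open>k\<close> points there is no further one to condition on,
      and the whole space takes the place of the ball.\<close>
    have firsts_S: "firsts k (\<lambda>i j. lt (w i) (w j)) S = S" for w
    proof -
      have "card {j \<in> S. lt (w j) (w i)} < k" if "i \<in> S" for i
        unfolding True[symmetric] by (rule psubset_card_mono[OF S]) (use that irr in auto)
      then show ?thesis by (auto simp: firsts_def)
    qed
    have "?Ev = {w \<in> space ?Q. (\<forall>i\<in>S. w i \<in> {a \<in> space M. y a} \<union> {a \<in> space M. \<not> y a}) \<and>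
        (\<forall>i\<in>S - S. w i \<in> space M) \<and> card {i \<in> S. w i \<in> {a \<in> space M. y a}} = c}"
      unfolding firsts_S by (auto simp: space_PiM PiE_iff intro!: arg_cong[where f = card])
    then have "emeasure ?Q ?Ev = emeasure ?Q {w \<in> space ?Q.
        (\<forall>i\<in>S. w i \<in> {a \<in> space M. y a} \<union> {a \<in> space M. \<not> y a}) \<and>
        (\<forall>i\<in>S - S. w i \<in> space M) \<and> card {i \<in> S. w i \<in> {a \<in> space M. y a}} = c}"
      by simp
    also have "\<dots> \<le> ?C * emeasure ?Q {w \<in> space ?Q.
        (\<forall>i\<in>S. w i \<in> {a \<in> space M. y a} \<union> {a \<in> space M. \<not> y a}) \<and> (\<forall>i\<in>S - S. w i \<in> space M)}"
      by (rule box_count_le) (use S True k c in auto)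
    also have "\<dots> \<le> ?C * 1" by (intro mult_left_mono Q.P.emeasure_le_1) simp
    finally show ?thesis by simp
  next
    case False
    then have kS: "k < card S" using k by simp
    \<comment> \<open>In a pair \<open>(l, K)\<close>, \<open>l\<close> is the index of the point of
      rank \<open>k\<close> and \<open>K\<close> the set of the indices before it; \<open>E\<close>
      is the event that this is the configuration, \<open>G\<close> adds the label count.\<close>
    define I where "I = (SIGMA l:S. {K. K \<subseteq> S - {l} \<and> card K = k})"
    define E where "E = (\<lambda>(l, K). {w \<in> space ?Q. (\<forall>i\<in>K. lt (w i) (w l)) \<and> (\<forall>i\<in>S - {l} - K. lt (w l) (w i))})"
    define G where "G = (\<lambda>(l, K). {w \<in> space ?Q. (\<forall>i\<in>K. lt (w i) (w l)) \<and> (\<forall>i\<in>S - {l} - K. lt (w l) (w i)) \<and>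
      card {i \<in> K. y (w i)} = c})"
    have fI: "finite I" unfolding I_def using S by (intro finite_SigmaI) auto
    have ltm: "Measurable.pred ?Q (\<lambda>w. lt (w i) (w j))" if "i \<in> S" "j \<in> S" for i j
    proof -
      have "(\<lambda>w. (w i, w j)) \<in> ?Q \<rightarrow>\<^sub>M M \<Otimes>\<^sub>M M" using that by measurable
      from measurable_compose[OF this lt] show ?thesis by simp
    qed
    have ym: "Measurable.pred ?Q (\<lambda>w. y (w i))" if "i \<in> S" for i using that by measurable
    have Em: "E x \<in> sets ?Q" if xI: "x \<in> I" for x
    proof -
      obtain l K where x: "x = (l, K)" "l \<in> S" "K \<subseteq> S - {l}" using xI unfolding I_def by blast
      then have "finite K" using S finite_subset by auto
      then show ?thesis unfolding x E_def prod.case using x S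
        by (intro predE pred_intros_finite pred_intros_logic ltm) auto
    qed
    have Gm: "G x \<in> sets ?Q" if xI: "x \<in> I" for x
    proof -
      obtain l K where x: "x = (l, K)" "l \<in> S" "K \<subseteq> S - {l}" using xI unfolding I_def by blast
      then have fK: "finite K" using S finite_subset by auto
      have eq: "G x = E x \<inter> {w \<in> space ?Q. card {i \<in> K. y (w i)} = c}"
        unfolding x G_def E_def prod.case by auto
      have [measurable]: "(\<lambda>w. card {i \<in> K. y (w i)}) \<in> ?Q \<rightarrow>\<^sub>M count_space UNIV"
        using x by (intro measurable_card_Collect fK ym) auto
      show ?thesis unfolding eq using Em[OF xI] by measurable
    qed
    have GE: "emeasure ?Q (G x) \<le> ?C * emeasure ?Q (E x)" if xI: "x \<in> I" for x
    proof -
      obtain l K where x: "x = (l, K)" "l \<in> S" "K \<subseteq> S - {l}" "card K = k" using xI unfolding I_def by blast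
      define S' where "S' = S - {l}"
      have S': "finite S'" "l \<notin> S'" "S = insert l S'" using S x by (auto simp: S'_def)
      let ?Q' = "Pi\<^sub>M S' (\<lambda>_. M)"
      let ?A1 = "\<lambda>\<zeta>. {a \<in> space M. lt a \<zeta> \<and> y a}" and ?A0 = "\<lambda>\<zeta>. {a \<in> space M. lt a \<zeta> \<and> \<not> y a}"
        and ?B = "\<lambda>\<zeta>. {a \<in> space M. lt \<zeta> a}"
      let ?E' = "\<lambda>\<zeta>. {w \<in> space ?Q'. (\<forall>i\<in>K. w i \<in> ?A1 \<zeta> \<union> ?A0 \<zeta>) \<and> (\<forall>i\<in>S' - K. w i \<in> ?B \<zeta>)}"
      let ?G' = "\<lambda>\<zeta>. {w \<in> space ?Q'. (\<forall>i\<in>K. w i \<in> ?A1 \<zeta> \<union> ?A0 \<zeta>) \<and> (\<forall>i\<in>S' - K. w i \<in> ?B \<zeta>) \<and>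
          card {i \<in> K. w i \<in> ?A1 \<zeta>} = c}"
      have KS': "K \<subseteq> S'" "l \<notin> K" using x by (auto simp: S'_def)
      have fK: "finite K" using KS' S' finite_subset by auto
      have meas[measurable]: "?A1 \<zeta> \<in> events" "?A0 \<zeta> \<in> events" "?B \<zeta> \<in> events" if "\<zeta> \<in> space M" for \<zeta>
      proof -
        have 1: "(\<lambda>a. (a, \<zeta>)) \<in> M \<rightarrow>\<^sub>M M \<Otimes>\<^sub>M M" and 2: "(\<lambda>a. (\<zeta>, a)) \<in> M \<rightarrow>\<^sub>M M \<Otimes>\<^sub>M M"
          using that by simp_all
        have [measurable]: "Measurable.pred M (\<lambda>a. lt a \<zeta>)" "Measurable.pred M (\<lambda>a. lt \<zeta> a)"
          using measurable_compose[OF 1 lt] measurable_compose[OF 2 lt] by simp_all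
        show "?A1 \<zeta> \<in> events" "?A0 \<zeta> \<in> events" "?B \<zeta> \<in> events" by measurable
      qed
      have upd: "w(l := \<zeta>) \<in> space ?Q \<longleftrightarrow> True" if "w \<in> space ?Q'" "\<zeta> \<in> space M" for w \<zeta>
        using that S' by (auto simp: space_PiM PiE_iff extensional_def)
      have wsp: "w i \<in> space M" if "w \<in> space ?Q'" "i \<in> S'" for w i using that by (auto simp: space_PiM PiE_iff)
      have memE: "w(l := \<zeta>) \<in> E x \<longleftrightarrow> w \<in> ?E' \<zeta>" if w: "w \<in> space ?Q'" "\<zeta> \<in> space M" for w \<zeta>
        using KS' wsp[OF w(1)] w S'(2) unfolding x E_def prod.case mem_Collect_eq upd[OF w] S'_def[symmetric]
        by (auto simp: subset_iff)
      have memG: "w(l := \<zeta>) \<in> G x \<longleftrightarrow> w \<in> ?G' \<zeta>" if w: "w \<in> space ?Q'" "\<zeta> \<in> space M" for w \<zeta>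
      proof -
        have "w(l := \<zeta>) \<in> G x \<longleftrightarrow> w(l := \<zeta>) \<in> E x \<and> card {i \<in> K. y ((w(l := \<zeta>)) i)} = c"
          unfolding x G_def E_def prod.case by blast
        also have "\<dots> \<longleftrightarrow> w \<in> ?E' \<zeta> \<and> card {i \<in> K. w i \<in> ?A1 \<zeta>} = c"
          unfolding memE[OF w]
        proof (rule conj_cong[OF refl])
          assume "w \<in> ?E' \<zeta>"
          then have "y ((w(l := \<zeta>)) i) \<longleftrightarrow> w i \<in> ?A1 \<zeta>" if "i \<in> K" for i
            using that KS'(2) by auto
          then have "{i \<in> K. y ((w(l := \<zeta>)) i)} = {i \<in> K. w i \<in> ?A1 \<zeta>}" by blast
          then show "card {i \<in> K. y ((w(l := \<zeta>)) i)} = c \<longleftrightarrow> card {i \<in> K. w i \<in> ?A1 \<zeta>} = c" by simp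
        qed
        also have "\<dots> \<longleftrightarrow> w \<in> ?G' \<zeta>" by blast
        finally show ?thesis .
      qed
      have indE: "indicator (E x) (w(l := \<zeta>)) = (indicator (?E' \<zeta>) w :: ennreal)"
        if "w \<in> space ?Q'" "\<zeta> \<in> space M" for w \<zeta>
        unfolding indicator_def memE[OF that] ..
      have indG: "indicator (G x) (w(l := \<zeta>)) = (indicator (?G' \<zeta>) w :: ennreal)"
        if "w \<in> space ?Q'" "\<zeta> \<in> space M" for w \<zeta>
        unfolding indicator_def memG[OF that] ..
      have comp: "Measurable.pred ?Q' (\<lambda>w. w i \<in> A)" if "i \<in> S'" "A \<in> events" for i A
        using that by measurable
      have E'm: "?E' \<zeta> \<in> sets ?Q'" if \<zeta>: "\<zeta> \<in> space M" for \<zeta>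
        using KS'(1) S'(1) fK meas[OF \<zeta>]
        by (intro predE pred_intros_logic(3) pred_intros_finite comp) auto
      have G'm: "?G' \<zeta> \<in> sets ?Q'" if \<zeta>: "\<zeta> \<in> space M" for \<zeta>
      proof -
        have eq: "?G' \<zeta> = ?E' \<zeta> \<inter> {w \<in> space ?Q'. card {i \<in> K. w i \<in> ?A1 \<zeta>} = c}"
          by auto
        have [measurable]: "(\<lambda>w. card {i \<in> K. w i \<in> ?A1 \<zeta>}) \<in> ?Q' \<rightarrow>\<^sub>M count_space UNIV"
          using KS'(1) meas[OF \<zeta>] by (intro measurable_card_Collect fK comp) auto
        show ?thesis unfolding eq using E'm[OF \<zeta>] by measurable
      qed
      have inE: "(\<integral>\<^sup>+ w. indicator (E x) (w(l := \<zeta>)) \<partial>?Q') = emeasure ?Q' (?E' \<zeta>)" if \<zeta>: "\<zeta> \<in> space M" for \<zeta>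
        unfolding nn_integral_indicator[OF E'm[OF \<zeta>], symmetric] by (intro nn_integral_cong indE \<zeta>)
      have inG: "(\<integral>\<^sup>+ w. indicator (G x) (w(l := \<zeta>)) \<partial>?Q') = emeasure ?Q' (?G' \<zeta>)" if \<zeta>: "\<zeta> \<in> space M" for \<zeta>
        unfolding nn_integral_indicator[OF G'm[OF \<zeta>], symmetric] by (intro nn_integral_cong indG \<zeta>)
      \<comment> \<open>Fubini with coordinate \<open>l\<close> integrated last: its value
        \<open>\<zeta>\<close> fixes the sets below and above, and the bound is uniform in
        \<open>\<zeta>\<close>.\<close>
      have "emeasure ?Q (G x) = (\<integral>\<^sup>+ \<zeta>. \<integral>\<^sup>+ w. indicator (G x) (w(l := \<zeta>)) \<partial>?Q' \<partial>M)"
        using Gm[OF xI] unfolding S'(3) nn_integral_indicator[OF Gm[OF xI, unfolded S'(3)], symmetric]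
        by (intro Q.product_nn_integral_insert_rev) (use S' in auto)
      also have "\<dots> = (\<integral>\<^sup>+ \<zeta>. emeasure ?Q' (?G' \<zeta>) \<partial>M)"
        by (intro nn_integral_cong inG)
      also have "\<dots> \<le> (\<integral>\<^sup>+ \<zeta>. ?C * emeasure ?Q' (?E' \<zeta>) \<partial>M)"
        using S' KS' x k c meas by (intro nn_integral_mono box_count_le) auto
      also have "\<dots> = (\<integral>\<^sup>+ \<zeta>. ?C * \<integral>\<^sup>+ w. indicator (E x) (w(l := \<zeta>)) \<partial>?Q' \<partial>M)"
        by (intro nn_integral_cong arg_cong2[where f = times] inE[symmetric] refl)
      also have "\<dots> = (\<integral>\<^sup>+ \<zeta>. \<integral>\<^sup>+ w. ?C * indicator (E x) (w(l := \<zeta>)) \<partial>?Q' \<partial>M)"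
      proof (intro nn_integral_cong nn_integral_cmult[symmetric])
        fix \<zeta> assume \<zeta>: "\<zeta> \<in> space M"
        show "(\<lambda>w. indicator (E x) (w(l := \<zeta>)) :: ennreal) \<in> borel_measurable ?Q'"
          using E'm[OF \<zeta>] by (subst measurable_cong[OF indE[OF _ \<zeta>]]) auto
      qed
      also have "\<dots> = (\<integral>\<^sup>+ w. ?C * indicator (E x) w \<partial>?Q)"
        unfolding S'(3) by (intro Q.product_nn_integral_insert_rev[symmetric] borel_measurable_times)
          (use S' Em[OF xI] in auto)
      also have "\<dots> = ?C * emeasure ?Q (E x)"
        using Em[OF xI] by (simp add: nn_integral_cmult)
      finally show ?thesis .
    qed
    have Kchar: "K = {i \<in> S. lt (w i) (w l)}" if "w \<in> E (l, K)" "(l, K) \<in> I" for w l K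
      using that irr tr unfolding E_def I_def prod.case by blast
    \<comment> \<open>Two distinct boundary points would be comparable, so their sets of
      predecessors would be strictly nested, although both have \<open>k\<close> elements.\<close>
    have disj: "disjoint_family_on E I"
      unfolding disjoint_family_on_def
    proof (intro ballI impI, rule ccontr)
      fix x x' assume x: "x \<in> I" "x' \<in> I" "x \<noteq> x'" and ne: "E x \<inter> E x' \<noteq> {}"
      obtain l K l' K' where xx: "x = (l, K)" "x' = (l', K')" by fastforce
      obtain w where w: "w \<in> E x" "w \<in> E x'" using ne by blast
      have K: "K = {i \<in> S. lt (w i) (w l)}" "K' = {i \<in> S. lt (w i) (w l')}"
        using Kchar w x unfolding xx by blast+
      have l: "l \<in> S" "l' \<in> S" "card K = k" "card K' = k" using x by (auto simp: I_def xx)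
      have fK: "finite K" "finite K'" using K S by auto
      have "l \<noteq> l'" using K x(3) xx by auto
      then have "lt (w l) (w l') \<or> lt (w l') (w l)"
        using w(1) l unfolding xx E_def prod.case by blast
      then have "K \<subset> K' \<or> K' \<subset> K" unfolding K using l tr irr by blast
      then have "card K < card K' \<or> card K' < card K" using fK psubset_card_mono by blast
      then show False using l by simp
    qed
    have cover: "AE w in ?Q. w \<in> ?Ev \<longrightarrow> w \<in> (\<Union>x\<in>I. G x)"
      using total
    proof (eventually_elim, safe)
      fix w assume tot: "\<forall>i\<in>S. \<forall>j\<in>S. i \<noteq> j \<longrightarrow> lt (w i) (w j) \<or> lt (w j) (w i)"
        and w: "w \<in> space ?Q" and cw: "c = card {i \<in> firsts k (\<lambda>i j. lt (w i) (w j)) S. y (w i)}"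
      interpret st: strict_total_on "\<lambda>i j. lt (w i) (w j)" S
        by unfold_locales (use S irr tr tot in blast)+
      obtain l where l: "l \<in> S" "card {j \<in> S. lt (w j) (w l)} = k"
        using bij_betw_imp_surj_on[OF st.bij_betw_card_below] kS by (metis (no_types, lifting) imageE lessThan_iff)
      define K where "K = {j \<in> S. lt (w j) (w l)}"
      have KI: "(l, K) \<in> I" using l irr by (auto simp: I_def K_def)
      have firsts_K: "firsts k (\<lambda>i j. lt (w i) (w j)) S = K"
        unfolding firsts_def K_def l(2)[symmetric]
        using st.card_below_less st.lt_total l(1) by (metis (no_types, lifting) less_asym' less_irrefl)
      have "w \<in> G (l, K)"
        unfolding G_def prod.case using w cw tot l(1) by (auto simp: firsts_K) (auto simp: K_def)
      then show "w \<in> (\<Union>x\<in>I. G x)" using KI by blast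
    qed
    have "emeasure ?Q ?Ev \<le> emeasure ?Q (\<Union>x\<in>I. G x)"
      by (rule emeasure_mono_AE[OF cover]) (use fI Gm in auto)
    also have "\<dots> \<le> (\<Sum>x\<in>I. emeasure ?Q (G x))"
      using fI Gm by (intro emeasure_subadditive_finite) auto
    also have "\<dots> \<le> (\<Sum>x\<in>I. ?C * emeasure ?Q (E x))" by (intro sum_mono GE)
    also have "\<dots> = ?C * emeasure ?Q (\<Union>x\<in>I. E x)"
      using disj fI Em by (subst sum_emeasure[symmetric]) (auto simp: sum_distrib_left[symmetric])
    also have "\<dots> \<le> ?C * 1" by (intro mult_left_mono Q.P.emeasure_le_1) simp
    finally show ?thesis by simp
  qed
qed

section \<open>Random tie-breakers\<close>

lemma distr_pair_PiM:
  fixes S :: "'i set"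
  assumes S: "finite S" and A: "prob_space A" and B: "prob_space B"
  shows "distr (Pi\<^sub>M S (\<lambda>_. A) \<Otimes>\<^sub>M Pi\<^sub>M S (\<lambda>_. B)) (Pi\<^sub>M S (\<lambda>_. A \<Otimes>\<^sub>M B)) (\<lambda>(z, u). \<lambda>i\<in>S. (z i, u i))
    = Pi\<^sub>M S (\<lambda>_. A \<Otimes>\<^sub>M B)"
    (is "distr (?QA \<Otimes>\<^sub>M ?QB) ?Q ?f = _")
proof -
  interpret A: prob_space A by fact
  interpret B: prob_space B by fact
  interpret AB: pair_prob_space A B ..
  interpret PA: product_sigma_finite "\<lambda>_ :: 'i. A" by unfold_locales
  interpret PB: product_sigma_finite "\<lambda>_ :: 'i. B" by unfold_locales
  interpret P: product_sigma_finite "\<lambda>_ :: 'i. A \<Otimes>\<^sub>M B" by unfold_locales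
  interpret QB: prob_space ?QB by (intro prob_space_PiM B)
  show ?thesis
  proof (rule P.PiM_eqI[OF S])
    fix X assume X: "\<And>i. i \<in> S \<Longrightarrow> X i \<in> sets (A \<Otimes>\<^sub>M B)"
    have f[measurable]: "?f \<in> ?QA \<Otimes>\<^sub>M ?QB \<rightarrow>\<^sub>M ?Q" by measurable
    have XQ: "Pi\<^sub>E S X \<in> sets ?Q" using S X by auto
    have "emeasure (distr (?QA \<Otimes>\<^sub>M ?QB) ?Q ?f) (Pi\<^sub>E S X) =
        emeasure (?QA \<Otimes>\<^sub>M ?QB) (?f -` Pi\<^sub>E S X \<inter> space (?QA \<Otimes>\<^sub>M ?QB))"
      by (rule emeasure_distr[OF f XQ])
    \<comment> \<open>The section of a box at \<open>z\<close> is the box of the sections at the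
      coordinates of \<open>z\<close>, so the integrand is a product over the coordinates and the
      integral factors.\<close>
    also have "\<dots> = (\<integral>\<^sup>+ z. emeasure ?QB (Pair z -` (?f -` Pi\<^sub>E S X \<inter> space (?QA \<Otimes>\<^sub>M ?QB))) \<partial>?QA)"
      by (rule QB.emeasure_pair_measure_alt) (use f XQ in measurable)
    also have "\<dots> = (\<integral>\<^sup>+ z. (\<Prod>i\<in>S. emeasure B (Pair (z i) -` X i)) \<partial>?QA)"
    proof (rule nn_integral_cong)
      fix z assume z: "z \<in> space ?QA"
      have "Pair (z i) -` X i \<in> sets B" if "i \<in> S" for i using X[OF that] by (rule sets_Pair1)
      moreover have "Pair z -` (?f -` Pi\<^sub>E S X \<inter> space (?QA \<Otimes>\<^sub>M ?QB)) = Pi\<^sub>E S (\<lambda>i. Pair (z i) -` X i)"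
      proof (intro equalityI subsetI)
        fix u assume "u \<in> Pi\<^sub>E S (\<lambda>i. Pair (z i) -` X i)"
        then have u: "(z i, u i) \<in> X i" "u \<in> extensional S" if "i \<in> S" for i using that by (auto simp: PiE_iff)
        then have "u i \<in> space B" if "i \<in> S" for i
          using sets.sets_into_space[OF X[OF that]] that by (auto simp: space_pair_measure)
        then show "u \<in> Pair z -` (?f -` Pi\<^sub>E S X \<inter> space (?QA \<Otimes>\<^sub>M ?QB))"
          using z \<open>u \<in> Pi\<^sub>E S _\<close> by (auto simp: PiE_iff space_pair_measure space_PiM)
      qed (use z in \<open>auto simp: PiE_iff space_pair_measure space_PiM split: if_splits\<close>)
      ultimately show "emeasure ?QB (Pair z -` (?f -` Pi\<^sub>E S X \<inter> space (?QA \<Otimes>\<^sub>M ?QB))) =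
          (\<Prod>i\<in>S. emeasure B (Pair (z i) -` X i))"
        using S by (simp add: PB.emeasure_PiM)
    qed
    also have "\<dots> = (\<Prod>i\<in>S. \<integral>\<^sup>+ a. emeasure B (Pair a -` X i) \<partial>A)"
      using S X by (intro PA.product_nn_integral_prod B.measurable_emeasure_Pair) auto
    also have "\<dots> = (\<Prod>i\<in>S. emeasure (A \<Otimes>\<^sub>M B) (X i))"
      by (intro prod.cong refl B.emeasure_pair_measure_alt[symmetric] X)
    finally show "emeasure (distr (?QA \<Otimes>\<^sub>M ?QB) ?Q ?f) (Pi\<^sub>E S X) = (\<Prod>i\<in>S. emeasure (A \<Otimes>\<^sub>M B) (X i))" .
  qed simp
qed

text \<open>Once the other coordinates are fixed, \<open>g (w i)\<close> would have to hit the
  single value \<open>g (w j)\<close>, an event of probability 0.\<close>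

lemma AE_PiM_distinct:
  fixes S :: "'i set" and g :: "'a \<Rightarrow> real"
  assumes S: "finite S" and N: "prob_space N" and g[measurable]: "g \<in> borel_measurable N"
    and atomless: "\<And>t. emeasure N {a \<in> space N. g a = t} = 0"
  shows "AE w in Pi\<^sub>M S (\<lambda>_. N). \<forall>i\<in>S. \<forall>j\<in>S. i \<noteq> j \<longrightarrow> g (w i) \<noteq> g (w j)"
proof (intro eventually_ball_finite S ballI)
  interpret N: prob_space N by fact
  interpret product_sigma_finite "\<lambda>_ :: 'i. N" by unfold_locales
  fix i j assume ij: "i \<in> S" "j \<in> S"
  let ?Q = "Pi\<^sub>M S (\<lambda>_. N)"
  show "AE w in ?Q. i \<noteq> j \<longrightarrow> g (w i) \<noteq> g (w j)"
  proof (cases "i = j")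
    case False
    define S' where "S' = S - {i}"
    have S': "finite S'" "i \<notin> S'" "S = insert i S'" "j \<in> S'" using S ij False by (auto simp: S'_def)
    let ?N = "{w \<in> space ?Q. g (w i) = g (w j)}"
    have m: "?N \<in> sets ?Q" using ij by measurable
    have "emeasure ?Q ?N = (\<integral>\<^sup>+ w. \<integral>\<^sup>+ a. indicator ?N (w(i := a)) \<partial>N \<partial>Pi\<^sub>M S' (\<lambda>_. N))"
      unfolding nn_integral_indicator[OF m, symmetric] unfolding S'(3)
      by (rule product_nn_integral_insert) (use S' m in auto)
    also have "\<dots> = (\<integral>\<^sup>+ w. 0 \<partial>Pi\<^sub>M S' (\<lambda>_. N))"
    proof (rule nn_integral_cong)
      fix w assume "w \<in> space (Pi\<^sub>M S' (\<lambda>_. N))"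
      have "(\<integral>\<^sup>+ a. indicator ?N (w(i := a)) \<partial>N) \<le> (\<integral>\<^sup>+ a. indicator {a \<in> space N. g a = g (w j)} a \<partial>N)"
        using S' by (intro nn_integral_mono) (auto simp: indicator_def)
      also have "\<dots> = 0" by (subst nn_integral_indicator) (auto simp: atomless)
      finally show "(\<integral>\<^sup>+ a. indicator ?N (w(i := a)) \<partial>N) = 0" by simp
    qed
    finally have "emeasure ?Q ?N = 0" by simp
    then show ?thesis using m by (intro AE_I[of _ _ ?N]) auto
  qed simp
qed

lemma strict_total_on_key:
  fixes u :: "'i \<Rightarrow> real"
  assumes "finite S" "inj_on u S"
  shows "strict_total_on (\<lambda>i j. u i < u j) S"
proof
  show "u i < u j \<or> u j < u i" if "i \<in> S" "j \<in> S" "i \<noteq> j" for i j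
    using inj_onD[OF assms(2), of i j] that by linarith
qed (use assms in auto)

text \<open>\<open>\<tau>\<close> sends an index to the element whose rank under \<open>u\<close>
  equals the rank of the index, so it carries the natural order of indices to the order of the
  keys.\<close>

lemma ex_sorting_bij:
  fixes u :: "nat \<Rightarrow> real"
  assumes S: "finite S" and u: "inj_on u S"
  obtains \<tau> where "bij_betw \<tau> S S" "\<And>i j. i \<in> S \<Longrightarrow> j \<in> S \<Longrightarrow> u (\<tau> i) < u (\<tau> j) \<longleftrightarrow> i < j"
proof -
  interpret u: strict_total_on "\<lambda>i j. u i < u j" S by (rule strict_total_on_key[OF S u])
  interpret i: strict_total_on "\<lambda>i j. real i < real j" S
    by (rule strict_total_on_key[OF S]) (simp add: inj_on_def)
  let ?ru = "\<lambda>i. card {j \<in> S. u j < u i}" and ?ri = "\<lambda>i. card {j \<in> S. real j < real i}"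
  define \<tau> where "\<tau> = inv_into S ?ru \<circ> ?ri"
  have bij: "bij_betw \<tau> S S"
    unfolding \<tau>_def by (rule bij_betw_trans[OF i.bij_betw_card_below bij_betw_inv_into[OF u.bij_betw_card_below]])
  have \<tau>S: "\<tau> i \<in> S" if "i \<in> S" for i using bij_betwE[OF bij] that by blast
  have r: "?ru (\<tau> i) = ?ri i" if "i \<in> S" for i
  proof -
    have "?ri i \<in> ?ru ` S"
      using bij_betwE[OF i.bij_betw_card_below] that unfolding bij_betw_imp_surj_on[OF u.bij_betw_card_below] by blast
    then show ?thesis unfolding \<tau>_def comp_def by (rule f_inv_into_f)
  qed
  have "u (\<tau> i) < u (\<tau> j) \<longleftrightarrow> i < j" if ij: "i \<in> S" "j \<in> S" for i j
  proof -
    have iff: "lt a b \<longleftrightarrow> card {l \<in> S. lt l a} < card {l \<in> S. lt l b}"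
      if "strict_total_on lt S" "a \<in> S" "b \<in> S" for lt and a b :: nat
      using strict_total_on.card_below_less[OF that(1), of a b] strict_total_on.card_below_less[OF that(1), of b a]
        strict_total_on.lt_total[OF that(1), of a b] strict_total_on.lt_irrefl[OF that(1), of a] that(2,3)
      by (cases "a = b") auto
    have "u (\<tau> i) < u (\<tau> j) \<longleftrightarrow> ?ru (\<tau> i) < ?ru (\<tau> j)"
      by (rule iff[OF u.strict_total_on_axioms \<tau>S[OF ij(1)] \<tau>S[OF ij(2)]])
    also have "\<dots> \<longleftrightarrow> real i < real j"
      unfolding r[OF ij(1)] r[OF ij(2)] by (rule iff[OF i.strict_total_on_axioms ij, symmetric])
    finally show ?thesis by simp
  qed
  with bij that show ?thesis by blast
qed

lemma measurable_card_firsts: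
  assumes "finite S"
    and "\<And>i j. i \<in> S \<Longrightarrow> j \<in> S \<Longrightarrow> Measurable.pred M (\<lambda>w. lt w i j)"
    and "\<And>i. i \<in> S \<Longrightarrow> Measurable.pred M (\<lambda>w. y w i)"
  shows "(\<lambda>w. card {i \<in> firsts k (lt w) S. y w i}) \<in> M \<rightarrow>\<^sub>M count_space UNIV"
proof -
  have m: "Measurable.pred M (\<lambda>w. i \<in> firsts k (lt w) S)" if "i \<in> S" for i
  proof -
    have [measurable]: "(\<lambda>w. card {j \<in> S. lt w j i}) \<in> M \<rightarrow>\<^sub>M count_space UNIV"
      using that assms by (intro measurable_card_Collect) auto
    have "i \<in> firsts k (lt w) S \<longleftrightarrow> card {j \<in> S. lt w j i} < k" for w using that by (simp add: firsts_def)
    then show ?thesis by simp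
  qed
  have "{i \<in> firsts k (lt w) S. y w i} = {i \<in> S. i \<in> firsts k (lt w) S \<and> y w i}" for w
    by (auto simp: firsts_def)
  then show ?thesis
    using assms m by (simp, intro measurable_card_Collect pred_intros_logic) auto
qed

text \<open>
  Ties are broken by the index; by exchangeability they may be broken by independent uniform
  variables instead, which makes the pairs of a point and its tie-breaker i.i.d. and tie-free.
\<close>

lemma firsts_count_index_le:
  fixes S :: "nat set" and d :: "'a \<Rightarrow> real"
  assumes S: "finite S" and k: "k \<ge> 1" "k \<le> card S" and P: "prob_space P"
    and d[measurable]: "d \<in> borel_measurable P" and y[measurable]: "Measurable.pred P y"
    and c: "k \<le> 2 * c + 2" "2 * c \<le> k + 2"
  shows "emeasure (Pi\<^sub>M S (\<lambda>_. P)) {w \<in> space (Pi\<^sub>M S (\<lambda>_. P)).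
      card {i \<in> firsts k (\<lambda>i j. d (w i) < d (w j) \<or> d (w i) = d (w j) \<and> i < j) S. y (w i)} = c}
    \<le> ennreal (3.28 / sqrt (real k))"
proof -
  interpret P: prob_space P by fact
  define U where "U = uniform_measure lborel {0..1::real}"
  have U: "prob_space U" unfolding U_def by (rule prob_space_uniform_measure) auto
  interpret U: prob_space U by fact
  interpret PU: pair_prob_space P U ..
  have setsU[measurable_cong]: "sets U = sets borel" by (simp add: U_def)
  have spaceU[simp]: "space U = UNIV" by (simp add: U_def)
  have atom: "emeasure U {t} = 0" for t
  proof -
    have "emeasure lborel ({0..1} \<inter> {t}) = 0" by (intro emeasure_lborel_countable countable_finite) simp
    then show ?thesis unfolding U_def by simp
  qed
  let ?QP = "Pi\<^sub>M S (\<lambda>_. P)" and ?QU = "Pi\<^sub>M S (\<lambda>_. U)" and ?Q = "Pi\<^sub>M S (\<lambda>_. P \<Otimes>\<^sub>M U)"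
  interpret QP: prob_space ?QP by (intro prob_space_PiM P)
  interpret QU: prob_space ?QU by (intro prob_space_PiM U)
  interpret QQ: pair_prob_space ?QP ?QU ..
  define T :: "(nat \<Rightarrow> real) \<Rightarrow> (nat \<Rightarrow> 'a) \<Rightarrow> nat" where
    "T u z = card {i \<in> firsts k (\<lambda>i j. d (z i) < d (z j) \<or> d (z i) = d (z j) \<and> u i < u j) S. y (z i)}" for u z
  have T_meas: "(\<lambda>x. T (f x) (g x)) \<in> N \<rightarrow>\<^sub>M count_space UNIV"
    if f: "f \<in> N \<rightarrow>\<^sub>M ?QU" and g: "g \<in> N \<rightarrow>\<^sub>M ?QP" for f g and N :: "'z measure"
  proof -
    have [measurable]: "(\<lambda>x. f x i) \<in> borel_measurable N" "(\<lambda>x. g x i) \<in> N \<rightarrow>\<^sub>M P" if "i \<in> S" for i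
      using measurable_compose[OF f measurable_component_singleton[OF that]]
        measurable_compose[OF g measurable_component_singleton[OF that]]
      by (simp_all add: measurable_cong_sets[OF refl setsU])
    show ?thesis unfolding T_def
      by (rule measurable_card_firsts[OF S]) measurable
  qed
  have T_meas1: "T u \<in> ?QP \<rightarrow>\<^sub>M count_space UNIV" for u
  proof -
    have "T u = T (restrict u S)"
      by (rule ext, unfold T_def, intro arg_cong[where f = card] Collect_cong conj_cong refl arg_cong2[where f="(\<in>)"] firsts_cong) simp
    moreover have "(\<lambda>_. restrict u S) \<in> ?QP \<rightarrow>\<^sub>M ?QU" by (intro measurable_const) (simp add: space_PiM)
    ultimately show ?thesis using T_meas[of "\<lambda>_. restrict u S" ?QP "\<lambda>z. z"] by simp
  qed
  \<comment> \<open>The sorting bijection turns the order by keys into the order by index, and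
    permuting the coordinates preserves the i.i.d. law. So every injective key gives the same
    distribution of the count.\<close>
  have same_law: "emeasure ?QP {z \<in> space ?QP. T u z = c} = emeasure ?QP {z \<in> space ?QP. T real z = c}"
    if u: "inj_on u S" for u
  proof -
    obtain \<tau> where \<tau>: "bij_betw \<tau> S S" and mono: "\<And>i j. i \<in> S \<Longrightarrow> j \<in> S \<Longrightarrow> u (\<tau> i) < u (\<tau> j) \<longleftrightarrow> i < j"
      using ex_sorting_bij[OF S u] by metis
    have inj: "inj_on \<tau> S" and img: "\<tau> ` S = S" using \<tau> by (auto simp: bij_betw_def)
    have \<tau>S: "\<tau> \<in> S \<rightarrow> S" using img by auto
    have law: "distr ?QP ?QP (\<lambda>z. \<lambda>i\<in>S. z (\<tau> i)) = ?QP"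
      using distr_PiM_reindex[of S "\<lambda>_. P" \<tau> S] P inj \<tau>S by simp
    have Tz: "T u z = T real (\<lambda>i\<in>S. z (\<tau> i))" for z
    proof -
      let ?lt = "\<lambda>i j. d (z i) < d (z j) \<or> d (z i) = d (z j) \<and> u i < u j"
      let ?z = "\<lambda>i\<in>S. z (\<tau> i)"
      let ?F = "firsts k (\<lambda>i j. d (?z i) < d (?z j) \<or> d (?z i) = d (?z j) \<and> real i < real j) S"
      have "firsts k ?lt S = \<tau> ` firsts k (\<lambda>i j. ?lt (\<tau> i) (\<tau> j)) S"
        using firsts_reindex[OF inj, of k ?lt] by (simp only: img)
      also have "firsts k (\<lambda>i j. ?lt (\<tau> i) (\<tau> j)) S = ?F"
        by (rule firsts_cong) (simp add: mono)
      finally have "{i \<in> firsts k ?lt S. y (z i)} = \<tau> ` {i \<in> ?F. y (?z i)}"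
        by (auto simp: firsts_def)
      moreover have "inj_on \<tau> {i \<in> ?F. y (?z i)}"
        by (rule inj_on_subset[OF inj]) (auto simp: firsts_def)
      ultimately show ?thesis unfolding T_def by (simp add: card_image)
    qed
    have m: "(\<lambda>z. \<lambda>i\<in>S. z (\<tau> i)) \<in> ?QP \<rightarrow>\<^sub>M ?QP"
      using \<tau>S by (intro measurable_restrict measurable_component_singleton) auto
    have set: "{z \<in> space ?QP. T real z = c} \<in> sets ?QP" using T_meas1[of real] by measurable
    have "emeasure ?QP {z \<in> space ?QP. T real z = c} =
        emeasure ?QP ((\<lambda>z. \<lambda>i\<in>S. z (\<tau> i)) -` {z \<in> space ?QP. T real z = c} \<inter> space ?QP)"
      by (subst law[symmetric], subst emeasure_distr[OF m]) (use set in simp_all)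
    also have "(\<lambda>z. \<lambda>i\<in>S. z (\<tau> i)) -` {z \<in> space ?QP. T real z = c} \<inter> space ?QP = {z \<in> space ?QP. T u z = c}"
      using measurable_space[OF m] by (auto simp: Tz)
    finally show ?thesis ..
  qed
  have "AE u in ?QU. \<forall>i\<in>S. \<forall>j\<in>S. i \<noteq> j \<longrightarrow> u i \<noteq> u j"
    using AE_PiM_distinct[OF S U, of "\<lambda>x. x"] atom by simp
  then have inj: "AE u in ?QU. inj_on u S"
    by eventually_elim (auto simp: inj_on_def)
  let ?lt = "\<lambda>(a, s) (b, t). d a < d b \<or> d a = d b \<and> s < (t :: real)"
  let ?E3 = "{w \<in> space ?Q. card {i \<in> firsts k (\<lambda>i j. ?lt (w i) (w j)) S. y (fst (w i))} = c}"
  let ?E2 = "{(z, u). z \<in> space ?QP \<and> u \<in> space ?QU \<and> T u z = c}"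
  let ?m = "\<lambda>(z, u). \<lambda>i\<in>S. (z i, u i)"
  have E2: "?E2 \<in> sets (?QP \<Otimes>\<^sub>M ?QU)"
  proof -
    have "?E2 = {x \<in> space (?QP \<Otimes>\<^sub>M ?QU). T (snd x) (fst x) = c}" by (auto simp: space_pair_measure)
    also have "\<dots> \<in> sets (?QP \<Otimes>\<^sub>M ?QU)"
      using T_meas[of snd "?QP \<Otimes>\<^sub>M ?QU" fst] by measurable
    finally show ?thesis .
  qed
  have lt_meas: "Measurable.pred ((P \<Otimes>\<^sub>M U) \<Otimes>\<^sub>M (P \<Otimes>\<^sub>M U)) (\<lambda>(a, b). ?lt a b)"
    by (simp add: split_beta') measurable
  have mm: "?m \<in> ?QP \<Otimes>\<^sub>M ?QU \<rightarrow>\<^sub>M ?Q" by measurable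
  have E3: "?E3 \<in> sets ?Q"
  proof -
    have "(\<lambda>w. card {i \<in> firsts k (\<lambda>i j. ?lt (w i) (w j)) S. y (fst (w i))}) \<in> ?Q \<rightarrow>\<^sub>M count_space UNIV"
    proof (rule measurable_card_firsts[OF S])
      fix i j assume ij: "i \<in> S" "j \<in> S"
      have "(\<lambda>w. (w i, w j)) \<in> ?Q \<rightarrow>\<^sub>M (P \<Otimes>\<^sub>M U) \<Otimes>\<^sub>M (P \<Otimes>\<^sub>M U)" using ij by measurable
      from measurable_compose[OF this lt_meas]
      show "Measurable.pred ?Q (\<lambda>w. ?lt (w i) (w j))" by simp
      show "Measurable.pred ?Q (\<lambda>w. y (fst (w i)))" using ij by measurable
    qed
    then show ?thesis by measurable
  qed
  \<comment> \<open>A constant is averaged over the tie-breakers; almost every one of them is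
    injective, so the index may be exchanged for it inside the integral.\<close>
  have "emeasure ?QP {z \<in> space ?QP. T real z = c} = (\<integral>\<^sup>+ u. emeasure ?QP {z \<in> space ?QP. T real z = c} \<partial>?QU)"
    by (simp add: QU.emeasure_space_1)
  also have "\<dots> = (\<integral>\<^sup>+ u. emeasure ?QP {z \<in> space ?QP. T u z = c} \<partial>?QU)"
    by (rule nn_integral_cong_AE, rule eventually_mono[OF inj], rule same_law[symmetric])
  also have "\<dots> = (\<integral>\<^sup>+ u. emeasure ?QP ((\<lambda>z. (z, u)) -` ?E2) \<partial>?QU)"
    by (intro nn_integral_cong arg_cong2[where f = emeasure] refl) auto
  also have "\<dots> = emeasure (?QP \<Otimes>\<^sub>M ?QU) ?E2"
    by (rule QQ.emeasure_pair_measure_alt2[OF E2, symmetric])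
  also have "?E2 = ?m -` ?E3 \<inter> space (?QP \<Otimes>\<^sub>M ?QU)"
  proof -
    have "card {i \<in> firsts k (\<lambda>i j. ?lt (?m (z, u) i) (?m (z, u) j)) S. y (fst (?m (z, u) i))} = T u z" for z u
    proof -
      have "firsts k (\<lambda>i j. ?lt (?m (z, u) i) (?m (z, u) j)) S =
          firsts k (\<lambda>i j. d (z i) < d (z j) \<or> d (z i) = d (z j) \<and> u i < u j) S"
        by (rule firsts_cong) simp
      then show ?thesis unfolding T_def by (intro arg_cong[where f = card]) (auto simp: firsts_def)
    qed
    then show ?thesis using measurable_space[OF mm] by (auto simp: space_pair_measure)
  qed
  also have "emeasure (?QP \<Otimes>\<^sub>M ?QU) \<dots> = emeasure ?Q ?E3"
    by (subst (2) distr_pair_PiM[OF S P U, symmetric], subst emeasure_distr[OF mm E3]) simp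
  also have "\<dots> \<le> ennreal (3.28 / sqrt (real k))"
  proof (rule PU.firsts_count_le[OF S k lt_meas])
    have z: "emeasure (P \<Otimes>\<^sub>M U) {a \<in> space (P \<Otimes>\<^sub>M U). snd a = t} = 0" for t
    proof -
      have "{a \<in> space (P \<Otimes>\<^sub>M U). snd a = t} = space P \<times> {t}" by (auto simp: space_pair_measure)
      then show ?thesis by (simp add: U.emeasure_pair_measure_Times atom setsU)
    qed
    have "AE w in ?Q. \<forall>i\<in>S. \<forall>j\<in>S. i \<noteq> j \<longrightarrow> snd (w i) \<noteq> snd (w j)"
      by (rule AE_PiM_distinct[OF S PU.prob_space_axioms _ z]) (simp add: measurable_snd'' cong: measurable_cong_sets)
    then show "AE w in ?Q. \<forall>i\<in>S. \<forall>j\<in>S. i \<noteq> j \<longrightarrow> ?lt (w i) (w j) \<or> ?lt (w j) (w i)"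
      by eventually_elim (auto simp: split_beta' neq_iff)
  qed (use c in \<open>auto simp: split_beta'\<close>)
  finally show ?thesis by (simp add: T_def)
qed

section \<open>The leave-one-out error\<close>

abbreviation loo_close :: "nat \<Rightarrow> nat \<Rightarrow> (nat \<Rightarrow> (real ^ 'd) \<times> bool) \<Rightarrow> nat \<Rightarrow> bool" where
  "loo_close k m u i \<equiv> close_call k (\<lambda>l. fst (u l)) (\<lambda>l. snd (u l)) ({..<m} - {i}) (fst (u i))"

text \<open>By \<open>knn_flip\<close>, if replacing observation \<open>j\<close> changes the
  prediction at \<open>i\<close>, then this relation holds before or after the replacement.\<close>

definition influences :: "nat \<Rightarrow> nat \<Rightarrow> (nat \<Rightarrow> (real ^ 'd) \<times> bool) \<Rightarrow> nat \<Rightarrow> nat \<Rightarrow> bool" where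
  "influences k m u j i \<longleftrightarrow>
     j \<in> nearest k (\<lambda>l. fst (u l)) ({..<m} - {i}) (fst (u i)) \<and>
     loo_close k m u i"

definition influence :: "nat \<Rightarrow> nat \<Rightarrow> (nat \<Rightarrow> (real ^ 'd) \<times> bool) \<Rightarrow> nat \<Rightarrow> real" where
  "influence k m u j = (\<Sum>i\<in>{..<m} - {j}. of_bool (influences k m u j i))"

text \<open>Coordinates below \<open>m\<close> carry the data, coordinate \<open>m + i\<close> carries the coin of test point \<open>i\<close>.\<close>

definition loo_loss :: "nat \<Rightarrow> nat \<Rightarrow> (nat \<Rightarrow> (real ^ 'd) \<times> bool) \<Rightarrow> nat \<Rightarrow> real" where
  "loo_loss k m u i = of_bool (knn_classifier k (\<lambda>l. fst (u l)) (\<lambda>l. snd (u l)) ({..<m} - {i})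
     (snd (u (m + i))) (fst (u i)) \<noteq> snd (u i))"

definition loo_error :: "nat \<Rightarrow> nat \<Rightarrow> (nat \<Rightarrow> (real ^ 'd) \<times> bool) \<Rightarrow> real" where
  "loo_error k m u = (\<Sum>i<m. loo_loss k m u i) / real m"

lemma loo_loss_bounds: "0 \<le> loo_loss k m u i" "loo_loss k m u i \<le> 1"
  by (auto simp: loo_loss_def)

lemma loo_error_bounds: "0 \<le> loo_error k m u" "loo_error k m u \<le> 1"
proof -
  show "0 \<le> loo_error k m u" unfolding loo_error_def by (intro divide_nonneg_nonneg sum_nonneg loo_loss_bounds) auto
  have "(\<Sum>i<m. loo_loss k m u i) \<le> (\<Sum>i<m. 1)" by (intro sum_mono loo_loss_bounds)
  then show "loo_error k m u \<le> 1" unfolding loo_error_def by (cases "m = 0") (auto simp: field_simps)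
qed

lemma influence_nonneg: "0 \<le> influence k m u j"
  unfolding influence_def by (intro sum_nonneg) auto

text \<open>Forgetting the near tie leaves exactly the cardinality that Stone's property
  bounds.\<close>

lemma influence_le:
  assumes "stone_property \<gamma> m (\<lambda>l. fst (u l))" "j < m" "k \<ge> 1"
  shows "influence k m u j \<le> real k * \<gamma>"
proof -
  let ?A = "{i \<in> {..<m} - {j}. j \<in> nearest k (\<lambda>l. fst (u l)) ({..<m} - {i}) (fst (u i))}"
  have "influence k m u j \<le> (\<Sum>i\<in>{..<m} - {j}. if j \<in> nearest k (\<lambda>l. fst (u l)) ({..<m} - {i}) (fst (u i)) then 1 else 0)"
    unfolding influence_def by (intro sum_mono) (auto simp: influences_def)
  also have "\<dots> = real (card ?A)" by (simp add: sum.If_cases Int_def)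
  also have "\<dots> \<le> real k * \<gamma>" using assms unfolding stone_property_def by blast
  finally show ?thesis .
qed

text \<open>The summand 1 stands for the loss at \<open>j\<close> itself, where test point and true
  label change. At any other test point the loss can change only through the prediction, which
  \<open>knn_flip\<close> charges to one of the two influences.\<close>

lemma loo_error_diff_data:
  assumes k: "k \<ge> 1" "k < m" and j: "j < m"
  defines "u' \<equiv> \<lambda>u z. u(j := z)"
  shows "\<bar>loo_error k m u - loo_error k m (u' u z)\<bar> \<le> (1 + influence k m u j + influence k m (u' u z) j) / real m"
proof -
  have diff: "\<bar>loo_loss k m u i - loo_loss k m (u' u z) i\<bar> \<le>
      of_bool (influences k m u j i) + of_bool (influences k m (u' u z) j i)" if i: "i \<in> {..<m} - {j}" for i
  proof (cases "loo_loss k m u i = loo_loss k m (u' u z) i")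
    case False
    have S: "finite ({..<m} - {i})" "k \<ge> 1" "k \<le> card ({..<m} - {i})" using k i by auto
    have eq: "u' u z i = u i" "u' u z (m + i) = u (m + i)" using i j by (auto simp: u'_def)
    have flip: "knn_classifier k (\<lambda>l. fst (u l)) (\<lambda>l. snd (u l)) ({..<m} - {i}) (snd (u (m + i))) (fst (u i)) \<noteq>
        knn_classifier k (\<lambda>l. fst (u' u z l)) (\<lambda>l. snd (u' u z l)) ({..<m} - {i}) (snd (u (m + i))) (fst (u i))"
      (is "?a \<noteq> ?b")
    proof
      assume "?a = ?b"
      then have "loo_loss k m u i = loo_loss k m (u' u z) i" unfolding loo_loss_def eq by (simp only:)
      with False show False ..
    qed
    have "influences k m u j i \<or> influences k m (u' u z) j i"
      unfolding influences_def eq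
      by (rule knn_flip[OF S _ _ flip]) (simp_all add: u'_def)
    then show ?thesis using loo_loss_bounds[of k m u i] loo_loss_bounds[of k m "u' u z" i] by auto
  qed simp
  have "\<bar>\<Sum>i<m. loo_loss k m u i - loo_loss k m (u' u z) i\<bar> \<le> (\<Sum>i<m. \<bar>loo_loss k m u i - loo_loss k m (u' u z) i\<bar>)"
    by (rule sum_abs)
  also have "\<dots> = \<bar>loo_loss k m u j - loo_loss k m (u' u z) j\<bar> +
      (\<Sum>i\<in>{..<m} - {j}. \<bar>loo_loss k m u i - loo_loss k m (u' u z) i\<bar>)"
    using j by (intro sum.remove) auto
  also have "\<dots> \<le> 1 + (\<Sum>i\<in>{..<m} - {j}. of_bool (influences k m u j i) + of_bool (influences k m (u' u z) j i))"
    using loo_loss_bounds[of k m u j] loo_loss_bounds[of k m "u' u z" j]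
    by (intro add_mono sum_mono diff) auto
  also have "\<dots> = 1 + influence k m u j + influence k m (u' u z) j"
    by (simp add: influence_def sum.distrib)
  finally show ?thesis using j unfolding loo_error_def
    by (simp add: sum_subtractf diff_divide_distrib[symmetric] divide_right_mono)
qed

text \<open>The coordinate \<open>m + i\<close> enters the loss at \<open>i\<close> alone and lies
  outside the training coordinates.\<close>

lemma loo_error_diff_coin:
  assumes i: "i < m"
  shows "\<bar>loo_error k m u - loo_error k m (u(m + i := z))\<bar> \<le> 1 / real m"
proof -
  let ?u' = "u(m + i := z)"
  have same: "loo_loss k m u l = loo_loss k m ?u' l" if "l \<in> {..<m} - {i}" for l
  proof -
    have x: "nearest k (\<lambda>l. fst (u l)) ({..<m} - {l}) (fst (u l)) = nearest k (\<lambda>l. fst (?u' l)) ({..<m} - {l}) (fst (u l))"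
      by (rule nearest_cong) auto
    have s: "(\<Sum>a\<in>nearest k (\<lambda>l. fst (?u' l)) ({..<m} - {l}) (fst (u l)). of_bool (snd (u a))) =
       (\<Sum>a\<in>nearest k (\<lambda>l. fst (?u' l)) ({..<m} - {l}) (fst (u l)). of_bool (snd (?u' a)) :: real)"
      by (rule sum.cong) (auto simp: nearest_def)
    have e: "?u' l = u l" "?u' (m + l) = u (m + l)" using that i by auto
    show ?thesis unfolding loo_loss_def knn_classifier_def x s e ..
  qed
  have "(\<Sum>l<m. loo_loss k m u l) - (\<Sum>l<m. loo_loss k m ?u' l) = loo_loss k m u i - loo_loss k m ?u' i"
    using i same by (simp add: sum.remove[of "{..<m}" i])
  then have "\<bar>(\<Sum>l<m. loo_loss k m u l) - (\<Sum>l<m. loo_loss k m ?u' l)\<bar> \<le> 1"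
    using loo_loss_bounds[of k m u i] loo_loss_bounds[of k m ?u' i] by linarith
  then show ?thesis unfolding loo_error_def
    by (simp add: diff_divide_distrib[symmetric] divide_right_mono)
qed

lemma borel_measurable_votes:
  fixes x :: "nat \<Rightarrow> 'w \<Rightarrow> real ^ 'd"
  assumes "finite S" and [measurable]: "z \<in> borel_measurable M"
    and x: "\<And>i. i \<in> S \<Longrightarrow> x i \<in> borel_measurable M"
    and y: "\<And>i. i \<in> S \<Longrightarrow> Measurable.pred M (y i)"
  shows "(\<lambda>w. votes k (\<lambda>i. x i w) (\<lambda>i. y i w) S (z w)) \<in> borel_measurable M"
  unfolding votes_def nearest_eq_firsts
proof (rule borel_measurable_sum_firsts[OF assms(1)])
  fix i j assume ij: "i \<in> S" "j \<in> S"
  note [measurable] = x[OF ij(1)] x[OF ij(2)] y[OF ij(1)]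
  show "Measurable.pred M (\<lambda>w. closer (\<lambda>i. x i w) (z w) i j)" unfolding closer_def by measurable
  show "(\<lambda>w. of_bool (y i w) :: real) \<in> borel_measurable M" by measurable
qed

text \<open>Through this invariance, almost sure properties and expectations known for the sample
  carry over to the sample with one coordinate replaced by its independent copy.\<close>

lemma (in product_prob_space) distr_resample:
  assumes I: "finite I" and j: "j \<in> I"
  shows "distr (Pi\<^sub>M I M \<Otimes>\<^sub>M Pi\<^sub>M I M) (Pi\<^sub>M I M) (\<lambda>(u, u'). u(j := u' j)) = Pi\<^sub>M I M"
    (is "distr (?Q \<Otimes>\<^sub>M ?Q) _ ?f = _")
proof (rule PiM_eqI[OF I])
  have f: "?f \<in> ?Q \<Otimes>\<^sub>M ?Q \<rightarrow>\<^sub>M ?Q"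
    unfolding split_beta' by (intro measurable_fun_upd[where J = I]) (use j in auto)
  fix X assume X: "\<And>i. i \<in> I \<Longrightarrow> X i \<in> sets (M i)"
  \<comment> \<open>The preimage of a box is again a box: the first family is free at
    \<open>j\<close>, the second is constrained at \<open>j\<close> only.\<close>
  let ?A = "\<lambda>i. if i = j then space (M i) else X i" and ?B = "\<lambda>i. if i = j then X i else space (M i)"
  have m: "?A i \<in> sets (M i)" "?B i \<in> sets (M i)" if "i \<in> I" for i using X[OF that] by auto
  have "emeasure (distr (?Q \<Otimes>\<^sub>M ?Q) ?Q ?f) (Pi\<^sub>E I X) = emeasure (?Q \<Otimes>\<^sub>M ?Q) (?f -` Pi\<^sub>E I X \<inter> space (?Q \<Otimes>\<^sub>M ?Q))"
    using X I by (intro emeasure_distr f) auto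
  also have "?f -` Pi\<^sub>E I X \<inter> space (?Q \<Otimes>\<^sub>M ?Q) = Pi\<^sub>E I ?A \<times> Pi\<^sub>E I ?B"
  proof -
    have sp: "x \<in> space (M i)" if "i \<in> I" "x \<in> X i" for i x using sets.sets_into_space[OF X[OF that(1)]] that by auto
    show ?thesis using j sp
      by (auto simp: space_pair_measure space_PiM PiE_iff extensional_def split: if_splits) (metis sp)+
  qed
  also have "emeasure (?Q \<Otimes>\<^sub>M ?Q) \<dots> = emeasure ?Q (Pi\<^sub>E I ?A) * emeasure ?Q (Pi\<^sub>E I ?B)"
    using m I by (intro P.emeasure_pair_measure_Times sets_PiM_I_finite) auto
  also have "\<dots> = (\<Prod>i\<in>I. emeasure (M i) (?A i)) * (\<Prod>i\<in>I. emeasure (M i) (?B i))"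
    using m I by (intro arg_cong2[where f = times] emeasure_PiM) auto
  also have "\<dots> = (\<Prod>i\<in>I. emeasure (M i) (X i))"
    unfolding prod.distrib[symmetric] by (intro prod.cong) (auto simp: M.emeasure_space_1)
  finally show "emeasure (distr (?Q \<Otimes>\<^sub>M ?Q) ?Q ?f) (Pi\<^sub>E I X) = (\<Prod>i\<in>I. emeasure (M i) (X i))" .
qed simp

lemma pred_lex:
  fixes f g :: "'w \<Rightarrow> real"
  assumes [measurable]: "f \<in> borel_measurable M" "g \<in> borel_measurable M"
  shows "Measurable.pred M (\<lambda>w. f w < g w \<or> f w = g w \<and> b)"
  by measurable

text \<open>At most three integers lie within 1 of \<open>k / 2\<close>, and each is attained with
  probability at most \<open>3.28 / sqrt k\<close>. The test point \<open>z\<close> is a constant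
  here, which makes the distances i.i.d.\<close>

lemma close_call_prob_le:
  fixes P :: "((real ^ 'd) \<times> bool) measure"
  assumes P: "prob_space P" and setsP: "sets P = sets (borel \<Otimes>\<^sub>M count_space UNIV)"
    and S: "finite S" and k: "k \<ge> 1" "k \<le> card S"
  shows "emeasure (Pi\<^sub>M S (\<lambda>_. P)) {w \<in> space (Pi\<^sub>M S (\<lambda>_. P)).
      close_call k (\<lambda>l. fst (w l)) (\<lambda>l. snd (w l)) S z} \<le> ennreal (9.84 / sqrt (real k))"
    (is "emeasure ?Q ?E \<le> _")
proof -
  note [measurable_cong] = setsP
  let ?d = "\<lambda>a :: (real ^ 'd) \<times> bool. dist z (fst a)"
  let ?T = "\<lambda>w. card {i \<in> firsts k (\<lambda>i j. ?d (w i) < ?d (w j) \<or> ?d (w i) = ?d (w j) \<and> i < j) S. snd (w i)}"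
  let ?C = "{(k - 1) div 2..(k + 2) div 2}"
  have cC: "card ?C \<le> 3" by auto
  have votes: "votes k (\<lambda>l. fst (w l)) (\<lambda>l. snd (w l)) S z = real (?T w)" for w
  proof -
    have "nearest k (\<lambda>l. fst (w l)) S z = firsts k (\<lambda>i j. ?d (w i) < ?d (w j) \<or> ?d (w i) = ?d (w j) \<and> i < j) S"
      unfolding nearest_eq_firsts by (rule firsts_cong) (simp add: closer_def)
    moreover have "finite (nearest k (\<lambda>l. fst (w l)) S z)" by (rule finite_subset[OF nearest_subset S])
    ultimately show ?thesis unfolding votes_def
      by (simp add: of_bool_def sum.If_cases Int_def)
  qed
  have dm: "?d \<in> borel_measurable P" "Measurable.pred P snd" by measurable
  have "?E \<subseteq> (\<Union>c\<in>?C. {w \<in> space ?Q. ?T w = c})"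
  proof
    fix w assume w: "w \<in> ?E"
    then have "\<bar>real (?T w) - real k / 2\<bar> \<le> 1" unfolding close_call_def votes by simp
    then have "real k \<le> 2 * real (?T w) + 2" "2 * real (?T w) \<le> real k + 2" by (auto simp: abs_le_iff field_simps)
    then have "k \<le> 2 * ?T w + 2" "2 * ?T w \<le> k + 2" by linarith+
    then have "?T w \<in> ?C" by auto
    then show "w \<in> (\<Union>c\<in>?C. {w \<in> space ?Q. ?T w = c})" using w by blast
  qed
  moreover have meas: "{w \<in> space ?Q. ?T w = c} \<in> sets ?Q" for c
  proof -
    have "?T \<in> ?Q \<rightarrow>\<^sub>M count_space UNIV" 
    proof (rule measurable_card_firsts[OF S])
      have co: "(\<lambda>w. w i) \<in> ?Q \<rightarrow>\<^sub>M P" if "i \<in> S" for i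
        by (rule measurable_component_singleton[OF that])
      have D: "(\<lambda>w. ?d (w i)) \<in> borel_measurable ?Q" if "i \<in> S" for i
        by (rule measurable_compose[OF co[OF that] dm(1)])
      fix i j assume ij: "i \<in> S" "j \<in> S"
      show "Measurable.pred ?Q (\<lambda>w. snd (w i))"
        by (rule measurable_compose[OF co[OF ij(1)] dm(2)])
      show "Measurable.pred ?Q (\<lambda>w. ?d (w i) < ?d (w j) \<or> ?d (w i) = ?d (w j) \<and> i < j)"
        by (intro pred_lex D ij)
    qed
    then show ?thesis by measurable
  qed
  ultimately have "emeasure ?Q ?E \<le> emeasure ?Q (\<Union>c\<in>?C. {w \<in> space ?Q. ?T w = c})"
    by (intro emeasure_mono sets.finite_UN) auto
  also have "\<dots> \<le> (\<Sum>c\<in>?C. emeasure ?Q {w \<in> space ?Q. ?T w = c})"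
    by (intro emeasure_subadditive_finite) (use meas in auto)
  also have "\<dots> \<le> (\<Sum>c\<in>?C. ennreal (3.28 / sqrt (real k)))"
  proof (rule sum_mono)
    fix c assume "c \<in> ?C"
    then have "k \<le> 2 * c + 2" "2 * c \<le> k + 2" by auto
    then show "emeasure ?Q {w \<in> space ?Q. ?T w = c} \<le> ennreal (3.28 / sqrt (real k))"
      by (intro firsts_count_index_le S k P dm)
  qed
  also have "\<dots> = ennreal (real (card ?C) * (3.28 / sqrt (real k)))"
    by (simp only: sum_constant ennreal_of_nat_eq_real_of_nat, subst ennreal_mult) auto
  also have "\<dots> \<le> ennreal (3 * (3.28 / sqrt (real k)))"
    using cC by (intro ennreal_leI mult_right_mono) auto
  finally show ?thesis by simp
qed

lemma stone_property_cong:
  assumes "\<And>i. i < m \<Longrightarrow> x i = x' i"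
  shows "stone_property \<gamma> m x = stone_property \<gamma> m x'"
proof -
  have "nearest k x ({..<m} - {i}) (x i) = nearest k x' ({..<m} - {i}) (x' i)" if "i < m" for k i
    unfolding assms[OF that] by (rule nearest_cong) (simp add: assms)
  then have "{i \<in> {..<m} - {j}. j \<in> nearest k x ({..<m} - {i}) (x i)} =
      {i \<in> {..<m} - {j}. j \<in> nearest k x' ({..<m} - {i}) (x' i)}" for j k
    by auto
  then show ?thesis unfolding stone_property_def by simp
qed

lemma (in prob_space) distr_fst_pair:
  assumes "prob_space N"
  shows "distr (M \<Otimes>\<^sub>M N) M fst = M"
proof -
  interpret N: prob_space N by fact
  show ?thesis
  proof (rule measure_eqI)
    fix A assume "A \<in> sets (distr (M \<Otimes>\<^sub>M N) M fst)"
    then have A: "A \<in> sets M" by simp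
    have "fst -` A \<inter> space (M \<Otimes>\<^sub>M N) = A \<times> space N"
      using sets.sets_into_space[OF A] by (auto simp: space_pair_measure)
    then show "emeasure (distr (M \<Otimes>\<^sub>M N) M fst) A = emeasure M A"
      using A by (simp add: emeasure_distr N.emeasure_pair_measure_Times N.emeasure_space_1)
  qed simp
qed

lemma (in prob_space) Lnorm_le_const:
  assumes f[measurable]: "f \<in> borel_measurable M" and b: "AE x in M. 0 \<le> f x \<and> f x \<le> V" and V: "0 \<le> V" and q: "q > 0"
  shows "Lnorm M q f \<le> V"
proof -
  have b': "AE x in M. \<bar>f x\<bar> powr q \<le> V powr q"
    using b by eventually_elim (use q in \<open>auto intro: powr_mono2\<close>)
  have "(\<integral>x. \<bar>f x\<bar> powr q \<partial>M) \<le> V powr q"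
    by (rule integral_le_const[OF _ b']) (rule integrable_const_bound[where B = "V powr q"], use b' in auto)
  moreover have "0 \<le> (\<integral>x. \<bar>f x\<bar> powr q \<partial>M)" by simp
  ultimately have "Lnorm M q f \<le> (V powr q) powr (1 / q)"
    unfolding Lnorm_def using q by (intro powr_mono2) auto
  also have "\<dots> = V" using q V by (simp add: powr_powr)
  finally show ?thesis .
qed

text \<open>
  The Efron-Stein hypothesis only covers variables with values in \<open>(real ^ 'd) \<times> bool\<close>, so a coin is
  encoded as the second component of such a pair.
\<close>

definition coin_law :: "((real ^ 'd) \<times> bool) measure" where
  "coin_law = distr (measure_pmf (bernoulli_pmf (1 / 2))) (borel \<Otimes>\<^sub>M count_space UNIV) (\<lambda>c. (0, c))"

lemma prob_space_coin_law: "prob_space coin_law"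
  unfolding coin_law_def by (intro measure_pmf.prob_space_distr) measurable

lemma sets_coin_law: "sets coin_law = sets (borel \<Otimes>\<^sub>M count_space UNIV)"
  by (simp add: coin_law_def)

text \<open>The bounds \<open>\<gamma> \<ge> 1\<close> and \<open>\<kappa> > 0\<close> are
  consequences of the defining properties of the two constants, established in
  \<open>stone_constant_ge_1\<close> and \<open>moment_constant_pos\<close>.\<close>

locale loo_model =
  fixes P :: "((real ^ 'd) \<times> bool) measure" and m k :: nat and \<gamma> \<kappa> :: real
  assumes prob_P: "prob_space P"
    and sets_P: "sets P = sets (borel \<Otimes>\<^sub>M count_space UNIV)"
    and k_pos: "k \<ge> 1" and k_less: "k < m" and \<gamma>_ge: "\<gamma> \<ge> 1" and \<kappa>_pos: "\<kappa> > 0"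
    and stone_AE: "AE x in Pi\<^sub>M {..<m} (\<lambda>_. distr P borel fst). stone_property \<gamma> m x"
    and moment: "moment_constant TYPE((real ^ 'd) \<times> bool) \<kappa>"
begin

definition coord :: "nat \<Rightarrow> ((real ^ 'd) \<times> bool) measure" where
  "coord i = (if i < m then P else coin_law)"

sublocale coord: product_prob_space coord "{..<2 * m}"
  by (rule product_prob_spaceI) (auto simp: coord_def prob_P prob_space_coin_law)

definition Q :: "(nat \<Rightarrow> (real ^ 'd) \<times> bool) measure" where
  "Q = Pi\<^sub>M {..<2 * m} coord"

sublocale Q: prob_space Q
  unfolding Q_def by (rule coord.P.prob_space_axioms)

sublocale QQ: pair_prob_space Q Q ..

abbreviation "F \<equiv> loo_error k m :: (nat \<Rightarrow> (real ^ 'd) \<times> bool) \<Rightarrow> real"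

lemma sets_coord: "sets (coord i) = sets (borel \<Otimes>\<^sub>M count_space UNIV)"
  by (simp add: coord_def sets_P sets_coin_law)

lemma m_pos: "m > 0" using k_less by simp

lemma measurable_coord:
  assumes "i < 2 * m"
  shows "(\<lambda>u. fst (u i)) \<in> borel_measurable Q" "Measurable.pred Q (\<lambda>u. snd (u i))"
proof -
  have 1: "(\<lambda>u. u i) \<in> Q \<rightarrow>\<^sub>M borel \<Otimes>\<^sub>M count_space UNIV"
    using measurable_component_singleton[of i "{..<2 * m}" coord] assms
    by (simp add: Q_def measurable_cong_sets[OF refl sets_coord])
  show "(\<lambda>u. fst (u i)) \<in> borel_measurable Q" "Measurable.pred Q (\<lambda>u. snd (u i))"
    using measurable_compose[OF 1 measurable_fst] measurable_compose[OF 1 measurable_snd] by simp_all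
qed

lemma pred_closer: 
  assumes "i < m" "j < m" "l < m"
  shows "Measurable.pred Q (\<lambda>u. closer (\<lambda>l. fst (u l)) (fst (u i)) j l)"
proof -
  have [measurable]: "(\<lambda>u. fst (u i)) \<in> borel_measurable Q" "(\<lambda>u. fst (u j)) \<in> borel_measurable Q"
    "(\<lambda>u. fst (u l)) \<in> borel_measurable Q" using assms by (auto intro!: measurable_coord)
  have "(\<lambda>u. dist (fst (u i)) (fst (u j))) \<in> borel_measurable Q" "(\<lambda>u. dist (fst (u i)) (fst (u l))) \<in> borel_measurable Q"
    by measurable
  then show ?thesis unfolding closer_def
    by (intro pred_lex)
qed

lemma measurable_loo_votes:
  "i < m \<Longrightarrow> (\<lambda>u. votes k (\<lambda>l. fst (u l)) (\<lambda>l. snd (u l)) ({..<m} - {i}) (fst (u i))) \<in> borel_measurable Q"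
  by (rule borel_measurable_votes) (auto intro: measurable_coord)

lemma pred_close_call:
  "i < m \<Longrightarrow> Measurable.pred Q (\<lambda>u. loo_close k m u i)"
  unfolding close_call_def using measurable_loo_votes[of i] by measurable

lemma measurable_loo_loss:
  assumes i: "i < m" shows "(\<lambda>u. loo_loss k m u i) \<in> borel_measurable Q"
proof -
  note [measurable] = measurable_loo_votes[OF i] measurable_coord(2)[of i] measurable_coord(2)[of "m + i"]
  have [measurable]: "i < 2 * m" "m + i < 2 * m" using i by auto
  show ?thesis unfolding loo_loss_def knn_classifier_votes[OF k_pos] by measurable
qed

lemma measurable_F[measurable]: "F \<in> borel_measurable Q"
  unfolding loo_error_def by (intro borel_measurable_divide borel_measurable_sum measurable_loo_loss borel_measurable_const) auto

lemma measurable_influence: 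
  assumes j: "j < m" shows "(\<lambda>u. influence k m u j) \<in> borel_measurable Q"
proof -
  have "Measurable.pred Q (\<lambda>u. influences k m u j i)" if i: "i \<in> {..<m} - {j}" for i
  proof -
    have [measurable]: "(\<lambda>u. card {l \<in> {..<m} - {i}. closer (\<lambda>l. fst (u l)) (fst (u i)) l j}) \<in> Q \<rightarrow>\<^sub>M count_space UNIV"
      using i j by (intro measurable_card_Collect pred_closer) auto
    have "influences k m u j i \<longleftrightarrow> card {l \<in> {..<m} - {i}. closer (\<lambda>l. fst (u l)) (fst (u i)) l j} < k \<and>
        loo_close k m u i" for u
      using i j by (auto simp: influences_def nearest_def)
    moreover have "Measurable.pred Q (\<lambda>u. card {l \<in> {..<m} - {i}. closer (\<lambda>l. fst (u l)) (fst (u i)) l j} < k \<and>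
        loo_close k m u i)"
    proof -
      have [measurable]: "Measurable.pred Q (\<lambda>u. loo_close k m u i)"
        using i by (intro pred_close_call) auto
      show ?thesis by measurable
    qed
    ultimately show ?thesis by (subst measurable_cong)
  qed
  then show ?thesis unfolding influence_def by (intro borel_measurable_sum) simp
qed

lemma measurable_resample: "j < 2 * m \<Longrightarrow> (\<lambda>(u, u'). u(j := u' j)) \<in> Q \<Otimes>\<^sub>M Q \<rightarrow>\<^sub>M Q"
  unfolding split_beta' Q_def by (intro measurable_fun_upd[where J = "{..<2 * m}"]) auto

lemma distr_resample_Q: "j < 2 * m \<Longrightarrow> distr (Q \<Otimes>\<^sub>M Q) Q (\<lambda>(u, u'). u(j := u' j)) = Q"
  unfolding Q_def by (rule coord.distr_resample) auto

text \<open>The assumption concerns the product of the laws of the points. It is pulled back in two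
  steps, along the projection of labelled points to points and along the restriction to the first
  \<open>m\<close> coordinates.\<close>

lemma AE_stone: "AE u in Q. stone_property \<gamma> m (\<lambda>l. fst (u l))"
proof -
  have PiM_eq: "Pi\<^sub>M {..<m} coord = Pi\<^sub>M {..<m} (\<lambda>_. P)"
    by (rule PiM_cong) (auto simp: coord_def)
  have 1: "distr Q (Pi\<^sub>M {..<m} (\<lambda>_. P)) (\<lambda>u. restrict u {..<m}) = Pi\<^sub>M {..<m} (\<lambda>_. P)"
    using coord.distr_PiM_restrict_finite[of "{..<m}"] by (simp add: Q_def PiM_eq)
  have fst: "fst \<in> P \<rightarrow>\<^sub>M borel" by (simp add: measurable_cong_sets[OF sets_P refl])
  interpret P: prob_space P by (rule prob_P)
  have borel: "prob_space (distr P borel fst)" by (rule P.prob_space_distr[OF fst])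
  have 2: "distr (Pi\<^sub>M {..<m} (\<lambda>_. P)) (Pi\<^sub>M {..<m} (\<lambda>_. distr P borel fst)) (compose {..<m} fst)
      = Pi\<^sub>M {..<m} (\<lambda>_. distr P borel fst)"
    using distr_PiM_finite_prob_space'[of "{..<m}" "\<lambda>_. P" "\<lambda>_. distr P borel fst" fst] prob_P borel fst
    by (simp add: distr_cong[of P P "distr P borel fst" borel fst fst])
  have c: "compose {..<m} fst \<in> Pi\<^sub>M {..<m} (\<lambda>_. P) \<rightarrow>\<^sub>M Pi\<^sub>M {..<m} (\<lambda>_. distr P borel fst)"
    unfolding compose_def
  proof (rule measurable_restrict)
    fix i assume "i \<in> {..<m}"
    from measurable_compose[OF measurable_component_singleton[OF this] fst]
    show "(\<lambda>x. fst (x i)) \<in> Pi\<^sub>M {..<m} (\<lambda>_. P) \<rightarrow>\<^sub>M distr P borel fst" by simp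
  qed
  have "AE x in Pi\<^sub>M {..<m} (\<lambda>_. P). stone_property \<gamma> m (compose {..<m} fst x)"
    using AE_distrD[OF c] stone_AE unfolding 2 by blast
  then have "AE x in distr Q (Pi\<^sub>M {..<m} (\<lambda>_. P)) (\<lambda>u. restrict u {..<m}). stone_property \<gamma> m (compose {..<m} fst x)"
    unfolding 1 .
  then have AE: "AE u in Q. stone_property \<gamma> m (compose {..<m} fst (restrict u {..<m}))"
  proof (rule AE_distrD[rotated])
    have "(\<lambda>u. restrict u {..<m}) \<in> Q \<rightarrow>\<^sub>M Pi\<^sub>M {..<m} coord"
      unfolding Q_def by (rule measurable_restrict_subset) auto
    then show "(\<lambda>u. restrict u {..<m}) \<in> Q \<rightarrow>\<^sub>M Pi\<^sub>M {..<m} (\<lambda>_. P)" by (simp only: PiM_eq)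
  qed
  have "stone_property \<gamma> m (compose {..<m} fst (restrict u {..<m})) = stone_property \<gamma> m (\<lambda>l. fst (u l))"
    for u :: "nat \<Rightarrow> (real ^ 'd) \<times> bool"
    by (rule stone_property_cong) (simp add: compose_def)
  with AE show ?thesis by simp
qed

end

section \<open>The Efron-Stein sum and the moments of a block\<close>

context loo_model
begin

definition sq :: "(nat \<Rightarrow> (real ^ 'd) \<times> bool) \<Rightarrow> (nat \<Rightarrow> (real ^ 'd) \<times> bool) \<Rightarrow> real" where
  "sq u u' = (\<Sum>i<2 * m. (F u - F (u(i := u' i)))\<^sup>2)"

definition mutual_influence :: "(nat \<Rightarrow> (real ^ 'd) \<times> bool) \<Rightarrow> (nat \<Rightarrow> (real ^ 'd) \<times> bool) \<Rightarrow> nat \<Rightarrow> real" where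
  "mutual_influence u u' j = influence k m u j + influence k m (u(j := u' j)) j"

lemma measurable_F_resample: "i < 2 * m \<Longrightarrow> (\<lambda>(u, u'). F (u(i := u' i))) \<in> borel_measurable (Q \<Otimes>\<^sub>M Q)"
  using measurable_compose[OF measurable_resample measurable_F] by (simp add: split_beta')

lemma measurable_sq: "(\<lambda>(u, u'). sq u u') \<in> borel_measurable (Q \<Otimes>\<^sub>M Q)"
  unfolding sq_def split_beta'
  using measurable_F_resample by (intro borel_measurable_sum borel_measurable_power borel_measurable_diff
      measurable_compose[OF measurable_fst measurable_F]) (auto simp: split_beta')

text \<open>Each of the finitely many resampled families has the law of the original one, so the
  exceptional sets remain null.\<close>

lemma AE_stone_pair:
  "AE (u, u') in Q \<Otimes>\<^sub>M Q. stone_property \<gamma> m (\<lambda>l. fst (u l)) \<and>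
     (\<forall>j<m. stone_property \<gamma> m (\<lambda>l. fst ((u(j := u' j)) l)))"
proof -
  have "AE x in Q \<Otimes>\<^sub>M Q. stone_property \<gamma> m (\<lambda>l. fst (fst x l))"
    by (rule AE_distrD[OF measurable_fst]) (simp only: Q.distr_fst_pair[OF Q.prob_space_axioms] AE_stone)
  moreover have "AE x in Q \<Otimes>\<^sub>M Q. \<forall>j\<in>{..<m}. stone_property \<gamma> m (\<lambda>l. fst (((\<lambda>(u, u'). u(j := u' j)) x) l))"
  proof (intro eventually_ball_finite ballI)
    fix j assume "j \<in> {..<m}"
    then have j: "j < 2 * m" by simp
    show "AE x in Q \<Otimes>\<^sub>M Q. stone_property \<gamma> m (\<lambda>l. fst (((\<lambda>(u, u'). u(j := u' j)) x) l))"
      by (rule AE_distrD[OF measurable_resample[OF j]]) (simp only: distr_resample_Q[OF j] AE_stone)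
  qed simp
  ultimately show ?thesis by eventually_elim (auto simp: split_beta')
qed

lemma mutual_influence_le:
  assumes "stone_property \<gamma> m (\<lambda>l. fst (u l))" "stone_property \<gamma> m (\<lambda>l. fst ((u(j := u' j)) l))" "j < m"
  shows "mutual_influence u u' j \<le> 2 * real k * \<gamma>"
  using influence_le[OF assms(1,3) k_pos] influence_le[OF assms(2,3) k_pos]
  unfolding mutual_influence_def by linarith

lemma mutual_influence_nonneg: "0 \<le> mutual_influence u u' j"
  by (simp add: mutual_influence_def influence_nonneg)

text \<open>The last summand collects the \<open>m\<close> coins, each of which contributes at most
  \<open>1 / m\<^sup>2\<close>.\<close>

lemma sq_le: "sq u u' \<le> (\<Sum>j<m. ((1 + mutual_influence u u' j) / real m)\<^sup>2) + 1 / real m"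
proof -
  have split: "{..<2 * m} = {..<m} \<union> (\<lambda>i. m + i) ` {..<m}"
  proof (intro equalityI subsetI)
    fix i assume "i \<in> {..<2 * m}"
    then show "i \<in> {..<m} \<union> (\<lambda>i. m + i) ` {..<m}"
      by (cases "i < m") (auto intro: image_eqI[of _ _ "i - m"])
  qed auto
  have "sq u u' = (\<Sum>j<m. (F u - F (u(j := u' j)))\<^sup>2) + (\<Sum>i<m. (F u - F (u(m + i := u' (m + i))))\<^sup>2)"
    unfolding sq_def split by (subst sum.union_disjoint) (auto simp: sum.reindex)
  also have "(\<Sum>j<m. (F u - F (u(j := u' j)))\<^sup>2) \<le> (\<Sum>j<m. ((1 + mutual_influence u u' j) / real m)\<^sup>2)"
  proof (rule sum_mono)
    fix j assume "j \<in> {..<m}"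
    then have "\<bar>F u - F (u(j := u' j))\<bar> \<le> (1 + mutual_influence u u' j) / real m"
      using loo_error_diff_data[OF k_pos k_less, of j u "u' j"] by (simp add: mutual_influence_def add.assoc)
    then show "(F u - F (u(j := u' j)))\<^sup>2 \<le> ((1 + mutual_influence u u' j) / real m)\<^sup>2"
      by (metis abs_ge_zero power2_abs power_mono)
  qed
  also have "(\<Sum>i<m. (F u - F (u(m + i := u' (m + i))))\<^sup>2) \<le> (\<Sum>i<m. (1 / real m)\<^sup>2)"
  proof (rule sum_mono)
    fix i assume "i \<in> {..<m}"
    then have "\<bar>F u - F (u(m + i := u' (m + i)))\<bar> \<le> 1 / real m"
      using loo_error_diff_coin[of i m k u "u' (m + i)"] by simp
    then show "(F u - F (u(m + i := u' (m + i))))\<^sup>2 \<le> (1 / real m)\<^sup>2"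
      by (metis abs_ge_zero power2_abs power_mono)
  qed
  also have "(\<Sum>i<m. (1 / real m)\<^sup>2) = 1 / real m" using m_pos by (simp add: power2_eq_square)
  finally show ?thesis by simp
qed

text \<open>An almost sure bound on the Efron-Stein sum: Stone's property caps the influence before
  and after resampling by \<open>k * \<gamma>\<close> each, and the final 1 comes from the
  coins.\<close>

definition V :: real where "V = ((1 + 2 * real k * \<gamma>)\<^sup>2 + 1) / real m"

lemma V_pos: "V > 0"
  unfolding V_def using m_pos by (intro divide_pos_pos add_nonneg_pos) auto

lemma V_le: "V \<le> 10 * (real k)\<^sup>2 * \<gamma>\<^sup>2 / real m"
proof -
  have "1 * 1 \<le> real k * \<gamma>" using k_pos \<gamma>_ge by (intro mult_mono) auto
  then have kg: "1 \<le> real k * \<gamma>" by simp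
  then have "1 + 2 * real k * \<gamma> \<le> 3 * (real k * \<gamma>)" by linarith
  then have "(1 + 2 * real k * \<gamma>)\<^sup>2 \<le> (3 * (real k * \<gamma>))\<^sup>2" using \<gamma>_ge by (intro power_mono) auto
  moreover have "1 \<le> (real k * \<gamma>)\<^sup>2" by (rule one_le_power[OF kg])
  ultimately have "(1 + 2 * real k * \<gamma>)\<^sup>2 + 1 \<le> 10 * (real k * \<gamma>)\<^sup>2" by (simp add: power_mult_distrib)
  then show ?thesis unfolding V_def by (intro divide_right_mono) (auto simp: power_mult_distrib)
qed

lemma AE_sq_le: "AE (u, u') in Q \<Otimes>\<^sub>M Q. sq u u' \<le> V"
  using AE_stone_pair
proof (eventually_elim, clarify)
  fix u u' :: "nat \<Rightarrow> (real ^ 'd) \<times> bool"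
  assume st: "stone_property \<gamma> m (\<lambda>l. fst (u l))" "\<forall>j<m. stone_property \<gamma> m (\<lambda>l. fst ((u(j := u' j)) l))"
  have "(\<Sum>j<m. ((1 + mutual_influence u u' j) / real m)\<^sup>2) \<le> (\<Sum>j<m. ((1 + 2 * real k * \<gamma>) / real m)\<^sup>2)"
  proof (rule sum_mono, rule power_mono)
    fix j assume "j \<in> {..<m}"
    then show "(1 + mutual_influence u u' j) / real m \<le> (1 + 2 * real k * \<gamma>) / real m"
      using mutual_influence_le[of u j u'] st by (intro divide_right_mono) auto
  qed (simp add: mutual_influence_nonneg)
  also have "\<dots> = (1 + 2 * real k * \<gamma>)\<^sup>2 / real m" using m_pos by (simp add: power_divide power2_eq_square)
  finally show "sq u u' \<le> V" using sq_le[of u u'] unfolding V_def by (simp add: add_divide_distrib)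
qed

definition W :: "(nat \<Rightarrow> (real ^ 'd) \<times> bool) \<Rightarrow> real" where "W u = F u - (\<integral>v. F v \<partial>Q)"

lemma integrable_F: "integrable Q F"
  by (rule Q.integrable_const_bound[where B = 1]) (auto simp: loo_error_bounds)

lemma W_measurable[measurable]: "W \<in> borel_measurable Q"
  unfolding W_def by measurable

lemma W_abs_le: "\<bar>W u\<bar> \<le> 1"
proof -
  have "0 \<le> (\<integral>v. F v \<partial>Q)" by (intro Bochner_Integration.integral_nonneg) (simp add: loo_error_bounds)
  moreover have "(\<integral>v. F v \<partial>Q) \<le> 1"
    by (rule Q.integral_le_const[OF integrable_F]) (simp add: loo_error_bounds)
  ultimately show ?thesis using loo_error_bounds[of k m u] unfolding W_def by linarith
qed

lemma W_centered: "(\<integral>u. W u \<partial>Q) = 0"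
  unfolding W_def using integrable_F by (subst Bochner_Integration.integral_diff) (auto simp: Q.prob_space)

lemma Lnorm_W_le:
  assumes "2 \<le> q"
  shows "Lnorm Q q W \<le> sqrt (2 * \<kappa> * q) * sqrt (Lnorm (Q \<Otimes>\<^sub>M Q) (q / 2) (\<lambda>(u, u'). sq u u'))"
proof -
  have "prob_space (coord i)" for i by (simp add: coord_def prob_P prob_space_coin_law)
  moreover have "F \<in> borel_measurable (Pi\<^sub>M {..<2 * m} coord)" using measurable_F by (simp add: Q_def)
  ultimately show ?thesis
    using moment assms unfolding moment_constant_def Let_def sq_def W_def[abs_def] Q_def by blast
qed

lemma W_powr: "j \<ge> 1 \<Longrightarrow> \<bar>W u\<bar> powr (2 * real j) = W u ^ (2 * j)"
proof -
  assume j: "j \<ge> 1"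
  have "\<bar>W u\<bar> powr (2 * real j) = \<bar>W u\<bar> powr real (2 * j)" by simp
  also have "\<dots> = \<bar>W u\<bar> ^ (2 * j)"
    using j by (cases "W u = 0") (simp_all add: powr_realpow del: of_nat_mult)
  also have "\<dots> = W u ^ (2 * j)" by (simp add: power_mult)
  finally show ?thesis .
qed

text \<open>The moment inequality with exponent \<open>2 * j\<close>, in which the norm of the
  Efron-Stein sum is at most its almost sure bound \<open>V\<close>; the factor under the root is
  \<open>2 * \<kappa> * (2 * j) * V\<close>.\<close>

lemma W_moment:
  assumes j: "j \<ge> 1"
  shows "(\<integral>u. W u ^ (2 * j) \<partial>Q) \<le> (4 * \<kappa> * V * real j) ^ j"
proof -
  let ?x = "\<integral>u. W u ^ (2 * j) \<partial>Q"
  have x: "?x \<ge> 0" by (intro Bochner_Integration.integral_nonneg) (simp add: power_mult)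
  have sq0: "0 \<le> sq u u'" for u u' by (simp add: sq_def sum_nonneg)
  have "Lnorm (Q \<Otimes>\<^sub>M Q) (2 * real j / 2) (\<lambda>(u, u'). sq u u') \<le> V"
    using j V_pos AE_sq_le by (intro QQ.Lnorm_le_const measurable_sq) (auto simp: split_beta' sq0)
  then have "sqrt (2 * \<kappa> * (2 * real j)) * sqrt (Lnorm (Q \<Otimes>\<^sub>M Q) (2 * real j / 2) (\<lambda>(u, u'). sq u u'))
    \<le> sqrt (2 * \<kappa> * (2 * real j)) * sqrt V"
    using \<kappa>_pos by (intro mult_left_mono) auto
  also have "\<dots> = sqrt (4 * \<kappa> * V * real j)" by (simp add: real_sqrt_mult[symmetric] mult_ac)
  finally have "Lnorm Q (2 * real j) W \<le> sqrt (4 * \<kappa> * V * real j)"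
    using Lnorm_W_le[of "2 * real j"] j by linarith
  then have "?x powr (1 / (2 * real j)) \<le> sqrt (4 * \<kappa> * V * real j)"
    unfolding Lnorm_def by (simp add: W_powr[OF j])
  then have "(?x powr (1 / (2 * real j))) powr (2 * real j) \<le> sqrt (4 * \<kappa> * V * real j) powr (2 * real j)"
    by (intro powr_mono2) auto
  moreover have "(?x powr (1 / (2 * real j))) powr (2 * real j) = ?x"
    using j x by (simp add: powr_powr)
  moreover have "sqrt (4 * \<kappa> * V * real j) powr (2 * real j) = (4 * \<kappa> * V * real j) ^ j"
  proof -
    have pos: "4 * \<kappa> * V * real j > 0" using \<kappa>_pos V_pos j by simp
    have "sqrt (4 * \<kappa> * V * real j) powr (2 * real j) = sqrt (4 * \<kappa> * V * real j) powr real (2 * j)" by simp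
    also have "\<dots> = sqrt (4 * \<kappa> * V * real j) ^ (2 * j)" using pos by (intro powr_realpow) simp
    also have "\<dots> = (4 * \<kappa> * V * real j) ^ j" using pos by (simp add: power_mult)
    finally show ?thesis .
  qed
  ultimately show ?thesis by simp
qed

sublocale W: moment_bounded Q W "4 * \<kappa> * V"
  by unfold_locales (use W_abs_le W_centered W_moment \<kappa>_pos V_pos in auto)

end

section \<open>The variance of a block\<close>

lemma close_call_cong:
  assumes "\<And>l. l \<in> S \<Longrightarrow> x l = x' l" "\<And>l. l \<in> S \<Longrightarrow> y l = y' l"
  shows "close_call k x y S z = close_call k x' y' S z"
proof -
  have n: "nearest k x S z = nearest k x' S z" by (rule nearest_cong) (rule assms)
  have "(\<Sum>i\<in>nearest k x' S z. of_bool (y i)) = (\<Sum>i\<in>nearest k x' S z. of_bool (y' i) :: real)"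
    by (rule sum.cong) (use nearest_subset[of k x' S z] assms in auto)
  then show ?thesis unfolding close_call_def votes_def n by simp
qed

context loo_model
begin

text \<open>The test point is integrated last. For each fixed value of it the remaining data are
  i.i.d., and \<open>close_call_prob_le\<close> is uniform in the position.\<close>

lemma close_call_loo_prob_le:
  assumes i: "i < m"
  shows "measure Q {u \<in> space Q. loo_close k m u i}
    \<le> 9.84 / sqrt (real k)" (is "measure Q ?E \<le> ?b")
proof -
  define S where "S = {..<m} - {i}"
  define I' where "I' = {..<2 * m} - {i}"
  have I': "finite I'" "i \<notin> I'" "{..<2 * m} = insert i I'" using i by (auto simp: I'_def)
  have S: "finite S" "S \<subseteq> I'" "k \<le> card S" using i k_less by (auto simp: S_def I'_def)
  interpret R: product_prob_space coord I' by unfold_locales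
  have PiM_S: "Pi\<^sub>M S coord = Pi\<^sub>M S (\<lambda>_. P)" by (rule PiM_cong) (auto simp: S_def coord_def)
  let ?cc = "\<lambda>w. close_call k (\<lambda>l. fst (w l)) (\<lambda>l. snd (w l)) S"
  have E: "?E \<in> sets Q" using pred_close_call[OF i] by measurable
  have inner: "(\<integral>\<^sup>+ w. indicator ?E (w(i := \<zeta>)) \<partial>Pi\<^sub>M I' coord) \<le> ennreal ?b" if \<zeta>: "\<zeta> \<in> space (coord i)" for \<zeta>
  proof -
    let ?E' = "{w \<in> space (Pi\<^sub>M S (\<lambda>_. P)). ?cc w (fst \<zeta>)}"
    have r: "(\<lambda>w. restrict w S) \<in> Pi\<^sub>M I' coord \<rightarrow>\<^sub>M Pi\<^sub>M S (\<lambda>_. P)"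
      unfolding PiM_S[symmetric] by (rule measurable_restrict_subset[OF S(2)])
    have co: "(\<lambda>w. w l) \<in> Pi\<^sub>M S (\<lambda>_. P) \<rightarrow>\<^sub>M borel \<Otimes>\<^sub>M count_space UNIV" if "l \<in> S" for l
      using measurable_component_singleton[OF that, of "\<lambda>_. P"] by (simp add: measurable_cong_sets[OF refl sets_P])
    have "(\<lambda>w. votes k (\<lambda>l. fst (w l)) (\<lambda>l. snd (w l)) S (fst \<zeta>)) \<in> borel_measurable (Pi\<^sub>M S (\<lambda>_. P))"
      using S measurable_compose[OF co measurable_fst] measurable_compose[OF co measurable_snd]
      by (intro borel_measurable_votes) auto
    then have E': "?E' \<in> sets (Pi\<^sub>M S (\<lambda>_. P))" unfolding close_call_def by measurable
    have "(\<integral>\<^sup>+ w. indicator ?E (w(i := \<zeta>)) \<partial>Pi\<^sub>M I' coord) \<le> (\<integral>\<^sup>+ w. indicator ?E' (restrict w S) \<partial>Pi\<^sub>M I' coord)"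
    proof (rule nn_integral_mono)
      fix w assume w: "w \<in> space (Pi\<^sub>M I' coord)"
      have "?cc (w(i := \<zeta>)) (fst \<zeta>) = ?cc (restrict w S) (fst \<zeta>)"
        by (rule close_call_cong) (auto simp: S_def)
      then show "indicator ?E (w(i := \<zeta>)) \<le> (indicator ?E' (restrict w S) :: ennreal)"
        using measurable_space[OF r w] by (auto simp: indicator_def S_def[symmetric])
    qed
    also have "\<dots> = (\<integral>\<^sup>+ w. indicator ?E' w \<partial>distr (Pi\<^sub>M I' coord) (Pi\<^sub>M S (\<lambda>_. P)) (\<lambda>w. restrict w S))"
      by (rule nn_integral_distr[OF r, symmetric]) (use E' in simp)
    also have "distr (Pi\<^sub>M I' coord) (Pi\<^sub>M S (\<lambda>_. P)) (\<lambda>w. restrict w S) = Pi\<^sub>M S (\<lambda>_. P)"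
      using R.distr_PiM_restrict_finite[OF S(1,2)] unfolding PiM_S .
    also have "(\<integral>\<^sup>+ w. indicator ?E' w \<partial>Pi\<^sub>M S (\<lambda>_. P)) \<le> ennreal ?b"
      using close_call_prob_le[OF prob_P sets_P S(1) k_pos S(3)] E' by simp
    finally show ?thesis .
  qed
  have "emeasure Q ?E = (\<integral>\<^sup>+ \<zeta>. \<integral>\<^sup>+ w. indicator ?E (w(i := \<zeta>)) \<partial>Pi\<^sub>M I' coord \<partial>coord i)"
    using E unfolding nn_integral_indicator[OF E, symmetric] unfolding Q_def I'(3)
    by (intro coord.product_nn_integral_insert_rev) (use I' in auto)
  also have "\<dots> \<le> (\<integral>\<^sup>+ \<zeta>. ennreal ?b \<partial>coord i)"
    by (rule nn_integral_mono) (rule inner)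
  also have "\<dots> = ennreal ?b" by (simp add: coord.M.emeasure_space_1)
  finally show ?thesis by (simp add: Q.emeasure_eq_measure)
qed

lemma influence_le_m: "influence k m u j \<le> real m"
proof -
  have "influence k m u j \<le> (\<Sum>i\<in>{..<m} - {j}. 1)" unfolding influence_def by (intro sum_mono) auto
  also have "\<dots> \<le> real m" by (simp add: card_Diff_subset_Int)
  finally show ?thesis .
qed

lemma integrable_influence: "j < m \<Longrightarrow> integrable Q (\<lambda>u. influence k m u j)"
  by (rule Q.integrable_const_bound[where B = "real m"])
    (auto simp: influence_le_m influence_nonneg measurable_influence)

text \<open>Double counting: summed over the observations instead of the test points, each test
  point contributes its at most \<open>k\<close> neighbours, and only when its vote is nearly
  tied.\<close>

lemma sum_influence_le:
  "(\<Sum>j<m. influence k m u j) \<le>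
    (\<Sum>i<m. real k * of_bool (loo_close k m u i))"
proof -
  let ?N = "\<lambda>i. nearest k (\<lambda>l. fst (u l)) ({..<m} - {i}) (fst (u i))"
  let ?c = "\<lambda>i. loo_close k m u i"
  have "(\<Sum>j<m. influence k m u j) \<le> (\<Sum>j<m. \<Sum>i<m. of_bool (influences k m u j i))"
    unfolding influence_def by (intro sum_mono sum_mono2) auto
  also have "\<dots> = (\<Sum>i<m. \<Sum>j<m. of_bool (influences k m u j i))" by (rule sum.swap)
  also have "\<dots> \<le> (\<Sum>i<m. real k * of_bool (?c i))"
  proof (rule sum_mono)
    fix i
    have "(\<Sum>j<m. of_bool (influences k m u j i)) = real (card {j \<in> {..<m}. influences k m u j i})"
      by (simp add: of_bool_def sum.If_cases Int_def)
    also have "\<dots> \<le> real k * of_bool (?c i)"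
    proof (cases "?c i")
      case True
      have "card {j \<in> {..<m}. influences k m u j i} \<le> card (?N i)"
        by (rule card_mono) (auto simp: influences_def intro: finite_subset[OF nearest_subset])
      also have "\<dots> \<le> k"
        unfolding nearest_eq_firsts by (subst strict_total_on.card_firsts[OF strict_total_on_closer]) auto
      finally show ?thesis using True by simp
    qed (simp add: influences_def)
    finally show "(\<Sum>j<m. of_bool (influences k m u j i)) \<le> real k * of_bool (?c i)" .
  qed
  finally show ?thesis .
qed

text \<open>The average influence of an observation is thus of order \<open>sqrt k\<close>, against
  the order \<open>k\<close> of the worst case.\<close>

lemma integral_sum_influence_le:
  "(\<Sum>j<m. \<integral>u. influence k m u j \<partial>Q) \<le> real m * (real k * (9.84 / sqrt (real k)))"
proof -
  let ?c = "\<lambda>u i. loo_close k m u i"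
  have int: "integrable Q (\<lambda>u. real k * of_bool (?c u i))" if "i < m" for i
    by (rule Q.integrable_const_bound[where B = "real k"]) (use pred_close_call[OF that] in auto)
  have "(\<Sum>j<m. \<integral>u. influence k m u j \<partial>Q) = (\<integral>u. (\<Sum>j<m. influence k m u j) \<partial>Q)"
    by (rule Bochner_Integration.integral_sum[symmetric]) (simp add: integrable_influence)
  also have "\<dots> \<le> (\<integral>u. (\<Sum>i<m. real k * of_bool (?c u i)) \<partial>Q)"
    by (intro integral_mono sum_influence_le Bochner_Integration.integrable_sum integrable_influence int) auto
  also have "\<dots> = (\<Sum>i<m. \<integral>u. real k * of_bool (?c u i) \<partial>Q)"
    by (rule Bochner_Integration.integral_sum) (rule int, simp)
  also have "\<dots> \<le> (\<Sum>i<m. real k * (9.84 / sqrt (real k)))"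
  proof (rule sum_mono)
    fix i assume "i \<in> {..<m}"
    then have i: "i < m" by simp
    have "(\<integral>u. real k * of_bool (?c u i) \<partial>Q) = real k * (\<integral>u. indicator {u \<in> space Q. ?c u i} u \<partial>Q)"
      by (subst Bochner_Integration.integral_mult_right_zero[symmetric], rule Bochner_Integration.integral_cong) (auto simp: indicator_def)
    also have "\<dots> = real k * measure Q {u \<in> space Q. ?c u i}"
    proof -
      have "{u \<in> space Q. ?c u i} \<inter> space Q = {u \<in> space Q. ?c u i}" by auto
      then show ?thesis by simp
    qed
    also have "\<dots> \<le> real k * (9.84 / sqrt (real k))"
      by (intro mult_left_mono close_call_loo_prob_le i) auto
    finally show "(\<integral>u. real k * of_bool (?c u i) \<partial>Q) \<le> real k * (9.84 / sqrt (real k))" .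
  qed
  finally show ?thesis by simp
qed

text \<open>The resampled family has the law of the original one, so both halves have the same
  mean.\<close>

lemma integral_mutual_influence:
  assumes j: "j < m"
  shows "integrable (Q \<Otimes>\<^sub>M Q) (\<lambda>x. mutual_influence (fst x) (snd x) j)"
    and "(\<integral>x. mutual_influence (fst x) (snd x) j \<partial>(Q \<Otimes>\<^sub>M Q)) = 2 * (\<integral>u. influence k m u j \<partial>Q)"
proof -
  have j2: "j < 2 * m" using j by simp
  note inf = measurable_influence[OF j]
  let ?r = "\<lambda>(u, u'). u(j := u' j)"
  have fst: "distr (Q \<Otimes>\<^sub>M Q) Q fst = Q" by (rule Q.distr_fst_pair[OF Q.prob_space_axioms])
  have 1: "integrable (Q \<Otimes>\<^sub>M Q) (\<lambda>x. influence k m (fst x) j)"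
    using integrable_influence[OF j] by (subst integrable_distr_eq[OF measurable_fst inf, symmetric]) (simp add: fst)
  have 2: "integrable (Q \<Otimes>\<^sub>M Q) (\<lambda>x. influence k m (?r x) j)"
    using integrable_influence[OF j]
    by (subst integrable_distr_eq[OF measurable_resample[OF j2] inf, symmetric]) (simp only: distr_resample_Q[OF j2])
  have 3: "(\<integral>x. influence k m (fst x) j \<partial>(Q \<Otimes>\<^sub>M Q)) = (\<integral>u. influence k m u j \<partial>Q)"
    by (subst integral_distr[OF measurable_fst inf, symmetric]) (simp add: fst)
  have 4: "(\<integral>x. influence k m (?r x) j \<partial>(Q \<Otimes>\<^sub>M Q)) = (\<integral>u. influence k m u j \<partial>Q)"
    by (subst integral_distr[OF measurable_resample[OF j2] inf, symmetric]) (simp only: distr_resample_Q[OF j2])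
  have eq: "mutual_influence (fst x) (snd x) j = influence k m (fst x) j + influence k m (?r x) j" for x
    by (simp add: mutual_influence_def split_beta')
  show "integrable (Q \<Otimes>\<^sub>M Q) (\<lambda>x. mutual_influence (fst x) (snd x) j)"
    unfolding eq using 1 2 by (rule Bochner_Integration.integrable_add)
  show "(\<integral>x. mutual_influence (fst x) (snd x) j \<partial>(Q \<Otimes>\<^sub>M Q)) = 2 * (\<integral>u. influence k m u j \<partial>Q)"
    unfolding eq Bochner_Integration.integral_add[OF 1 2] 3 4 by simp
qed

text \<open>With \<open>a\<close> the mutual influence,
  \<open>(1 + a)\<^sup>2 \<le> 2 + 2 * a\<^sup>2\<close>; in \<open>a\<^sup>2\<close> one factor is
  replaced by its almost sure bound \<open>2 * k * \<gamma>\<close>, and only the other is averaged.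
  This is where \<open>k\<^sup>2\<close> becomes \<open>k\<^sup>2 / sqrt k\<close>.\<close>

lemma integral_sq_le:
  "(\<integral>x. sq (fst x) (snd x) \<partial>(Q \<Otimes>\<^sub>M Q)) \<le> 82 * \<gamma>\<^sup>2 * (real k)\<^sup>2 / sqrt (real k) / real m"
proof -
  define D where "D x = 3 / real m + 4 * real k * \<gamma> / (real m)\<^sup>2 * (\<Sum>j<m. mutual_influence (fst x) (snd x) j)" for x
  have sq0: "0 \<le> sq u u'" for u u' by (simp add: sq_def sum_nonneg)
  have int_sq: "integrable (Q \<Otimes>\<^sub>M Q) (\<lambda>x. sq (fst x) (snd x))"
    using AE_sq_le measurable_sq
    by (intro QQ.integrable_const_bound[where B = V]) (auto simp: split_beta' sq0)
  have int_D: "integrable (Q \<Otimes>\<^sub>M Q) D"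
    unfolding D_def[abs_def] by (intro Bochner_Integration.integrable_add integrable_mult_right
      Bochner_Integration.integrable_sum integral_mutual_influence) auto
  have "AE x in Q \<Otimes>\<^sub>M Q. sq (fst x) (snd x) \<le> D x"
    using AE_stone_pair
  proof (eventually_elim, clarify)
    fix u u' :: "nat \<Rightarrow> (real ^ 'd) \<times> bool"
    assume st: "stone_property \<gamma> m (\<lambda>l. fst (u l))" "\<forall>j<m. stone_property \<gamma> m (\<lambda>l. fst ((u(j := u' j)) l))"
    have "(\<Sum>j<m. ((1 + mutual_influence u u' j) / real m)\<^sup>2)
      \<le> (\<Sum>j<m. 2 / (real m)\<^sup>2 + 4 * real k * \<gamma> / (real m)\<^sup>2 * mutual_influence u u' j)"
    proof (rule sum_mono)
      fix j assume "j \<in> {..<m}"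
      let ?a = "mutual_influence u u' j"
      have a: "0 \<le> ?a" "?a \<le> 2 * real k * \<gamma>"
        using mutual_influence_nonneg mutual_influence_le[of u j u'] st \<open>j \<in> {..<m}\<close> by auto
      have "0 \<le> (1 - ?a)\<^sup>2" by simp
      then have "(1 + ?a)\<^sup>2 \<le> 2 + 2 * (?a * ?a)" by (simp add: power2_eq_square algebra_simps)
      also have "?a * ?a \<le> 2 * real k * \<gamma> * ?a" using a by (intro mult_right_mono) auto
      finally have "(1 + ?a)\<^sup>2 \<le> 2 + 4 * real k * \<gamma> * ?a" by simp
      then have "(1 + ?a)\<^sup>2 / (real m)\<^sup>2 \<le> (2 + 4 * real k * \<gamma> * ?a) / (real m)\<^sup>2" by (rule divide_right_mono) simp
      then show "((1 + ?a) / real m)\<^sup>2 \<le> 2 / (real m)\<^sup>2 + 4 * real k * \<gamma> / (real m)\<^sup>2 * ?a"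
        unfolding power_divide by (simp add: add_divide_distrib)
    qed
    also have "\<dots> = 2 / real m + 4 * real k * \<gamma> / (real m)\<^sup>2 * (\<Sum>j<m. mutual_influence u u' j)"
      using m_pos by (simp add: sum.distrib sum_distrib_left power2_eq_square)
    finally have "sq u u' \<le> 2 / real m + 4 * real k * \<gamma> / (real m)\<^sup>2 * (\<Sum>j<m. mutual_influence u u' j) + 1 / real m"
      using sq_le[of u u'] by linarith
    moreover have "3 / real m = 2 / real m + 1 / real m" by (simp add: add_divide_distrib[symmetric])
    ultimately show "sq (fst (u, u')) (snd (u, u')) \<le> D (u, u')"
      unfolding D_def fst_conv snd_conv by linarith
  qed
  then have "(\<integral>x. sq (fst x) (snd x) \<partial>(Q \<Otimes>\<^sub>M Q)) \<le> (\<integral>x. D x \<partial>(Q \<Otimes>\<^sub>M Q))"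
    by (intro integral_mono_AE int_sq int_D)
  also have "\<dots> = 3 / real m + 4 * real k * \<gamma> / (real m)\<^sup>2 * (\<integral>x. (\<Sum>j<m. mutual_influence (fst x) (snd x) j) \<partial>(Q \<Otimes>\<^sub>M Q))"
    unfolding D_def by (subst Bochner_Integration.integral_add)
      (auto intro!: integrable_mult_right Bochner_Integration.integrable_sum integral_mutual_influence simp: QQ.prob_space)
  also have "(\<integral>x. (\<Sum>j<m. mutual_influence (fst x) (snd x) j) \<partial>(Q \<Otimes>\<^sub>M Q)) = 2 * (\<Sum>j<m. \<integral>u. influence k m u j \<partial>Q)"
    by (subst Bochner_Integration.integral_sum) (auto simp: integral_mutual_influence sum_distrib_left)
  also have "3 / real m + 4 * real k * \<gamma> / (real m)\<^sup>2 * (2 * (\<Sum>j<m. \<integral>u. influence k m u j \<partial>Q))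
    \<le> 3 / real m + 4 * real k * \<gamma> / (real m)\<^sup>2 * (2 * (real m * (real k * (9.84 / sqrt (real k)))))"
    using \<gamma>_ge by (intro add_left_mono mult_left_mono integral_sum_influence_le) auto
  \<comment> \<open>\<open>1968 / 25\<close> is \<open>4 * 2 * 9.84 = 78.72\<close>; adding the 3
    gives less than 82, once \<open>\<gamma>\<close> is enlarged to
    \<open>\<gamma>\<^sup>2\<close>.\<close>
  also have "\<dots> = (3 + 1968 / 25 * (\<gamma> * ((real k)\<^sup>2 / sqrt (real k)))) / real m"
    using m_pos by (simp add: power2_eq_square field_simps)
  also have "\<dots> \<le> (82 * (\<gamma>\<^sup>2 * ((real k)\<^sup>2 / sqrt (real k)))) / real m"
  proof (rule divide_right_mono)
    have sk: "1 \<le> (real k)\<^sup>2 / sqrt (real k)"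
    proof -
      have "sqrt (real k) \<le> real k" using k_pos by (intro real_le_lsqrt) (auto simp: power2_eq_square)
      also have "real k \<le> (real k)\<^sup>2" using k_pos by (simp add: power2_eq_square)
      finally show ?thesis using k_pos by (simp add: field_simps)
    qed
    have "\<gamma> \<le> \<gamma>\<^sup>2" using mult_left_mono[OF \<gamma>_ge, of \<gamma>] \<gamma>_ge by (simp add: power2_eq_square)
    note g2 = one_le_power[OF \<gamma>_ge, of 2] this
    have "1 * 1 \<le> \<gamma>\<^sup>2 * ((real k)\<^sup>2 / sqrt (real k))" using g2 sk by (intro mult_mono) auto
    moreover have "\<gamma> * ((real k)\<^sup>2 / sqrt (real k)) \<le> \<gamma>\<^sup>2 * ((real k)\<^sup>2 / sqrt (real k))"
      using g2 by (intro mult_right_mono) auto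
    ultimately show "3 + 1968 / 25 * (\<gamma> * ((real k)\<^sup>2 / sqrt (real k))) \<le> 82 * (\<gamma>\<^sup>2 * ((real k)\<^sup>2 / sqrt (real k)))"
      by linarith
  qed simp
  finally show ?thesis by (simp add: mult.assoc)
qed

text \<open>The common unit: \<open>4 * \<kappa> * V\<close> is at most
  \<open>40 * scale\<^sup>2\<close>, and the variance is of order
  \<open>scale\<^sup>2 / sqrt k\<close>.\<close>

definition scale :: real where "scale = real k * sqrt (\<kappa> * \<gamma>\<^sup>2 / real m)"

lemma scale_square: "scale\<^sup>2 = (real k)\<^sup>2 * \<kappa> * \<gamma>\<^sup>2 / real m"
  using \<kappa>_pos by (simp add: scale_def power_mult_distrib)

lemma scale_pos: "scale > 0"
  unfolding scale_def using k_pos \<kappa>_pos \<gamma>_ge m_pos by simp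

text \<open>The moment inequality with exponent 2, where the norm of order 1 of the Efron-Stein sum
  is its mean; \<open>328 = 4 * 82\<close>.\<close>

lemma W_variance: "(\<integral>u. (W u)\<^sup>2 \<partial>Q) \<le> 328 * scale\<^sup>2 / sqrt (real k)"
proof -
  have "Lnorm Q 2 W = sqrt (\<integral>u. (W u)\<^sup>2 \<partial>Q)"
    using W_powr[of 1] unfolding Lnorm_def by (simp add: powr_half_sqrt)
  moreover have "Lnorm (Q \<Otimes>\<^sub>M Q) (2 / 2) (\<lambda>(u, u'). sq u u') = (\<integral>x. sq (fst x) (snd x) \<partial>(Q \<Otimes>\<^sub>M Q))"
  proof -
    have "0 \<le> sq u u'" for u u' by (simp add: sq_def sum_nonneg)
    then show ?thesis unfolding Lnorm_def by (simp add: split_beta')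
  qed
  ultimately have "sqrt (\<integral>u. (W u)\<^sup>2 \<partial>Q) \<le> sqrt (4 * \<kappa>) * sqrt (\<integral>x. sq (fst x) (snd x) \<partial>(Q \<Otimes>\<^sub>M Q))"
    using Lnorm_W_le[of 2] by simp
  then have "sqrt (\<integral>u. (W u)\<^sup>2 \<partial>Q) \<le> sqrt (4 * \<kappa> * (\<integral>x. sq (fst x) (snd x) \<partial>(Q \<Otimes>\<^sub>M Q)))"
    by (simp only: real_sqrt_mult)
  then have "(\<integral>u. (W u)\<^sup>2 \<partial>Q) \<le> 4 * \<kappa> * (\<integral>x. sq (fst x) (snd x) \<partial>(Q \<Otimes>\<^sub>M Q))" by simp
  also have "\<dots> \<le> 4 * \<kappa> * (82 * \<gamma>\<^sup>2 * (real k)\<^sup>2 / sqrt (real k) / real m)"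
    using \<kappa>_pos by (intro mult_left_mono integral_sq_le) auto
  also have "\<dots> = 328 * scale\<^sup>2 / sqrt (real k)" by (simp add: scale_square mult_ac)
  finally show ?thesis .
qed

lemma \<kappa>V_le: "4 * \<kappa> * V \<le> 40 * scale\<^sup>2"
  using mult_left_mono[OF V_le, of "4 * \<kappa>"] \<kappa>_pos by (simp add: scale_square mult_ac)

lemma W_mgf: "(\<integral>u. exp (t * W u) \<partial>Q) \<le> exp (80 * exp 1 * scale\<^sup>2 * t\<^sup>2)"
proof -
  have "(\<integral>u. exp (t * W u) \<partial>Q) \<le> exp (2 * (4 * \<kappa> * V * exp 1) * t\<^sup>2)" by (rule W.subgaussian_mgf)
  also have "2 * (4 * \<kappa> * V * exp 1) * t\<^sup>2 \<le> 2 * (40 * scale\<^sup>2 * exp 1) * t\<^sup>2"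
    by (intro mult_right_mono mult_left_mono \<kappa>V_le) auto
  finally show ?thesis by (simp add: mult_ac)
qed

lemma W_bernstein:
  fixes \<theta> :: real
  defines "t \<equiv> \<theta> / scale"
  shows "(\<integral>u. exp (t * W u) \<partial>Q) \<le>
    exp (\<theta>\<^sup>2 / 2 * ((328 * exp (\<bar>\<theta>\<bar> * sqrt (330 * ln (real k))) + 1320 * exp (165 * \<theta>\<^sup>2)) / sqrt (real k)))"
proof -
  \<comment> \<open>660 makes
    \<open>3 * s * (40 * scale\<^sup>2 * exp 1) = 120 * exp 1 / 660\<close> at most 1/2. Then
    \<open>L\<close> is chosen with \<open>s * L\<^sup>2 = ln k / 2\<close>, so that the tail beyond
    \<open>L\<close> carries the same factor \<open>1 / sqrt k\<close> as the variance.\<close>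
  define s where "s = 1 / (660 * scale\<^sup>2)"
  define L where "L = scale * sqrt (330 * ln (real k))"
  have sc: "scale > 0" by (rule scale_pos)
  have lnk: "ln (real k) \<ge> 0" using k_pos by simp
  have s: "s > 0" "3 * s * (4 * \<kappa> * V * exp 1) \<le> 1 / 2"
  proof -
    show "s > 0" using sc by (simp add: s_def)
    then have "3 * s * (4 * \<kappa> * V * exp 1) \<le> 3 * s * (40 * scale\<^sup>2 * exp 1)"
      by (intro mult_right_mono mult_left_mono \<kappa>V_le) auto
    also have "\<dots> = 120 * exp 1 / 660" using sc by (simp add: s_def)
    also have "\<dots> \<le> 1 / 2" using e_less_272 by simp
    finally show "3 * s * (4 * \<kappa> * V * exp 1) \<le> 1 / 2" .
  qed
  have L: "L \<ge> 0" using sc lnk by (simp add: L_def)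
  have sL: "exp (- (s * L\<^sup>2)) = 1 / sqrt (real k)"
  proof -
    have "s * L\<^sup>2 = ln (real k) / 2" using sc lnk by (simp add: s_def L_def power_mult_distrib)
    moreover have "exp (ln (real k) / 2) = sqrt (real k)"
    proof -
      have "ln (real k) / 2 = ln (sqrt (real k))" by (rule ln_sqrt[symmetric]) (use k_pos in simp)
      then have "exp (ln (real k) / 2) = exp (ln (sqrt (real k)))" by (rule arg_cong)
      also have "\<dots> = sqrt (real k)" using k_pos by (intro exp_ln) simp
      finally show ?thesis .
    qed
    ultimately show ?thesis by (simp only: exp_minus inverse_eq_divide)
  qed
  have th: "t\<^sup>2 * scale\<^sup>2 = \<theta>\<^sup>2" "\<bar>t\<bar> * L = \<bar>\<theta>\<bar> * sqrt (330 * ln (real k))" "t\<^sup>2 / (4 * s) = 165 * \<theta>\<^sup>2"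
    using sc by (auto simp: t_def L_def s_def power_divide abs_div)
  have "(\<integral>u. exp (t * W u) \<partial>Q) \<le> 1 + t\<^sup>2 / 2 * (328 * scale\<^sup>2 / sqrt (real k) * exp (\<bar>t\<bar> * L) +
      2 / s * exp (t\<^sup>2 / (4 * s)) * exp (- (s * L\<^sup>2)))"
    by (rule W.bernstein_mgf[OF W_variance s L])
  also have "t\<^sup>2 / 2 * (328 * scale\<^sup>2 / sqrt (real k) * exp (\<bar>t\<bar> * L) +
      2 / s * exp (t\<^sup>2 / (4 * s)) * exp (- (s * L\<^sup>2))) =
    (t\<^sup>2 * scale\<^sup>2) / 2 * ((328 * exp (\<bar>t\<bar> * L) + 1320 * exp (t\<^sup>2 / (4 * s))) / sqrt (real k))"
    unfolding sL using sc by (simp add: s_def algebra_simps add_divide_distrib)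
  also have "1 + \<dots> \<le> exp \<dots>" by (rule exp_ge_add_one_self)
  finally show ?thesis unfolding th .
qed

end

section \<open>Splitting the leave-p-out estimator into independent blocks\<close>

definition case_vars :: "('i \<Rightarrow> 'w \<Rightarrow> 'a) \<Rightarrow> ('j \<Rightarrow> 'w \<Rightarrow> 'a) \<Rightarrow> 'i + 'j \<Rightarrow> 'w \<Rightarrow> 'a" where
  "case_vars Z C s = (case s of Inl i \<Rightarrow> Z i | Inr j \<Rightarrow> C j)"

text \<open>An intersection of events over the merged family splits into a data event and a coin
  event. The independence of the two generated sigma-algebras separates these, and independence
  within each family factors them further. The map \<open>g\<close> brings the coins to the value
  type of the data.\<close>

lemma (in prob_space) indep_vars_case_vars:
  assumes Z: "indep_vars (\<lambda>_. N) Z I" and C: "indep_vars (\<lambda>_. N') C J"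
    and ind: "indep_set
      (sets (vimage_algebra (space M) (\<lambda>\<omega>. \<lambda>i\<in>I. Z i \<omega>) (Pi\<^sub>M I (\<lambda>_. N))))
      (sets (vimage_algebra (space M) (\<lambda>\<omega>. \<lambda>j\<in>J. C j \<omega>) (Pi\<^sub>M J (\<lambda>_. N'))))"
    and g: "g \<in> N' \<rightarrow>\<^sub>M N"
  shows "indep_vars (\<lambda>_. N) (case_vars Z (\<lambda>j \<omega>. g (C j \<omega>))) (Inl ` I \<union> Inr ` J)"
  unfolding indep_vars_def2
proof (intro conjI ballI)
  have Zm: "Z i \<in> M \<rightarrow>\<^sub>M N" if "i \<in> I" for i using Z that by (auto simp: indep_vars_def)
  have Cm: "C j \<in> M \<rightarrow>\<^sub>M N'" if "j \<in> J" for j using C that by (auto simp: indep_vars_def)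
  have gCm: "(\<lambda>\<omega>. g (C j \<omega>)) \<in> M \<rightarrow>\<^sub>M N" if "j \<in> J" for j by (rule measurable_compose[OF Cm[OF that] g])
  let ?U = "case_vars Z (\<lambda>j \<omega>. g (C j \<omega>))"
  show U: "?U s \<in> M \<rightarrow>\<^sub>M N" if "s \<in> Inl ` I \<union> Inr ` J" for s
    using that Zm gCm by (auto simp: case_vars_def)
  show "indep_sets (\<lambda>s. {?U s -` A \<inter> space M |A. A \<in> sets N}) (Inl ` I \<union> Inr ` J)"
  proof (rule indep_setsI)
    show "{?U s -` A \<inter> space M |A. A \<in> sets N} \<subseteq> events" if "s \<in> Inl ` I \<union> Inr ` J" for s
      using U[OF that] by (auto intro: measurable_sets)
    fix A K assume K: "K \<noteq> {}" "K \<subseteq> Inl ` I \<union> Inr ` J" "finite K"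
      and A: "\<forall>s\<in>K. A s \<in> {?U s -` A \<inter> space M |A. A \<in> sets N}"
    then have "\<forall>s\<in>K. \<exists>a. a \<in> sets N \<and> A s = ?U s -` a \<inter> space M" by blast
    from bchoice[OF this] obtain a
      where a: "\<And>s. s \<in> K \<Longrightarrow> a s \<in> sets N" "\<And>s. s \<in> K \<Longrightarrow> A s = ?U s -` a s \<inter> space M"
      by blast
    define I0 where "I0 = Inl -` K"
    define J0 where "J0 = Inr -` K"
    have I0: "I0 \<subseteq> I" "finite I0" and J0: "J0 \<subseteq> J" "finite J0"
      using K by (auto simp: I0_def J0_def intro: finite_vimageI)
    have K_eq: "K = Inl ` I0 \<union> Inr ` J0"
    proof (intro equalityI subsetI)
      fix s assume "s \<in> K"
      then show "s \<in> Inl ` I0 \<union> Inr ` J0" by (cases s) (auto simp: I0_def J0_def)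
    qed (auto simp: I0_def J0_def)
    define EA where "EA = {\<omega> \<in> space M. \<forall>i\<in>I0. Z i \<omega> \<in> a (Inl i)}"
    define EB where "EB = {\<omega> \<in> space M. \<forall>j\<in>J0. C j \<omega> \<in> g -` a (Inr j) \<inter> space N'}"
    have pa: "prob EA = (\<Prod>i\<in>I0. prob (A (Inl i)))"
    proof (cases "I0 = {}")
      case True
      then show ?thesis by (simp add: EA_def prob_space)
    next
      case False
      have "EA = (\<Inter>i\<in>I0. Z i -` a (Inl i) \<inter> space M)" using False by (auto simp: EA_def)
      also have "prob \<dots> = (\<Prod>i\<in>I0. prob (Z i -` a (Inl i) \<inter> space M))"
        by (rule indep_varsD[OF Z False I0(2,1)]) (use a(1) in \<open>auto simp: I0_def\<close>)
      also have "\<dots> = (\<Prod>i\<in>I0. prob (A (Inl i)))"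
        by (intro prod.cong) (use a(2) in \<open>auto simp: I0_def case_vars_def\<close>)
      finally show ?thesis .
    qed
    have pb: "prob EB = (\<Prod>j\<in>J0. prob (A (Inr j)))"
    proof (cases "J0 = {}")
      case True
      then show ?thesis by (simp add: EB_def prob_space)
    next
      case False
      have "EB = (\<Inter>j\<in>J0. C j -` (g -` a (Inr j) \<inter> space N') \<inter> space M)" using False by (auto simp: EB_def)
      also have "prob \<dots> = (\<Prod>j\<in>J0. prob (C j -` (g -` a (Inr j) \<inter> space N') \<inter> space M))"
        by (rule indep_varsD[OF C False J0(2,1)]) (use a(1) g in \<open>auto simp: J0_def intro: measurable_sets\<close>)
      also have "\<dots> = (\<Prod>j\<in>J0. prob (A (Inr j)))"
      proof (rule prod.cong)
        fix j assume j: "j \<in> J0"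
        then have "C j \<omega> \<in> space N'" if "\<omega> \<in> space M" for \<omega>
          using measurable_space[OF Cm] J0 that by auto
        then have "C j -` (g -` a (Inr j) \<inter> space N') \<inter> space M = A (Inr j)"
          using a(2)[of "Inr j"] j by (auto simp: J0_def case_vars_def)
        then show "prob (C j -` (g -` a (Inr j) \<inter> space N') \<inter> space M) = prob (A (Inr j))" by simp
      qed simp
      finally show ?thesis .
    qed
    have EA: "EA \<in> sets (vimage_algebra (space M) (\<lambda>\<omega>. \<lambda>i\<in>I. Z i \<omega>) (Pi\<^sub>M I (\<lambda>_. N)))"
    proof -
      have "{f \<in> space (Pi\<^sub>M I (\<lambda>_. N)). \<forall>i\<in>I0. f i \<in> a (Inl i)} \<in> sets (Pi\<^sub>M I (\<lambda>_. N))"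
        using I0 a(1) by (intro sets.sets_Collect_finite_All sets_Collect_single) (auto simp: I0_def)
      from in_vimage_algebra[OF this, of "\<lambda>\<omega>. \<lambda>i\<in>I. Z i \<omega>" "space M"]
      have "(\<lambda>\<omega>. \<lambda>i\<in>I. Z i \<omega>) -` {f \<in> space (Pi\<^sub>M I (\<lambda>_. N)). \<forall>i\<in>I0. f i \<in> a (Inl i)} \<inter> space M
        \<in> sets (vimage_algebra (space M) (\<lambda>\<omega>. \<lambda>i\<in>I. Z i \<omega>) (Pi\<^sub>M I (\<lambda>_. N)))" .
      moreover have "(\<lambda>\<omega>. \<lambda>i\<in>I. Z i \<omega>) -` {f \<in> space (Pi\<^sub>M I (\<lambda>_. N)). \<forall>i\<in>I0. f i \<in> a (Inl i)} \<inter> space M = EA"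
        using I0 measurable_space[OF Zm] by (auto simp: EA_def space_PiM)
      ultimately show ?thesis by simp
    qed
    have EB: "EB \<in> sets (vimage_algebra (space M) (\<lambda>\<omega>. \<lambda>j\<in>J. C j \<omega>) (Pi\<^sub>M J (\<lambda>_. N')))"
    proof -
      have "{f \<in> space (Pi\<^sub>M J (\<lambda>_. N')). \<forall>j\<in>J0. f j \<in> g -` a (Inr j) \<inter> space N'} \<in> sets (Pi\<^sub>M J (\<lambda>_. N'))"
        using J0 a(1) g by (intro sets.sets_Collect_finite_All sets_Collect_single) (auto simp: J0_def intro: measurable_sets)
      from in_vimage_algebra[OF this, of "\<lambda>\<omega>. \<lambda>j\<in>J. C j \<omega>" "space M"]
      have "(\<lambda>\<omega>. \<lambda>j\<in>J. C j \<omega>) -` {f \<in> space (Pi\<^sub>M J (\<lambda>_. N')). \<forall>j\<in>J0. f j \<in> g -` a (Inr j) \<inter> space N'} \<inter> space M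
        \<in> sets (vimage_algebra (space M) (\<lambda>\<omega>. \<lambda>j\<in>J. C j \<omega>) (Pi\<^sub>M J (\<lambda>_. N')))" .
      moreover have "(\<lambda>\<omega>. \<lambda>j\<in>J. C j \<omega>) -` {f \<in> space (Pi\<^sub>M J (\<lambda>_. N')). \<forall>j\<in>J0. f j \<in> g -` a (Inr j) \<inter> space N'} \<inter> space M = EB"
        using J0 measurable_space[OF Cm] by (auto simp: EB_def space_PiM)
      ultimately show ?thesis by simp
    qed
    have "(\<Inter>s\<in>K. A s) = EA \<inter> EB"
    proof (intro equalityI subsetI)
      fix \<omega> assume \<omega>: "\<omega> \<in> (\<Inter>s\<in>K. A s)"
      then have sp: "\<omega> \<in> space M" using K(1) a(2) by blast
      have "Z i \<omega> \<in> a (Inl i)" if "i \<in> I0" for i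
        using \<omega> a(2)[of "Inl i"] that by (auto simp: I0_def case_vars_def)
      moreover have "C j \<omega> \<in> g -` a (Inr j) \<inter> space N'" if "j \<in> J0" for j
        using \<omega> a(2)[of "Inr j"] that measurable_space[OF Cm sp] J0 by (auto simp: J0_def case_vars_def)
      ultimately show "\<omega> \<in> EA \<inter> EB" using sp by (simp add: EA_def EB_def)
    next
      fix \<omega> assume \<omega>: "\<omega> \<in> EA \<inter> EB"
      show "\<omega> \<in> (\<Inter>s\<in>K. A s)"
      proof
        fix s assume s: "s \<in> K"
        then show "\<omega> \<in> A s" using \<omega> a(2)[OF s]
          by (cases s) (auto simp: EA_def EB_def I0_def J0_def case_vars_def)
      qed
    qed
    then have "prob (\<Inter>s\<in>K. A s) = prob EA * prob EB"
      using indep_setD[OF ind EA EB] by simp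
    also have "\<dots> = (\<Prod>s\<in>K. prob (A s))"
      unfolding pa pb K_eq using I0 J0 by (subst prod.union_disjoint) (auto simp: prod.reindex)
    finally show "prob (\<Inter>s\<in>K. A s) = (\<Prod>s\<in>K. prob (A s))" .
  qed
qed

section \<open>From subsets to permutations, and from training sets to blocks\<close>

lemma ex_permutation_image:
  assumes A: "finite A" "v \<subseteq> A" "v' \<subseteq> A" "card v = card v'"
  obtains \<tau> where "\<tau> permutes A" "\<tau> ` v = v'"
proof -
  have fin: "finite v" "finite v'" using A finite_subset by auto
  obtain f where f: "bij_betw f v v'" using finite_same_card_bij[OF fin A(4)] by blast
  have "card (A - v) = card (A - v')" using A fin by (simp add: card_Diff_subset)
  then obtain g where g: "bij_betw g (A - v) (A - v')"
    using finite_same_card_bij[of "A - v" "A - v'"] A by auto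
  define \<tau> where "\<tau> x = (if x \<in> v then f x else if x \<in> A then g x else x)" for x
  have 1: "bij_betw \<tau> v v'" using f by (rule bij_betw_cong[THEN iffD1, rotated]) (simp add: \<tau>_def)
  have 2: "bij_betw \<tau> (A - v) (A - v')" using g by (rule bij_betw_cong[THEN iffD1, rotated]) (simp add: \<tau>_def)
  have "bij_betw \<tau> (v \<union> (A - v)) (v' \<union> (A - v'))" by (rule bij_betw_combine[OF 1 2]) auto
  moreover have "v \<union> (A - v) = A" "v' \<union> (A - v') = A" using A by auto
  ultimately have "bij_betw \<tau> A A" by simp
  then have "\<tau> permutes A" by (rule bij_imp_permutes) (use A in \<open>auto simp: \<tau>_def\<close>)
  moreover have "\<tau> ` v = v'" using 1 by (rule bij_betw_imp_surj_on)
  ultimately show ?thesis by (rule that)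
qed

lemma sum_permutations_image:
  fixes g :: "'a set \<Rightarrow> real"
  assumes A: "finite A" and B: "B \<subseteq> A" "card B = m"
  defines "\<V> \<equiv> {v. v \<subseteq> A \<and> card v = m}" and "\<S> \<equiv> {\<sigma>. \<sigma> permutes A}"
  shows "(\<Sum>\<sigma>\<in>\<S>. g (\<sigma> ` B)) / real (card \<S>) = (\<Sum>v\<in>\<V>. g v) / real (card \<V>)"
proof -
  have fV: "finite \<V>" using A by (simp add: \<V>_def)
  have fP: "finite \<S>" unfolding \<S>_def by (rule finite_permutations[OF A])
  have PV: "\<sigma> ` B \<in> \<V>" if "\<sigma> \<in> \<S>" for \<sigma>
  proof -
    have \<sigma>: "\<sigma> permutes A" using that by (simp add: \<S>_def)
    have "\<sigma> ` B \<subseteq> A" using image_mono[OF B(1), of \<sigma>] permutes_image[OF \<sigma>] by simp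
    moreover have "card (\<sigma> ` B) = m" using card_image[OF permutes_inj_on[OF \<sigma>]] B by simp
    ultimately show ?thesis by (simp add: \<V>_def)
  qed
  define c where "c v = card {\<sigma> \<in> \<S>. \<sigma> ` B = v}" for v
  have c_le: "c v \<le> c v'" if v: "v \<in> \<V>" "v' \<in> \<V>" for v v'
  proof -
    obtain \<tau> where \<tau>: "\<tau> permutes A" "\<tau> ` v = v'"
      using ex_permutation_image[OF A, of v v'] v by (auto simp: \<V>_def)
    show ?thesis unfolding c_def
    proof (rule card_inj_on_le[of "\<lambda>\<sigma>. \<tau> \<circ> \<sigma>"])
      show "inj_on (\<lambda>\<sigma>. \<tau> \<circ> \<sigma>) {\<sigma> \<in> \<S>. \<sigma> ` B = v}"
        by (rule inj_on_subset[OF fun.inj_map[OF permutes_inj[OF \<tau>(1)]]]) simp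
      show "(\<lambda>\<sigma>. \<tau> \<circ> \<sigma>) ` {\<sigma> \<in> \<S>. \<sigma> ` B = v} \<subseteq> {\<sigma> \<in> \<S>. \<sigma> ` B = v'}"
      proof (rule image_subsetI)
        fix \<sigma> assume "\<sigma> \<in> {\<sigma> \<in> \<S>. \<sigma> ` B = v}"
        then show "\<tau> \<circ> \<sigma> \<in> {\<sigma> \<in> \<S>. \<sigma> ` B = v'}"
          using \<tau> permutes_compose[OF _ \<tau>(1), of \<sigma>] image_comp[of \<tau> \<sigma> B] by (simp add: \<S>_def)
      qed
      show "finite {\<sigma> \<in> \<S>. \<sigma> ` B = v'}" using fP by simp
    qed
  qed
  have BV: "B \<in> \<V>" using B by (simp add: \<V>_def)
  have c_eq: "c v = c B" if "v \<in> \<V>" for v using c_le[OF that BV] c_le[OF BV that] by simp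
  have sum_eq: "(\<Sum>\<sigma>\<in>\<S>. f (\<sigma> ` B)) = real (c B) * (\<Sum>v\<in>\<V>. f v)" for f :: "'a set \<Rightarrow> real"
  proof -
    have "(\<Sum>\<sigma>\<in>\<S>. f (\<sigma> ` B)) = (\<Sum>v\<in>\<V>. \<Sum>\<sigma>\<in>{\<sigma> \<in> \<S>. \<sigma> ` B = v}. f (\<sigma> ` B))"
      by (rule sum.group[symmetric]) (use fP fV PV in auto)
    also have "\<dots> = (\<Sum>v\<in>\<V>. real (c v) * f v)"
      by (intro sum.cong) (auto simp: c_def)
    also have "\<dots> = real (c B) * (\<Sum>v\<in>\<V>. f v)"
      by (simp add: c_eq sum_distrib_left)
    finally show ?thesis .
  qed
  have "id \<in> \<S>" by (simp add: \<S>_def permutes_id)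
  then have "card \<S> > 0" using fP by (auto simp: card_gt_0_iff)
  moreover have "real (card \<S>) = real (c B) * real (card \<V>)" using sum_eq[of "\<lambda>_. 1"] by simp
  ultimately show ?thesis unfolding sum_eq[of g] by auto
qed

text \<open>Strict monotonicity, beyond injectivity, is needed because distance ties are broken by
  the smaller index.\<close>

lemma knn_classifier_reindex:
  assumes f: "strict_mono_on T f" and x: "\<And>i. i \<in> T \<Longrightarrow> x' i = x (f i)" and y: "\<And>i. i \<in> T \<Longrightarrow> y' i = y (f i)"
  shows "knn_classifier k x y (f ` T) b z = knn_classifier k x' y' T b z"
proof -
  have inj: "inj_on f T" by (rule strict_mono_on_imp_inj_on[OF f])
  have less: "f i < f j \<longleftrightarrow> i < j" if "i \<in> T" "j \<in> T" for i j
    using strict_mono_onD[OF f, of i j] strict_mono_onD[OF f, of j i] that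
    by (cases i j rule: linorder_cases) auto
  have "nearest k x (f ` T) z = f ` firsts k (\<lambda>i j. closer x z (f i) (f j)) T"
    unfolding nearest_eq_firsts by (rule firsts_reindex[OF inj])
  also have "firsts k (\<lambda>i j. closer x z (f i) (f j)) T = nearest k x' T z"
    unfolding nearest_eq_firsts by (rule firsts_cong) (simp add: closer_def x less)
  finally have n: "nearest k x (f ` T) z = f ` nearest k x' T z" .
  have "(\<Sum>i\<in>f ` nearest k x' T z. of_bool (y i)) = (\<Sum>i\<in>nearest k x' T z. of_bool (y' i) :: real)"
    using inj_on_subset[OF inj nearest_subset, of k x' z] nearest_subset[of k x' T z]
    by (subst sum.reindex) (auto intro!: sum.cong simp: y)
  then show ?thesis unfolding knn_classifier_def n by simp
qed

text \<open>A training set together with a test index is the same as an \<open>m\<close>-set with a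
  marked element, for \<open>m = n - p + 1\<close>.\<close>

lemma bij_betw_insert_test:
  assumes p: "1 \<le> p" "p \<le> n"
  defines "\<V> \<equiv> {v. v \<subseteq> {1..n} \<and> card v = n - p + 1}"
  shows "bij_betw (\<lambda>(v, i). (v - {i}, i)) (SIGMA v:\<V>. v) (lpo_coins n p)"
proof (rule bij_betw_byWitness[where f' = "\<lambda>(e, i). (insert i e, i)"])
  have fin: "finite v" if "v \<subseteq> {1..n}" for v using that finite_subset by blast
  show "(\<lambda>(v, i). (v - {i}, i)) ` (SIGMA v:\<V>. v) \<subseteq> lpo_coins n p"
    using fin by (auto simp: \<V>_def lpo_coins_def training_sets_def)
  show "(\<lambda>(e, i). (insert i e, i)) ` lpo_coins n p \<subseteq> (SIGMA v:\<V>. v)"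
    using fin by (auto simp: \<V>_def lpo_coins_def training_sets_def)
qed (auto simp: lpo_coins_def insert_absorb)

lemma lpo_eq_average:
  assumes p: "1 \<le> p" "p \<le> n"
  defines "\<V> \<equiv> {v. v \<subseteq> {1..n} \<and> card v = n - p + 1}"
  shows "lpo n p k x y b = (\<Sum>v\<in>\<V>.
    (\<Sum>i\<in>v. of_bool (knn_classifier k x y (v - {i}) (b (v - {i}, i)) (x i) \<noteq> y i)) / real (n - p + 1)) / real (card \<V>)"
proof -
  define L :: "nat set \<times> nat \<Rightarrow> real" where
    "L = (\<lambda>(e, i). of_bool (knn_classifier k x y e (b (e, i)) (x i) \<noteq> y i))"
  have fT: "finite (training_sets n p)" unfolding training_sets_def by simp
  have fV: "finite \<V>" unfolding \<V>_def by simp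
  have fv: "finite v" if "v \<in> \<V>" for v using that finite_subset by (auto simp: \<V>_def)
  have swap: "(\<Sum>c\<in>lpo_coins n p. f c) = (\<Sum>v\<in>\<V>. \<Sum>i\<in>v. f (v - {i}, i))" for f :: "_ \<Rightarrow> real"
  proof -
    have "(\<Sum>c\<in>lpo_coins n p. f c) = (\<Sum>c\<in>(SIGMA v:\<V>. v). f (case c of (v, i) \<Rightarrow> (v - {i}, i)))"
      using bij_betw_insert_test[OF p] unfolding \<V>_def[symmetric] by (rule sum.reindex_bij_betw[symmetric])
    also have "\<dots> = (\<Sum>v\<in>\<V>. \<Sum>i\<in>v. f (v - {i}, i))"
      using fV fv by (subst sum.Sigma) (auto simp: split_beta')
    finally show ?thesis .
  qed
  have split: "(\<Sum>c\<in>lpo_coins n p. f c) = (\<Sum>e\<in>training_sets n p. \<Sum>i\<in>{1..n} - e. f (e, i))" for f :: "_ \<Rightarrow> real"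
    unfolding lpo_coins_def using fT by (subst sum.Sigma) (auto simp: split_beta')
  have "card (training_sets n p) = n choose p"
    using p binomial_symmetric[of p n] by (simp add: training_sets_def n_subsets)
  moreover have "card ({1..n} - e) = p" if "e \<in> training_sets n p" for e
    using that p finite_subset[of e "{1..n}"] by (auto simp: training_sets_def card_Diff_subset)
  ultimately have "(\<Sum>c\<in>lpo_coins n p. 1 :: real) = real (n choose p) * real p"
    unfolding split by simp
  moreover have "(\<Sum>c\<in>lpo_coins n p. 1 :: real) = real (card \<V>) * real (n - p + 1)"
    unfolding swap by (simp add: \<V>_def)
  \<comment> \<open>Both sides count the pairs of a training set and a test index, so the two
    normalisations agree.\<close>
  ultimately have norm: "real (n choose p) * real p = real (card \<V>) * real (n - p + 1)" by simp
  have "lpo n p k x y b = (\<Sum>c\<in>lpo_coins n p. L c) / (real (n choose p) * real p)"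
    unfolding lpo_def split L_def by (simp add: sum_distrib_left[symmetric] sum_divide_distrib[symmetric] divide_inverse mult_ac)
  also have "\<dots> = (\<Sum>v\<in>\<V>. (\<Sum>i\<in>v. L (v - {i}, i)) / real (n - p + 1)) / real (card \<V>)"
    unfolding swap norm sum_divide_distrib[symmetric] by simp
  finally show ?thesis by (simp add: L_def)
qed

lemma exp_average_le:
  fixes y :: "'i \<Rightarrow> real"
  assumes "finite S" "S \<noteq> {}"
  shows "exp (t * ((\<Sum>i\<in>S. y i) / real (card S))) \<le> (\<Sum>i\<in>S. exp (t * y i)) / real (card S)"
proof -
  have c: "real (card S) > 0" using assms by (simp add: card_gt_0_iff)
  have "exp (\<Sum>i\<in>S. (1 / real (card S)) *\<^sub>R (t * y i)) \<le> (\<Sum>i\<in>S. (1 / real (card S)) * exp (t * y i))"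
    by (rule convex_on_sum[OF assms exp_convex]) (use c assms in auto)
  moreover have "(\<Sum>i\<in>S. (1 / real (card S)) *\<^sub>R (t * y i)) = t * ((\<Sum>i\<in>S. y i) / real (card S))"
    by (simp add: sum_distrib_left[symmetric] sum_divide_distrib[symmetric])
  moreover have "(\<Sum>i\<in>S. (1 / real (card S)) * exp (t * y i)) = (\<Sum>i\<in>S. exp (t * y i)) / real (card S)"
    by (simp add: sum_divide_distrib)
  ultimately show ?thesis by simp
qed

lemma (in prob_space) chernoff_bound:
  assumes Z[measurable]: "Z \<in> borel_measurable M" and int: "integrable M (\<lambda>x. exp (l * Z x))" and l: "l \<ge> 0"
  shows "prob {x \<in> space M. Z x > t} \<le> exp (- (l * t)) * expectation (\<lambda>x. exp (l * Z x))"
proof -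
  have "prob {x \<in> space M. Z x > t} = expectation (indicator {x \<in> space M. Z x > t})"
  proof -
    have "{x \<in> space M. Z x > t} \<inter> space M = {x \<in> space M. Z x > t}" by auto
    then show ?thesis by simp
  qed
  also have "\<dots> \<le> expectation (\<lambda>x. exp (- (l * t)) * exp (l * Z x))"
  proof (rule integral_mono)
    show "integrable M (indicator {x \<in> space M. Z x > t} :: _ \<Rightarrow> real)"
      by (rule integrable_const_bound[where B = 1]) (auto simp: indicator_def)
    show "integrable M (\<lambda>x. exp (- (l * t)) * exp (l * Z x))" using int by simp
    fix x assume "x \<in> space M"
    show "indicator {x \<in> space M. Z x > t} x \<le> exp (- (l * t)) * exp (l * Z x)"
    proof (cases "Z x > t")
      case True
      then have "0 \<le> l * (Z x - t)" using l by simp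
      then have "1 \<le> exp (- (l * t) + l * Z x)" by (simp add: algebra_simps)
      then show ?thesis by (simp only: exp_add) (auto simp: indicator_def intro: order_trans)
    qed (simp add: indicator_def)
  qed
  finally show ?thesis by simp
qed

section \<open>Blocks of the sample and their laws\<close>

locale lpo_model = prob_space M + loo_model P m k \<gamma> \<kappa>
  for M :: "'w measure" and P :: "((real ^ 'd) \<times> bool) measure" and n p m k :: nat and \<gamma> \<kappa> :: real +
  fixes X :: "nat \<Rightarrow> 'w \<Rightarrow> real ^ 'd" and Y :: "nat \<Rightarrow> 'w \<Rightarrow> bool" and B :: "nat set \<times> nat \<Rightarrow> 'w \<Rightarrow> bool"
  assumes p_pos: "p \<ge> 1" and p_le: "p \<le> n" and m_eq: "m = n - p + 1"
    and data_indep: "indep_vars (\<lambda>_. borel \<Otimes>\<^sub>M count_space UNIV) (\<lambda>i \<omega>. (X i \<omega>, Y i \<omega>)) {1..n}"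
    and data_law: "\<And>i. i \<in> {1..n} \<Longrightarrow> distr M (borel \<Otimes>\<^sub>M count_space UNIV) (\<lambda>\<omega>. (X i \<omega>, Y i \<omega>)) = P"
    and coins_indep: "indep_vars (\<lambda>_. count_space UNIV) B (lpo_coins n p)"
    and coins_law: "\<And>c. c \<in> lpo_coins n p \<Longrightarrow>
           distr M (count_space UNIV) (B c) = measure_pmf (bernoulli_pmf (1 / 2))"
    and data_coins_indep: "indep_set
           (sets (vimage_algebra (space M) (\<lambda>\<omega>. \<lambda>i\<in>{1..n}. (X i \<omega>, Y i \<omega>))
              (Pi\<^sub>M {1..n} (\<lambda>_. borel \<Otimes>\<^sub>M count_space UNIV))))
           (sets (vimage_algebra (space M) (\<lambda>\<omega>. \<lambda>c\<in>lpo_coins n p. B c \<omega>)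
              (Pi\<^sub>M (lpo_coins n p) (\<lambda>_. count_space UNIV))))"
begin

abbreviation "N \<equiv> borel \<Otimes>\<^sub>M count_space UNIV :: ((real ^ 'd) \<times> bool) measure"

text \<open>Data and coins form a single independent family with a common value type; a coin
  receives the dummy point 0, in agreement with \<open>coin_law\<close>.\<close>

definition U :: "nat + (nat set \<times> nat) \<Rightarrow> 'w \<Rightarrow> (real ^ 'd) \<times> bool" where
  "U = case_vars (\<lambda>i \<omega>. (X i \<omega>, Y i \<omega>)) (\<lambda>c \<omega>. (0, B c \<omega>))"

definition K :: "(nat + (nat set \<times> nat)) set" where
  "K = Inl ` {1..n} \<union> Inr ` lpo_coins n p"

definition \<nu> :: "nat + (nat set \<times> nat) \<Rightarrow> ((real ^ 'd) \<times> bool) measure" where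
  "\<nu> s = (case s of Inl i \<Rightarrow> P | Inr c \<Rightarrow> coin_law)"

lemma prob_\<nu>: "prob_space (\<nu> s)"
  by (cases s) (simp_all add: \<nu>_def prob_P prob_space_coin_law)

lemma U_indep: "indep_vars (\<lambda>_. N) U K"
  unfolding U_def K_def
  by (rule indep_vars_case_vars[OF data_indep coins_indep data_coins_indep, where g = "\<lambda>c. (0, c)"]) measurable

lemma U_measurable: "s \<in> K \<Longrightarrow> U s \<in> M \<rightarrow>\<^sub>M N"
  using U_indep by (auto simp: indep_vars_def)

lemma U_law: assumes "s \<in> K" shows "distr M N (U s) = \<nu> s"
proof (cases s)
  case (Inl i)
  then show ?thesis using assms data_law[of i] by (auto simp: U_def case_vars_def \<nu>_def K_def)
next
  case (Inr c)
  then have c: "c \<in> lpo_coins n p" using assms by (auto simp: K_def)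
  have Bm: "B c \<in> M \<rightarrow>\<^sub>M count_space UNIV" using coins_indep c by (auto simp: indep_vars_def)
  have "coin_law = distr (distr M (count_space UNIV) (B c)) N (\<lambda>c. (0, c))"
    unfolding coins_law[OF c] coin_law_def ..
  also have "\<dots> = distr M N (\<lambda>\<omega>. (0, B c \<omega>))"
    using Bm by (subst distr_distr) (auto simp: comp_def space_pair_measure)
  finally show ?thesis using Inr by (simp add: U_def case_vars_def \<nu>_def)
qed

lemma K_nonempty: "K \<noteq> {}" using p_pos p_le by (auto simp: K_def)

lemma U_joint: "distr M (Pi\<^sub>M K (\<lambda>_. N)) (\<lambda>\<omega>. \<lambda>s\<in>K. U s \<omega>) = Pi\<^sub>M K \<nu>"
proof -
  have "distr M (Pi\<^sub>M K (\<lambda>_. N)) (\<lambda>\<omega>. \<lambda>s\<in>K. U s \<omega>) = Pi\<^sub>M K (\<lambda>s. distr M N (U s))"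
    using indep_vars_iff_distr_eq_PiM'[OF K_nonempty, where M' = "\<lambda>_. N" and X = U] U_measurable U_indep by blast
  also have "\<dots> = Pi\<^sub>M K \<nu>" by (rule PiM_cong) (simp_all add: U_law)
  finally show ?thesis .
qed

definition \<V> :: "nat set set" where "\<V> = {v. v \<subseteq> {1..n} \<and> card v = m}"

lemma \<V>_finite: "finite \<V>" by (simp add: \<V>_def)

lemma \<V>D: assumes "v \<in> \<V>" shows "v \<subseteq> {1..n}" "card v = m" "finite v"
  using assms finite_subset by (auto simp: \<V>_def)

lemma enum_bij: "v \<in> \<V> \<Longrightarrow> bij_betw (enumerate v) {..<m} v"
  using finite_bij_enumerate[of v] \<V>D[of v] by simp

lemma enum_mono: "v \<in> \<V> \<Longrightarrow> strict_mono_on {..<m} (enumerate v)"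
  unfolding strict_mono_on_def using \<V>D[of v] by (auto intro: finite_enumerate_mono)

lemma enum_in: "v \<in> \<V> \<Longrightarrow> i < m \<Longrightarrow> enumerate v i \<in> v"
  using bij_betwE[OF enum_bij] by blast

text \<open>This embeds the coordinates of the abstract block into the indices of the data and
  coins. Enumerating \<open>v\<close> increasingly preserves the tie-breaking order, and coordinate
  \<open>m + l\<close> is sent to the coin reserved for testing the \<open>l\<close>-th point
  against the rest of \<open>v\<close>.\<close>

definition \<iota> :: "nat set \<Rightarrow> nat \<Rightarrow> nat + (nat set \<times> nat)" where
  "\<iota> v i = (if i < m then Inl (enumerate v i)
    else Inr (v - {enumerate v (i - m)}, enumerate v (i - m)))"

lemma \<iota>_inj: assumes v: "v \<in> \<V>" shows "inj_on (\<iota> v) {..<2 * m}"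
proof (rule inj_onI)
  have inj: "inj_on (enumerate v) {..<m}" using enum_bij[OF v] by (rule bij_betw_imp_inj_on)
  fix i j assume ij: "i \<in> {..<2 * m}" "j \<in> {..<2 * m}" "\<iota> v i = \<iota> v j"
  show "i = j"
  proof (cases "i < m")
    case True
    then have "j < m" "enumerate v i = enumerate v j" using ij(3) by (auto simp: \<iota>_def split: if_splits)
    then show ?thesis using inj_onD[OF inj] True by auto
  next
    case False
    then have j: "\<not> j < m" "enumerate v (i - m) = enumerate v (j - m)" using ij(3) by (auto simp: \<iota>_def split: if_splits)
    then have "i - m = j - m" using inj_onD[OF inj, of "i - m" "j - m"] False ij(1,2) by auto
    then show ?thesis using False j(1) by linarith
  qed
qed

lemma \<iota>_in: assumes v: "v \<in> \<V>" "i < 2 * m" shows "\<iota> v i \<in> K"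
proof (cases "i < m")
  case True
  then show ?thesis using enum_in[OF v(1) True] \<V>D[OF v(1)] by (auto simp: \<iota>_def K_def)
next
  case False
  let ?j = "enumerate v (i - m)"
  have "?j \<in> v" using v False by (intro enum_in) auto
  then have "(v - {?j}, ?j) \<in> lpo_coins n p"
    using \<V>D[OF v(1)] by (auto simp: lpo_coins_def training_sets_def m_eq)
  then show ?thesis using False by (simp add: \<iota>_def K_def)
qed

definition sample :: "nat set \<Rightarrow> 'w \<Rightarrow> nat \<Rightarrow> (real ^ 'd) \<times> bool" where
  "sample v \<omega> = (\<lambda>i\<in>{..<2 * m}. U (\<iota> v i) \<omega>)"

lemma sets_Q: "sets Q = sets (Pi\<^sub>M {..<2 * m} (\<lambda>_. N))"
  unfolding Q_def by (rule sets_PiM_cong) (simp_all add: sets_coord)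

lemma sample_measurable: "v \<in> \<V> \<Longrightarrow> sample v \<in> M \<rightarrow>\<^sub>M Q"
  unfolding measurable_cong_sets[OF refl sets_Q] sample_def
  by (intro measurable_restrict U_measurable \<iota>_in) auto

text \<open>Reindexing a product measure along the injection \<open>\<iota> v\<close> gives the
  product of the selected factors, which are those of \<open>Q\<close> in the right order.\<close>

lemma sample_law: assumes v: "v \<in> \<V>" shows "distr M Q (sample v) = Q"
proof -
  let ?t = "\<lambda>f. \<lambda>i\<in>{..<2 * m}. f (\<iota> v i)"
  have Q_eq: "Pi\<^sub>M {..<2 * m} (\<lambda>i. \<nu> (\<iota> v i)) = Q"
    unfolding Q_def by (rule PiM_cong) (auto simp: \<nu>_def \<iota>_def coord_def)
  have Jm: "(\<lambda>\<omega>. \<lambda>s\<in>K. U s \<omega>) \<in> M \<rightarrow>\<^sub>M Pi\<^sub>M K (\<lambda>_. N)" by (intro measurable_restrict U_measurable)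
  have tm: "?t \<in> Pi\<^sub>M K (\<lambda>_. N) \<rightarrow>\<^sub>M Q"
    unfolding measurable_cong_sets[OF refl sets_Q] using \<iota>_in[OF v]
    by (intro measurable_restrict measurable_component_singleton) auto
  have "Q = distr (Pi\<^sub>M K \<nu>) Q ?t"
    using distr_PiM_reindex[of K \<nu> "\<iota> v" "{..<2 * m}"] prob_\<nu> \<iota>_inj[OF v] \<iota>_in[OF v]
    unfolding Q_eq by auto
  also have "\<dots> = distr M Q (?t \<circ> (\<lambda>\<omega>. \<lambda>s\<in>K. U s \<omega>))"
    unfolding U_joint[symmetric] by (rule distr_distr[OF tm Jm])
  also have "?t \<circ> (\<lambda>\<omega>. \<lambda>s\<in>K. U s \<omega>) = sample v"
    using \<iota>_in[OF v] by (auto simp: sample_def fun_eq_iff)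
  finally show ?thesis ..
qed

definition h :: "nat set \<Rightarrow> 'w \<Rightarrow> real" where "h v \<omega> = F (sample v \<omega>)"

definition R :: "'w \<Rightarrow> real" where "R \<omega> = lpo n p k (\<lambda>i. X i \<omega>) (\<lambda>i. Y i \<omega>) (\<lambda>c. B c \<omega>)"

lemma h_eq:
  assumes v: "v \<in> \<V>"
  shows "(\<Sum>i\<in>v. of_bool (knn_classifier k (\<lambda>i. X i \<omega>) (\<lambda>i. Y i \<omega>) (v - {i}) (B (v - {i}, i) \<omega>) (X i \<omega>) \<noteq> Y i \<omega>)) / real m
    = h v \<omega>"
proof -
  let ?e = "enumerate v"
  have s1: "sample v \<omega> l = (X (?e l) \<omega>, Y (?e l) \<omega>)" if "l < m" for l
    using that by (simp add: sample_def \<iota>_def U_def case_vars_def)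
  have s2: "sample v \<omega> (m + l) = (0, B (v - {?e l}, ?e l) \<omega>)" if "l < m" for l
    using that by (simp add: sample_def \<iota>_def U_def case_vars_def)
  have "loo_loss k m (sample v \<omega>) l =
      of_bool (knn_classifier k (\<lambda>i. X i \<omega>) (\<lambda>i. Y i \<omega>) (v - {?e l}) (B (v - {?e l}, ?e l) \<omega>) (X (?e l) \<omega>) \<noteq> Y (?e l) \<omega>)"
    if l: "l < m" for l
  proof -
    have img: "v - {?e l} = ?e ` ({..<m} - {l})"
      using bij_betw_imp_surj_on[OF enum_bij[OF v]] inj_on_image_set_diff[OF bij_betw_imp_inj_on[OF enum_bij[OF v]], of "{..<m}" "{l}"] l
      by simp
    have "knn_classifier k (\<lambda>i. X i \<omega>) (\<lambda>i. Y i \<omega>) (?e ` ({..<m} - {l})) b z =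
        knn_classifier k (\<lambda>i. fst (sample v \<omega> i)) (\<lambda>i. snd (sample v \<omega> i)) ({..<m} - {l}) b z" for b z
      by (rule knn_classifier_reindex) (use enum_mono[OF v] in \<open>auto simp: s1 strict_mono_on_def\<close>)
    then show ?thesis unfolding loo_loss_def s2[OF l] using s1[OF l] img by simp
  qed
  then show ?thesis unfolding h_def loo_error_def
    by (simp add: sum.reindex_bij_betw[OF enum_bij[OF v], symmetric])
qed

lemma R_eq: "R \<omega> = (\<Sum>v\<in>\<V>. h v \<omega>) / real (card \<V>)"
  unfolding R_def lpo_eq_average[OF p_pos p_le] m_eq[symmetric] \<V>_def[symmetric]
  by (intro arg_cong2[where f = "(/)"] sum.cong h_eq refl)

lemma h_measurable: "v \<in> \<V> \<Longrightarrow> h v \<in> borel_measurable M"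
  unfolding h_def using measurable_compose[OF sample_measurable measurable_F] .

lemma h_bounds: "0 \<le> h v \<omega>" "h v \<omega> \<le> 1" by (simp_all add: h_def loo_error_bounds)

lemma integrable_h: "v \<in> \<V> \<Longrightarrow> integrable M (h v)"
  by (rule integrable_const_bound[where B = 1]) (auto simp: h_bounds h_measurable)

lemma expectation_h: "v \<in> \<V> \<Longrightarrow> expectation (h v) = (\<integral>u. F u \<partial>Q)"
  unfolding h_def using integral_distr[OF sample_measurable measurable_F] sample_law by metis

definition \<mu> :: real where "\<mu> = (\<integral>u. F u \<partial>Q)"

lemma expectation_R: "expectation R = \<mu>"
proof -
  have "m \<le> card {1..n}" using p_pos p_le by (simp add: m_eq)
  then obtain v where "v \<subseteq> {1..n}" "card v = m" by (rule obtain_subset_with_card_n)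
  then have "\<V> \<noteq> {}" by (auto simp: \<V>_def)
  then have "card \<V> > 0" using \<V>_finite by (simp add: card_gt_0_iff)
  moreover have "expectation R = (\<Sum>v\<in>\<V>. expectation (h v)) / real (card \<V>)"
    unfolding R_eq[abs_def] by (simp add: Bochner_Integration.integral_sum integrable_h)
  ultimately show ?thesis by (simp add: expectation_h \<mu>_def)
qed

lemma measurable_R[measurable]: "R \<in> borel_measurable M"
  unfolding R_eq[abs_def] by (intro borel_measurable_divide borel_measurable_sum h_measurable) auto

lemma h_mgf: "v \<in> \<V> \<Longrightarrow> expectation (\<lambda>\<omega>. exp (t * (h v \<omega> - \<mu>))) = (\<integral>u. exp (t * W u) \<partial>Q)"
proof -
  assume v: "v \<in> \<V>"
  have "(\<integral>u. exp (t * W u) \<partial>Q) = (\<integral>u. exp (t * W u) \<partial>distr M Q (sample v))" unfolding sample_law[OF v] ..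
  also have "\<dots> = expectation (\<lambda>\<omega>. exp (t * W (sample v \<omega>)))"
    by (rule integral_distr[OF sample_measurable[OF v]]) measurable
  finally show ?thesis by (simp add: W_def h_def \<mu>_def)
qed

lemma h_exp_bounded: "exp (t * (h v \<omega> - \<mu>)) \<le> exp \<bar>t\<bar>"
proof -
  have "\<bar>h v \<omega> - \<mu>\<bar> \<le> 1" unfolding h_def \<mu>_def W_def[symmetric] by (rule W_abs_le)
  then have "\<bar>t\<bar> * \<bar>h v \<omega> - \<mu>\<bar> \<le> \<bar>t\<bar> * 1" by (intro mult_left_mono) auto
  then show ?thesis using abs_ge_self[of "t * (h v \<omega> - \<mu>)"] by (simp add: abs_mult)
qed

lemma integrable_exp_h: "v \<in> \<V> \<Longrightarrow> integrable M (\<lambda>\<omega>. exp (t * (h v \<omega> - \<mu>)))"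
proof (rule integrable_const_bound[where B = "exp \<bar>t\<bar>"])
  assume v: "v \<in> \<V>"
  note [measurable] = h_measurable[OF v]
  show "(\<lambda>\<omega>. exp (t * (h v \<omega> - \<mu>))) \<in> borel_measurable M" by measurable
qed (use h_exp_bounded[of t v] in \<open>simp del: exp_le_cancel_iff\<close>)

text \<open>Disjoint blocks involve disjoint sets of data and of coins, so the values computed from
  them are functions of disjoint groups of an independent family.\<close>

lemma indep_h:
  assumes I: "finite I" and v: "\<And>b. b \<in> I \<Longrightarrow> v b \<in> \<V>" and disj: "disjoint_family_on v I"
  shows "indep_vars (\<lambda>_. borel) (\<lambda>b \<omega>. exp (t * (h (v b) \<omega> - \<mu>))) I"
proof -
  define L where "L b = \<iota> (v b) ` {..<2 * m}" for b
  have LK: "L b \<subseteq> K" if "b \<in> I" for b using \<iota>_in[OF v[OF that]] by (auto simp: L_def)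
  \<comment> \<open>Every index used by block \<open>b\<close> names a point of \<open>v b\<close>:
    the observation itself or the point tested with the coin. Hence disjoint blocks cannot share a
    coin.\<close>
  have part: "(case s of Inl i \<Rightarrow> i | Inr c \<Rightarrow> snd c) \<in> v b" if "s \<in> L b" "b \<in> I" for s b
    using that enum_in[OF v[OF that(2)]] by (auto simp: L_def \<iota>_def split: if_splits)
  have "disjoint_family_on L I"
    unfolding disjoint_family_on_def
  proof (intro ballI impI)
    fix b b' assume b: "b \<in> I" "b' \<in> I" "b \<noteq> b'"
    then have "v b \<inter> v b' = {}" using disj by (auto simp: disjoint_family_on_def)
    then show "L b \<inter> L b' = {}" using part b by blast
  qed
  then have ind: "indep_vars (\<lambda>b. Pi\<^sub>M (L b) (\<lambda>_. N)) (\<lambda>b \<omega>. restrict (\<lambda>s. U s \<omega>) (L b)) I"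
    by (intro indep_vars_restrict[OF U_indep]) (use LK in auto)
  define g where "g b f = exp (t * (F (\<lambda>i\<in>{..<2 * m}. f (\<iota> (v b) i)) - \<mu>))" for b f
  have gm: "g b \<in> borel_measurable (Pi\<^sub>M (L b) (\<lambda>_. N))" if "b \<in> I" for b
  proof -
    have tm: "(\<lambda>f. \<lambda>i\<in>{..<2 * m}. f (\<iota> (v b) i)) \<in> Pi\<^sub>M (L b) (\<lambda>_. N) \<rightarrow>\<^sub>M Q"
      unfolding measurable_cong_sets[OF refl sets_Q]
      by (intro measurable_restrict measurable_component_singleton) (auto simp: L_def)
    note [measurable] = measurable_compose[OF tm measurable_F]
    show ?thesis unfolding g_def by measurable
  qed
  have "indep_vars (\<lambda>_. borel) (\<lambda>b \<omega>. g b (restrict (\<lambda>s. U s \<omega>) (L b))) I"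
    by (rule indep_vars_compose2[OF ind gm])
  moreover have "g b (restrict (\<lambda>s. U s \<omega>) (L b)) = exp (t * (h (v b) \<omega> - \<mu>))" for b \<omega>
  proof -
    have "(\<lambda>i\<in>{..<2 * m}. restrict (\<lambda>s. U s \<omega>) (L b) (\<iota> (v b) i)) = sample (v b) \<omega>"
      by (auto simp: sample_def L_def fun_eq_iff)
    then show ?thesis by (simp add: g_def h_def)
  qed
  ultimately show ?thesis by simp
qed

text \<open>Hoeffding's device for U-statistics: overlapping blocks are dependent, but for each
  fixed permutation the \<open>r\<close> consecutive blocks of its image are not, and convexity of
  the exponential allows averaging over permutations after taking expectations.\<close>

lemma R_mgf:
  assumes r: "r \<ge> 1" "r * m \<le> n" and \<beta>: "(\<integral>u. exp (t / real r * W u) \<partial>Q) \<le> \<beta>"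
  shows "integrable M (\<lambda>\<omega>. exp (t * (R \<omega> - \<mu>)))" "expectation (\<lambda>\<omega>. exp (t * (R \<omega> - \<mu>))) \<le> \<beta> ^ r"
proof -
  define S where "S = {\<sigma>. \<sigma> permutes {1..n}}"
  have "id \<in> S" by (simp add: S_def permutes_id)
  then have S: "finite S" "S \<noteq> {}" by (auto simp only: S_def intro: finite_permutations)
  have cS: "real (card S) > 0" using S by (simp add: card_gt_0_iff)
  define D where "D b = {b * m + 1..b * m + m}" for b :: nat
  have D: "D b \<subseteq> {1..n}" "card (D b) = m" if "b < r" for b
  proof -
    have "(b + 1) * m \<le> r * m" using that by (intro mult_le_mono1) simp
    then have "b * m + m \<le> n" using r(2) by (simp add: algebra_simps)
    then show "D b \<subseteq> {1..n}" by (auto simp: D_def)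
    show "card (D b) = m" by (simp add: D_def)
  qed
  have D_disj: "D b \<inter> D b' = {}" if "b < b'" for b b'
  proof -
    have "(b + 1) * m \<le> b' * m" using that by (intro mult_le_mono1) simp
    then have "b * m + m \<le> b' * m" by (simp add: algebra_simps)
    then show ?thesis by (auto simp: D_def)
  qed
  have \<sigma>V: "\<sigma> ` D b \<in> \<V>" if "\<sigma> \<in> S" "b < r" for \<sigma> b
  proof -
    have \<sigma>: "\<sigma> permutes {1..n}" using that by (simp add: S_def)
    show ?thesis using image_mono[OF D(1)[OF that(2)], of \<sigma>] permutes_image[OF \<sigma>]
      card_image[OF permutes_inj_on[OF \<sigma>]] D(2)[OF that(2)] by (simp add: \<V>_def)
  qed
  define Av where "Av \<sigma> \<omega> = (\<Sum>b<r. h (\<sigma> ` D b) \<omega> - \<mu>) / real r" for \<sigma> \<omega>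
  have R_Av: "R \<omega> - \<mu> = (\<Sum>\<sigma>\<in>S. Av \<sigma> \<omega>) / real (card S)" for \<omega>
  proof -
    have "(\<Sum>\<sigma>\<in>S. h (\<sigma> ` D b) \<omega>) / real (card S) = R \<omega>" if "b < r" for b
      unfolding R_eq \<V>_def S_def by (rule sum_permutations_image) (use D[OF that] in auto)
    then have eq: "(\<Sum>\<sigma>\<in>S. h (\<sigma> ` D b) \<omega>) = real (card S) * R \<omega>" if "b < r" for b
      using that cS by (simp add: field_simps)
    have "(\<Sum>\<sigma>\<in>S. Av \<sigma> \<omega>) = (\<Sum>b<r. \<Sum>\<sigma>\<in>S. h (\<sigma> ` D b) \<omega> - \<mu>) / real r"
      unfolding Av_def sum_divide_distrib[symmetric] by (simp add: sum.swap[of _ S])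
    also have "(\<Sum>b<r. \<Sum>\<sigma>\<in>S. h (\<sigma> ` D b) \<omega> - \<mu>) = (\<Sum>b<r. real (card S) * R \<omega> - real (card S) * \<mu>)"
      by (intro sum.cong refl) (simp add: sum_subtractf eq)
    also have "\<dots> / real r = real (card S) * (R \<omega> - \<mu>)"
      using r by (simp add: right_diff_distrib[symmetric])
    finally show ?thesis using cS by simp
  qed
  have prod_eq: "exp (t * Av \<sigma> \<omega>) = (\<Prod>b<r. exp (t / real r * (h (\<sigma> ` D b) \<omega> - \<mu>)))" for \<sigma> \<omega>
  proof -
    have "t * Av \<sigma> \<omega> = (\<Sum>b<r. t / real r * (h (\<sigma> ` D b) \<omega> - \<mu>))"
      by (simp add: Av_def sum_distrib_left sum_divide_distrib)
    then show ?thesis by (simp add: exp_sum)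
  qed
  have ind: "indep_vars (\<lambda>_. borel) (\<lambda>b \<omega>. exp (t / real r * (h (\<sigma> ` D b) \<omega> - \<mu>))) {..<r}" if \<sigma>: "\<sigma> \<in> S" for \<sigma>
  proof (rule indep_h)
    show "disjoint_family_on (\<lambda>b. \<sigma> ` D b) {..<r}"
      unfolding disjoint_family_on_def
    proof (intro ballI impI)
      fix b b' :: nat assume "b \<noteq> b'"
      then have "D b \<inter> D b' = {}" using D_disj[of b b'] D_disj[of b' b] by (cases b b' rule: linorder_cases) auto
      moreover have "inj \<sigma>" using \<sigma> permutes_inj by (auto simp: S_def)
      ultimately show "\<sigma> ` D b \<inter> \<sigma> ` D b' = {}" by (simp add: image_Int[symmetric])
    qed
  qed (use \<sigma>V[OF \<sigma>] in auto)
  have intAv: "integrable M (\<lambda>\<omega>. exp (t * Av \<sigma> \<omega>))" if \<sigma>: "\<sigma> \<in> S" for \<sigma>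
    unfolding prod_eq
    by (rule indep_vars_integrable[OF finite_lessThan ind[OF \<sigma>]])
      (intro integrable_exp_h \<sigma>V[OF \<sigma>], simp)
  have EAv: "expectation (\<lambda>\<omega>. exp (t * Av \<sigma> \<omega>)) \<le> \<beta> ^ r" if \<sigma>: "\<sigma> \<in> S" for \<sigma>
  proof -
    have "expectation (\<lambda>\<omega>. exp (t * Av \<sigma> \<omega>)) = (\<Prod>b<r. expectation (\<lambda>\<omega>. exp (t / real r * (h (\<sigma> ` D b) \<omega> - \<mu>))))"
      unfolding prod_eq
      by (rule indep_vars_lebesgue_integral[OF finite_lessThan ind[OF \<sigma>]])
        (intro integrable_exp_h \<sigma>V[OF \<sigma>], simp)
    also have "\<dots> \<le> (\<Prod>b<r. \<beta>)"
    proof (rule prod_mono, rule conjI)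
      fix b assume "b \<in> {..<r}"
      then have "\<sigma> ` D b \<in> \<V>" by (intro \<sigma>V[OF \<sigma>]) simp
      from h_mgf[OF this, of "t / real r"] \<beta>
      show "expectation (\<lambda>\<omega>. exp (t / real r * (h (\<sigma> ` D b) \<omega> - \<mu>))) \<le> \<beta>" by (simp only:)
    qed simp
    finally show ?thesis by simp
  qed
  have le: "exp (t * (R \<omega> - \<mu>)) \<le> (\<Sum>\<sigma>\<in>S. exp (t * Av \<sigma> \<omega>)) / real (card S)" for \<omega>
    unfolding R_Av by (rule exp_average_le[OF S])
  have intS: "integrable M (\<lambda>\<omega>. (\<Sum>\<sigma>\<in>S. exp (t * Av \<sigma> \<omega>)) / real (card S))"
    using intAv by (intro integrable_divide Bochner_Integration.integrable_sum)
  show int: "integrable M (\<lambda>\<omega>. exp (t * (R \<omega> - \<mu>)))"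
  proof (rule Bochner_Integration.integrable_bound[OF intS], measurable, rule AE_I2)
    show "norm (exp (t * (R \<omega> - \<mu>))) \<le> norm ((\<Sum>\<sigma>\<in>S. exp (t * Av \<sigma> \<omega>)) / real (card S))" for \<omega>
      using order_trans[OF le[of \<omega>] abs_ge_self] by (simp only: real_norm_def abs_exp_cancel)
  qed
  have "expectation (\<lambda>\<omega>. exp (t * (R \<omega> - \<mu>))) \<le> expectation (\<lambda>\<omega>. (\<Sum>\<sigma>\<in>S. exp (t * Av \<sigma> \<omega>)) / real (card S))"
    by (rule integral_mono[OF int intS le])
  also have "\<dots> = (\<Sum>\<sigma>\<in>S. expectation (\<lambda>\<omega>. exp (t * Av \<sigma> \<omega>))) / real (card S)"
    using intAv by (simp add: Bochner_Integration.integral_sum)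
  also have "\<dots> \<le> (\<Sum>\<sigma>\<in>S. \<beta> ^ r) / real (card S)"
    by (intro divide_right_mono sum_mono EAv) auto
  also have "\<dots> = \<beta> ^ r" using cS by simp
  finally show "expectation (\<lambda>\<omega>. exp (t * (R \<omega> - \<mu>))) \<le> \<beta> ^ r" .
qed

abbreviation "tail_prob t \<equiv>
  max (prob {\<omega> \<in> space M. R \<omega> - expectation R > t}) (prob {\<omega> \<in> space M. expectation R - R \<omega> > t})"

lemma R_tail:
  assumes r: "r \<ge> 1" "r * m \<le> n" and l: "l \<ge> 0"
    and \<beta>: "(\<integral>u. exp (l / real r * W u) \<partial>Q) \<le> \<beta>" "(\<integral>u. exp (- l / real r * W u) \<partial>Q) \<le> \<beta>"
  shows "tail_prob t \<le> exp (- (l * t)) * \<beta> ^ r"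
proof (rule max.boundedI)
  have "prob {\<omega> \<in> space M. R \<omega> - \<mu> > t} \<le> exp (- (l * t)) * expectation (\<lambda>\<omega>. exp (l * (R \<omega> - \<mu>)))"
    by (rule chernoff_bound[OF _ R_mgf(1)[OF r \<beta>(1)] l]) measurable
  also have "\<dots> \<le> exp (- (l * t)) * \<beta> ^ r" by (intro mult_left_mono R_mgf(2)[OF r \<beta>(1)]) auto
  finally show "prob {\<omega> \<in> space M. R \<omega> - expectation R > t} \<le> exp (- (l * t)) * \<beta> ^ r" by (simp add: expectation_R)
  have eq: "- l * (R \<omega> - \<mu>) = l * (\<mu> - R \<omega>)" for \<omega> by (simp add: algebra_simps)
  have "prob {\<omega> \<in> space M. \<mu> - R \<omega> > t} \<le> exp (- (l * t)) * expectation (\<lambda>\<omega>. exp (l * (\<mu> - R \<omega>)))"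
    by (rule chernoff_bound[OF _ R_mgf(1)[OF r \<beta>(2), unfolded eq] l]) measurable
  also have "\<dots> \<le> exp (- (l * t)) * \<beta> ^ r"
    by (intro mult_left_mono R_mgf(2)[OF r \<beta>(2), unfolded eq]) auto
  finally show "prob {\<omega> \<in> space M. expectation R - R \<omega> > t} \<le> exp (- (l * t)) * \<beta> ^ r" by (simp add: expectation_R)
qed

lemma R_tail_subgaussian:
  assumes t: "t > 0"
  shows "tail_prob t \<le> exp (- (t\<^sup>2 / (320 * exp 1 * scale\<^sup>2)))"
proof -
  let ?a = "80 * exp 1 * scale\<^sup>2"
  have a: "?a > 0" using scale_pos by simp
  \<comment> \<open>The minimiser of the exponent \<open>?a * l\<^sup>2 - l * t\<close>.\<close>
  define l where "l = t / (2 * ?a)"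
  have l: "l \<ge> 0" using t a by (simp add: l_def)
  have "tail_prob t \<le> exp (- (l * t)) * exp (?a * l\<^sup>2) ^ 1"
    by (rule R_tail) (use p_pos p_le m_eq l W_mgf[of l] W_mgf[of "- l"] in auto)
  also have "\<dots> = exp (?a * l\<^sup>2 - l * t)" by (simp add: exp_add[symmetric] del: exp_add)
  also have "?a * l\<^sup>2 - l * t = - (t\<^sup>2 / (4 * ?a))"
    using a by (simp only: l_def) (simp add: power2_eq_square field_simps)
  finally show ?thesis by (simp add: mult.assoc)
qed

text \<open>Unless \<open>min A B'\<close> exceeds \<open>2 * exp 1 * (1 + ln r)\<close>, the
  right-hand side is at least 1. Otherwise \<open>chernoff_exponent\<close> supplies the parameter,
  measured in units of \<open>scale\<close> and multiplied by \<open>r\<close> because a block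
  enters the mean with weight \<open>1 / r\<close>.\<close>

lemma R_tail_bernstein:
  assumes t: "t > 0" and r: "r \<ge> 1" "r * m \<le> n"
  defines "T \<equiv> t / scale"
  defines "A \<equiv> real r * T\<^sup>2 * sqrt (real k) / (4096 * exp 1)"
    and "B' \<equiv> ((real r)\<^sup>2 * T\<^sup>2 / (4096 * exp 1)) powr (1 / 3)"
  shows "tail_prob t \<le> exp 1 * real r * exp (- (1 / (2 * exp 1) * min A B'))"
proof -
  have rhs: "exp 1 * real r * exp (- (1 / (2 * exp 1) * min A B')) = exp (1 + ln (real r) - min A B' / (2 * exp 1))"
  proof -
    have "1 + ln (real r) - min A B' / (2 * exp 1) = 1 + ln (real r) + - (1 / (2 * exp 1) * min A B')" by simp
    also have "exp \<dots> = exp 1 * exp (ln (real r)) * exp (- (1 / (2 * exp 1) * min A B'))"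
      by (simp only: exp_add)
    also have "exp (ln (real r)) = real r" using r by simp
    finally show ?thesis ..
  qed
  show ?thesis
  proof (cases "2 * exp 1 * (1 + ln (real r)) < min A B'")
    case True
    have T: "T > 0" using t scale_pos by (simp add: T_def)
    obtain \<theta> where \<theta>: "\<theta> \<ge> 0" and bound: "real r * (\<theta>\<^sup>2 / 2 *
        ((328 * exp (\<theta> * sqrt (330 * ln (real k))) + 1320 * exp (165 * \<theta>\<^sup>2)) / sqrt (real k))) - \<theta> * (real r * T)
      \<le> 1 + ln (real r) - min A B' / (2 * exp 1)"
      using chernoff_exponent[of "real r" "real k" T] r k_pos T True unfolding A_def B'_def by auto
    let ?\<psi> = "\<theta>\<^sup>2 / 2 * ((328 * exp (\<theta> * sqrt (330 * ln (real k))) + 1320 * exp (165 * \<theta>\<^sup>2)) / sqrt (real k))"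
    define l where "l = real r * \<theta> / scale"
    have l: "l \<ge> 0" using \<theta> scale_pos by (simp add: l_def)
    have lr: "l / real r = \<theta> / scale" "- l / real r = - \<theta> / scale" using r by (auto simp: l_def)
    have "tail_prob t
      \<le> exp (- (l * t)) * exp ?\<psi> ^ r"
    proof (rule R_tail[OF r l])
      show "(\<integral>u. exp (l / real r * W u) \<partial>Q) \<le> exp ?\<psi>" unfolding lr using W_bernstein[of \<theta>] \<theta> by simp
      show "(\<integral>u. exp (- l / real r * W u) \<partial>Q) \<le> exp ?\<psi>" unfolding lr using W_bernstein[of "- \<theta>"] \<theta> by simp
    qed
    also have "\<dots> = exp (real r * ?\<psi> - \<theta> * (real r * T))"
      by (simp add: exp_of_nat_mult[symmetric] exp_add[symmetric] l_def T_def mult_ac)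
    also have "\<dots> \<le> exp (1 + ln (real r) - min A B' / (2 * exp 1))" using bound by simp
    finally show ?thesis unfolding rhs .
  next
    case False
    then have "min A B' \<le> (1 + ln (real r)) * (2 * exp 1)" by (simp only: not_less mult.commute)
    then have "min A B' / (2 * exp 1) \<le> 1 + ln (real r)" by (intro mult_imp_div_pos_le) auto
    then have "1 \<le> exp (1 + ln (real r) - min A B' / (2 * exp 1))" by simp
    then show ?thesis unfolding rhs by (intro max.boundedI order_trans[OF prob_le_1]) auto
  qed
qed

end

section \<open>The concentration inequalities\<close>

text \<open>Among two points, each is the only candidate neighbour of the other. An almost sure
  property in a probability space holds for at least one configuration, and a single one
  suffices.\<close>

lemma stone_constant_ge_1:
  fixes D :: "(real ^ 'd) measure"
  assumes "prob_space D" and "AE x in Pi\<^sub>M {..<2} (\<lambda>_. D). stone_property \<gamma> 2 x"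
  shows "\<gamma> \<ge> 1"
proof -
  interpret prob_space "Pi\<^sub>M {..<2 :: nat} (\<lambda>_. D)" by (intro prob_space_PiM assms(1))
  obtain x :: "nat \<Rightarrow> real ^ 'd" where x: "stone_property \<gamma> 2 x"
    using eventually_happens'[OF _ assms(2)] by (auto simp: trivial_limit_def AE_False)
  let ?A = "{i \<in> {..<2} - {0}. 0 \<in> nearest 1 x ({..<2} - {i}) (x i)}"
  have "\<not> closer x (x 1) 0 0" by (simp add: closer_def)
  then have none: "{j \<in> {0}. closer x (x 1) j 0} = {}" by blast
  have "0 \<in> nearest 1 x {0} (x 1)" unfolding nearest_def mem_Collect_eq none by simp
  moreover have "{..<2 :: nat} - {1} = {0}" by auto
  ultimately have "1 \<in> ?A" by (intro CollectI conjI) (simp_all only:, simp)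
  then have "card {1 :: nat} \<le> card ?A" by (intro card_mono) auto
  moreover have "real (card ?A) \<le> real 1 * \<gamma>"
    using x unfolding stone_property_def by (elim allE[of _ 1] allE[of _ 0] impE) simp_all
  ultimately show ?thesis by simp
qed

text \<open>A single fair coin has standard deviation 1/2, so the right-hand side of the inequality
  with exponent 2 must be positive.\<close>

lemma moment_constant_pos:
  assumes mc: "moment_constant TYPE((real ^ 'd) \<times> bool) \<kappa>"
  shows "\<kappa> > 0"
proof (rule ccontr)
  assume neg: "\<not> \<kappa> > 0"
  define C where "C = (coin_law :: ((real ^ 'd) \<times> bool) measure)"
  define f :: "(nat \<Rightarrow> (real ^ 'd) \<times> bool) \<Rightarrow> real" where "f u = of_bool (snd (u 0))" for u
  let ?Q = "Pi\<^sub>M {..<1 :: nat} (\<lambda>_. C)"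
  have C: "prob_space C" unfolding C_def by (rule prob_space_coin_law)
  interpret Q: prob_space ?Q by (intro prob_space_PiM C)
  have m0: "(\<lambda>u. u 0) \<in> ?Q \<rightarrow>\<^sub>M C" by (rule measurable_component_singleton) simp
  have sC: "snd \<in> C \<rightarrow>\<^sub>M count_space UNIV" by (simp add: C_def measurable_cong_sets[OF sets_coin_law refl])
  have f[measurable]: "f \<in> borel_measurable ?Q"
    unfolding f_def using measurable_compose[OF measurable_compose[OF m0 sC] measurable_of_bool] by simp
  have law: "(\<integral>u. g (snd (u 0)) \<partial>?Q) = (g True + g False) / 2" for g :: "bool \<Rightarrow> real"
  proof -
    have gm: "(\<lambda>a. g (snd a)) \<in> borel_measurable C" by (rule measurable_compose[OF sC]) simp
    have "(\<integral>u. g (snd (u 0)) \<partial>?Q) = (\<integral>a. g (snd a) \<partial>distr ?Q C (\<lambda>u. u 0))"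
      by (rule integral_distr[OF m0 gm, symmetric])
    also have "distr ?Q C (\<lambda>u. u 0) = C" by (rule distr_PiM_component) (use C in auto)
    also have "(\<integral>a. g (snd a) \<partial>C) = (\<integral>b. g b \<partial>measure_pmf (bernoulli_pmf (1 / 2)))"
      using gm unfolding C_def coin_law_def by (subst integral_distr) (auto simp: space_pair_measure)
    also have "\<dots> = (g True + g False) / 2" by simp
    finally show ?thesis .
  qed
  have Ef: "(\<integral>u. f u \<partial>?Q) = 1 / 2" using law[of of_bool] by (simp add: f_def)
  have "(\<integral>u. \<bar>of_bool (snd (u 0)) - 1 / 2\<bar> powr 2 \<partial>?Q) = (1 / 4 :: real)"
    using law[of "\<lambda>b. \<bar>of_bool b - 1 / 2\<bar> powr 2"] by (simp add: power2_eq_square)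
  then have "Lnorm ?Q 2 (\<lambda>u. f u - (\<integral>v. f v \<partial>?Q)) = (1 / 4) powr (1 / 2)"
    unfolding Lnorm_def Ef by (simp only: f_def)
  then have pos: "Lnorm ?Q 2 (\<lambda>u. f u - (\<integral>v. f v \<partial>?Q)) > 0" by simp
  have "Lnorm ?Q 2 (\<lambda>u. f u - (\<integral>v. f v \<partial>?Q)) \<le> sqrt (2 * \<kappa> * 2) *
      sqrt (Lnorm (?Q \<Otimes>\<^sub>M ?Q) (2 / 2) (\<lambda>(u, u'). \<Sum>i<1. (f u - f (u(i := u' i)))\<^sup>2))"
    using mc[unfolded moment_constant_def Let_def, rule_format, of 1 "\<lambda>_. C" f 2] C f by simp
  \<comment> \<open>\<open>sqrt\<close> extends to negative arguments as an odd function, so for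
    \<open>\<kappa> \<le> 0\<close> the first factor is nonpositive.\<close>
  also have "\<dots> \<le> 0"
    using neg by (intro mult_nonpos_nonneg) (auto simp: Lnorm_def)
  finally show False using pos by simp
qed

theorem theorem4p2:
  fixes M :: "'w measure"
    and XX :: "(real ^ 'd) set"
    and X :: "nat \<Rightarrow> 'w \<Rightarrow> real ^ 'd"
    and Y :: "nat \<Rightarrow> 'w \<Rightarrow> bool"
    and P :: "((real ^ 'd) \<times> bool) measure"
    and B :: "nat set \<times> nat \<Rightarrow> 'w \<Rightarrow> bool"
    and n p k :: nat
    and \<gamma> \<kappa> :: real
    and R :: "'w \<Rightarrow> real"
  assumes "prob_space M"
    and "p \<ge> 1" and "k \<ge> 1" and "p + k \<le> n"
    and "\<And>i \<omega>. i \<in> {1..n} \<Longrightarrow> \<omega> \<in> space M \<Longrightarrow> X i \<omega> \<in> XX"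
    and data_indep: "prob_space.indep_vars M (\<lambda>_. borel \<Otimes>\<^sub>M count_space UNIV)
           (\<lambda>i \<omega>. (X i \<omega>, Y i \<omega>)) {1..n}"
    and data_law: "\<And>i. i \<in> {1..n} \<Longrightarrow>
           distr M (borel \<Otimes>\<^sub>M count_space UNIV) (\<lambda>\<omega>. (X i \<omega>, Y i \<omega>)) = P"
    and coins_indep: "prob_space.indep_vars M (\<lambda>_. count_space UNIV) B (lpo_coins n p)"
    and coins_law: "\<And>c. c \<in> lpo_coins n p \<Longrightarrow>
           distr M (count_space UNIV) (B c) = measure_pmf (bernoulli_pmf (1 / 2))"
    and data_coins_indep: "prob_space.indep_set M
           (sets (vimage_algebra (space M) (\<lambda>\<omega>. \<lambda>i\<in>{1..n}. (X i \<omega>, Y i \<omega>))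
              (Pi\<^sub>M {1..n} (\<lambda>_. borel \<Otimes>\<^sub>M count_space UNIV))))
           (sets (vimage_algebra (space M) (\<lambda>\<omega>. \<lambda>c\<in>lpo_coins n p. B c \<omega>)
              (Pi\<^sub>M (lpo_coins n p) (\<lambda>_. count_space UNIV))))"
    and stone: "stone_constant TYPE('d) \<gamma>"
    and stone_AE: "\<And>m. AE x in Pi\<^sub>M {..<m} (\<lambda>_. distr P borel fst). stone_property \<gamma> m x"
    and kappa: "\<kappa> \<le> 1.271" "moment_constant TYPE((real ^ 'd) \<times> bool) \<kappa>"
    and R_def: "R = (\<lambda>\<omega>. lpo n p k (\<lambda>i. X i \<omega>) (\<lambda>i. Y i \<omega>) (\<lambda>c. B c \<omega>))"
  shows "(\<forall>t>0.
            max (measure M {\<omega> \<in> space M. R \<omega> - (\<integral>\<omega>. R \<omega> \<partial>M) > t})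
                (measure M {\<omega> \<in> space M. (\<integral>\<omega>. R \<omega> \<partial>M) - R \<omega> > t})
            \<le> exp (- (real (n - p + 1) * (t\<^sup>2 / ((Delta \<gamma> \<kappa>)\<^sup>2 * (real k)\<^sup>2))))) \<and>
         (real p > real n / 2 + 1 \<longrightarrow> (\<forall>t>0.
            max (measure M {\<omega> \<in> space M. R \<omega> - (\<integral>\<omega>. R \<omega> \<partial>M) > t})
                (measure M {\<omega> \<in> space M. (\<integral>\<omega>. R \<omega> \<partial>M) - R \<omega> > t})
            \<le> exp 1 * real_of_int \<lfloor>real n / real (n - p + 1)\<rfloor> *
              exp (- (1 / (2 * exp 1) *
                min (real (n - p + 1) * real_of_int \<lfloor>real n / real (n - p + 1)\<rfloor> *
                       (t\<^sup>2 / (4 * (Gamma_const \<gamma> \<kappa>)\<^sup>2 * real k powr (3 / 2))))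
                    ((real (n - p + 1) * (real_of_int \<lfloor>real n / real (n - p + 1)\<rfloor>)\<^sup>2 *
                       (t\<^sup>2 / (4 * (Gamma_const \<gamma> \<kappa>)\<^sup>2 * (real k)\<^sup>2))) powr (1 / 3))))))"
proof -
  interpret prob_space M by fact
  define m where "m = n - p + 1"
  have pn: "p \<le> n" "1 \<in> {1..n}" using \<open>p \<ge> 1\<close> \<open>p + k \<le> n\<close> by auto
  have Z1: "(\<lambda>\<omega>. (X 1 \<omega>, Y 1 \<omega>)) \<in> M \<rightarrow>\<^sub>M borel \<Otimes>\<^sub>M count_space UNIV"
    using data_indep pn(2) by (simp add: indep_vars_def)
  have P: "prob_space P" using prob_space_distr[OF Z1] data_law[OF pn(2)] by simp
  have sets_P: "sets P = sets (borel \<Otimes>\<^sub>M count_space UNIV)" using data_law[OF pn(2)] sets_distr by metis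
  have "fst \<in> P \<rightarrow>\<^sub>M borel" by (simp add: measurable_cong_sets[OF sets_P refl])
  then have "prob_space (distr P borel fst)" by (rule prob_space.prob_space_distr[OF P])
  then have \<gamma>: "\<gamma> \<ge> 1" using stone_AE[of 2] by (rule stone_constant_ge_1)
  have \<kappa>: "\<kappa> > 0" using kappa(2) by (rule moment_constant_pos)
  have "k < m" using \<open>p + k \<le> n\<close> by (simp add: m_def)
  then have loo: "loo_model P m k \<gamma> \<kappa>"
    by (intro loo_model.intro P sets_P \<gamma> \<kappa> stone_AE kappa(2) \<open>k \<ge> 1\<close>)
  interpret lpo: lpo_model M P n p m k \<gamma> \<kappa> X Y B
    by (intro lpo_model.intro lpo_model_axioms.intro loo m_def)
      (fact \<open>prob_space M\<close> \<open>p \<ge> 1\<close> pn(1) data_indep data_law coins_indep coins_law data_coins_indep)+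
  have R: "R = lpo.R" unfolding R_def lpo.R_def[abs_def] ..
  have m: "m > 0" "real m > 0" by (auto simp: m_def)
  have k0: "real k > 0" using \<open>k \<ge> 1\<close> by simp
  have scale: "lpo.scale\<^sup>2 = (real k)\<^sup>2 * \<kappa> * \<gamma>\<^sup>2 / real m" by (rule lpo.scale_square)
  have part1: "max (prob {\<omega> \<in> space M. R \<omega> - (\<integral>\<omega>. R \<omega> \<partial>M) > t}) (prob {\<omega> \<in> space M. (\<integral>\<omega>. R \<omega> \<partial>M) - R \<omega> > t})
      \<le> exp (- (real (n - p + 1) * (t\<^sup>2 / ((Delta \<gamma> \<kappa>)\<^sup>2 * (real k)\<^sup>2))))" if t: "t > 0" for t
  proof -
    \<comment> \<open>The first entry of the maximum in \<open>Delta\<close> is enough: its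
      contribution \<open>16 * 16 * 2 = 512\<close> exceeds the 320 of the subgaussian
      bound.\<close>
    have "4 * \<gamma> * sqrt (2 * \<kappa>) \<le> max (4 * \<gamma> * sqrt (2 * \<kappa>)) (sqrt (2 + 16 * \<gamma>))" by simp
    then have "(4 * sqrt (exp 1) * (4 * \<gamma> * sqrt (2 * \<kappa>)))\<^sup>2 \<le> (Delta \<gamma> \<kappa>)\<^sup>2"
      unfolding Delta_def using \<gamma> \<kappa> by (intro power_mono mult_left_mono) auto
    moreover have "(4 * sqrt (exp 1) * (4 * \<gamma> * sqrt (2 * \<kappa>)))\<^sup>2 = 512 * (exp 1 * (\<kappa> * \<gamma>\<^sup>2))"
      using \<kappa> by (simp add: power_mult_distrib)
    moreover have "0 \<le> exp 1 * (\<kappa> * \<gamma>\<^sup>2)" using \<kappa> by simp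
    ultimately have "320 * (exp 1 * (\<kappa> * \<gamma>\<^sup>2)) \<le> (Delta \<gamma> \<kappa>)\<^sup>2" by linarith
    then have D: "320 * exp 1 * (\<kappa> * \<gamma>\<^sup>2) \<le> (Delta \<gamma> \<kappa>)\<^sup>2" by (simp only: mult.assoc)
    have pos: "0 < 320 * exp 1 * (\<kappa> * \<gamma>\<^sup>2)" using \<kappa> \<gamma> by simp
    have Dp: "0 < (Delta \<gamma> \<kappa>)\<^sup>2" using D pos by linarith
    have "real m * (t\<^sup>2 / ((Delta \<gamma> \<kappa>)\<^sup>2 * (real k)\<^sup>2)) \<le> real m * (t\<^sup>2 / (320 * exp 1 * (\<kappa> * \<gamma>\<^sup>2) * (real k)\<^sup>2))"
    proof (intro mult_left_mono divide_left_mono mult_right_mono D)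
      show "0 < (Delta \<gamma> \<kappa>)\<^sup>2 * (real k)\<^sup>2 * (320 * exp 1 * (\<kappa> * \<gamma>\<^sup>2) * (real k)\<^sup>2)"
        using k0 by (intro mult_pos_pos Dp pos zero_less_power)
    qed auto
    also have "\<dots> = t\<^sup>2 / (320 * exp 1 * lpo.scale\<^sup>2)"
      unfolding scale using m by (simp add: field_simps)
    finally have "exp (- (t\<^sup>2 / (320 * exp 1 * lpo.scale\<^sup>2))) \<le>
        exp (- (real m * (t\<^sup>2 / ((Delta \<gamma> \<kappa>)\<^sup>2 * (real k)\<^sup>2))))" by simp
    with lpo.R_tail_subgaussian[OF t] show ?thesis unfolding R m_def[symmetric] by (rule order_trans)
  qed
  have part2: "max (prob {\<omega> \<in> space M. R \<omega> - (\<integral>\<omega>. R \<omega> \<partial>M) > t}) (prob {\<omega> \<in> space M. (\<integral>\<omega>. R \<omega> \<partial>M) - R \<omega> > t})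
            \<le> exp 1 * real_of_int \<lfloor>real n / real (n - p + 1)\<rfloor> *
              exp (- (1 / (2 * exp 1) *
                min (real (n - p + 1) * real_of_int \<lfloor>real n / real (n - p + 1)\<rfloor> *
                       (t\<^sup>2 / (4 * (Gamma_const \<gamma> \<kappa>)\<^sup>2 * real k powr (3 / 2))))
                    ((real (n - p + 1) * (real_of_int \<lfloor>real n / real (n - p + 1)\<rfloor>)\<^sup>2 *
                       (t\<^sup>2 / (4 * (Gamma_const \<gamma> \<kappa>)\<^sup>2 * (real k)\<^sup>2))) powr (1 / 3))))" if t: "t > 0" for t
  proof -
    define r where "r = n div m"
    have fl: "real_of_int \<lfloor>real n / real m\<rfloor> = real r"
      by (simp add: r_def floor_divide_of_nat_eq)
    have "m \<le> n" using \<open>p \<ge> 1\<close> pn by (simp add: m_def)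
    then have r: "r \<ge> 1" "r * m \<le> n" using m by (auto simp: r_def div_greater_zero_iff Suc_le_eq)
    \<comment> \<open>The second entry of the maximum in \<open>Gamma_const\<close> dominates
      because \<open>2 \<le> sqrt (2 * pi)\<close> and \<open>\<gamma> \<ge> 1\<close>. Hence
      \<open>4 * (Gamma_const \<gamma> \<kappa>)\<^sup>2\<close> equals
      \<open>4096 * exp 1 * (\<kappa> * \<gamma>\<^sup>2)\<close>, the source of the 4096 in
      \<open>A\<close> and \<open>B\<close>.\<close>
    have "sqrt (2 * (128 * \<kappa> * \<gamma> / sqrt (2 * pi))) \<le> 8 * \<gamma> * sqrt (2 * \<kappa>)"
    proof -
      have "2\<^sup>2 \<le> 2 * pi" using pi_gt3 by simp
      then have "2 \<le> sqrt (2 * pi)" by (rule real_le_rsqrt)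
      then have "2 * (128 * \<kappa> * \<gamma> / sqrt (2 * pi)) \<le> 2 * (128 * \<kappa> * \<gamma> / 2)"
        using \<kappa> \<gamma> by (intro mult_left_mono divide_left_mono) auto
      also have "\<dots> \<le> 128 * \<kappa> * (\<gamma> * \<gamma>)" using \<kappa> \<gamma> by simp
      also have "\<dots> = (8 * \<gamma> * sqrt (2 * \<kappa>))\<^sup>2" using \<kappa> by (simp add: power_mult_distrib power2_eq_square[of \<gamma>])
      finally show ?thesis using \<gamma> \<kappa> by (intro real_le_lsqrt) auto
    qed
    then have "Gamma_const \<gamma> \<kappa> = 2 * sqrt (2 * exp 1) * (8 * \<gamma> * sqrt (2 * \<kappa>))"
      unfolding Gamma_const_def by (simp add: max_def)
    then have G: "4 * (Gamma_const \<gamma> \<kappa>)\<^sup>2 = 4096 * exp 1 * (\<kappa> * \<gamma>\<^sup>2)"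
      using \<kappa> by (simp add: power_mult_distrib)
    have k32: "real k powr (3 / 2) = (real k)\<^sup>2 / sqrt (real k)"
    proof -
      have "real k powr (3 / 2) = real k powr (2 - 1 / 2)" by simp
      also have "\<dots> = real k powr 2 / real k powr (1 / 2)" by (rule powr_diff)
      finally show ?thesis using k0 by (simp add: powr_half_sqrt)
    qed
    have T: "(t / lpo.scale)\<^sup>2 = real m * t\<^sup>2 / ((real k)\<^sup>2 * (\<kappa> * \<gamma>\<^sup>2))"
      unfolding power_divide scale by (simp add: mult_ac)
    have A: "real m * real r * (t\<^sup>2 / (4096 * exp 1 * (\<kappa> * \<gamma>\<^sup>2) * ((real k)\<^sup>2 / sqrt (real k)))) =
        real r * (t / lpo.scale)\<^sup>2 * sqrt (real k) / (4096 * exp 1)"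
      unfolding T by (simp add: mult_ac)
    have B: "real m * (real r)\<^sup>2 * (t\<^sup>2 / (4096 * exp 1 * (\<kappa> * \<gamma>\<^sup>2) * (real k)\<^sup>2)) =
        (real r)\<^sup>2 * (t / lpo.scale)\<^sup>2 / (4096 * exp 1)"
      unfolding T by (simp add: mult_ac)
    show ?thesis
      using lpo.R_tail_bernstein[OF t r] unfolding R m_def[symmetric] fl G k32 A B .
  qed
  show ?thesis using part1 part2 by blast
qed

end
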